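(* Let $A$ and $B$ be real $n\times n$ matrices whose eigenvalues all have positive real parts. Denote by $\lambda_1$ and $\mu_1$ the smallest real parts of the eigenvalues of $A$ and $B$ respectively, and set $\epsilon=\lambda_1/\mu_1$. If the real part Jordan form of $A$ is not a multiple of the identity matrix $I_n$, then for every quasisymmetric map $F:(\mathbb R^n,D_A)\to(\mathbb R^n,D_B)$, the map $F:(\mathbb R^n,D_A^{\epsilon})\to(\mathbb R^n,D_B)$ is biLipschitz.
   Context: For a real $n\times n$ matrix $A$ whose eigenvalues all have positive real parts, $G_A=\mathbb R^n\rtimes_A\mathbb R$ is the Lie group with group law $(x_1,t_1)\cdot(x_2,t_2)=(x_1+e^{t_1A}x_2,\,t_1+t_2)$. An admissible metric on $G_A$ is a left invariant Riemannian metric for which the $\mathbb R$ direction is perpendicular to the $\mathbb R^n$ factor; the standard metric is the left invariant metric given by the standard inner product at the identity $(0,0)$. Each of $G_A$, $G_B$ is equipped with an arbitrary admissible metric. Parabolic visual quasimetric: let $\|\cdot\|$ be the norm on $\mathbb R^n$ given by the admissible inner product at the identity (the Euclidean norm for the standard metric). The distance induced on $\mathbb R^n\times\{t\}\subset G_A$ is $d_{A,t}((x,t),(y,t))=\|e^{-tA}(x-y)\|$. For $x\ne y$ in $\mathbb R^n$, $D_A(x,y)=e^t$ where $t$ is the smallest real number with $\|e^{-tA}(x-y)\|=1$; $D_A(x,x)=0$. This is a quasimetric on $\mathbb R^n$ (symmetric, nonnegative, zero exactly on the diagonal, and $D_A(x,z)\le M(D_A(x,y)+D_A(y,z))$ for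 some constant $M\ge1$). $D_B$ is defined likewise from $G_B$. $D_A^\epsilon(x,y)=(D_A(x,y))^\epsilon$. Real part Jordan form of $A$: the matrix obtained from the (complex) Jordan form of $A$ by replacing each diagonal entry by its real part and reordering the blocks to make it canonical. A bijection $F:X\to Y$ between quasimetric spaces is $\eta$-quasisymmetric, for a homeomorphism $\eta:[0,\infty)\to[0,\infty)$, if $\frac{\rho(F(x),F(y))}{\rho(F(x),F(z))}\le\eta\left(\frac{\rho(x,y)}{\rho(x,z)}\right)$ for all distinct triples $x,y,z\in X$; it is quasisymmetric if it is $\eta$-quasisymmetric for some $\eta$. A map is biLipschitz if it is a bijection and for some $L\ge1$, $\frac1L\rho(x,y)\le\rho(F(x),F(y))\le L\rho(x,y)$ for all $x,y$. *)

theory Defs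
  imports
    "HOL-Analysis.Analysis"
    "Jordan_Normal_Form.Jordan_Normal_Form"
    "Jordan_Normal_Form.Spectral_Radius"
begin

text \<open>
  Geometry uses the matrix type \<open>real^'n^'n\<close> of HOL-Analysis; eigenvalues and Jordan forms
  use the matrix type of the AFP entry Jordan_Normal_Form, reached through \<open>cmat_of\<close>.
\<close>

text \<open>
  The index type is enumerated by \<open>from_nat_into UNIV\<close>, a bijection from
  \<open>{..<CARD('n)}\<close> onto \<open>UNIV\<close>.  Another enumeration would give a
  permutation-similar matrix, hence the same spectrum and the same Jordan forms.
\<close>

definition cmat_of :: "real^'n^'n \<Rightarrow> complex Matrix.mat" where
  "cmat_of A = Matrix.mat CARD('n) CARD('n)
     (\<lambda>(i, j). complex_of_real
        (vec_nth (vec_nth A (from_nat_into UNIV i)) (from_nat_into UNIV j)))"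

definition eigenvalue_re_parts :: "real^'n^'n \<Rightarrow> real set" where
  "eigenvalue_re_parts A = Re ` spectrum (cmat_of A)"

text \<open>
  The canonical order of the blocks is by increasing diagonal entry and, for equal
  entries, by decreasing size.
\<close>

definition canonical_block_order :: "(nat \<times> real) list \<Rightarrow> bool" where
  "canonical_block_order bs \<longleftrightarrow>
     sorted_wrt (\<lambda>(k, a) (l, b). a < b \<or> (a = b \<and> l \<le> k)) bs"

definition real_part_jordan_form :: "real^'n^'n \<Rightarrow> real Matrix.mat \<Rightarrow> bool" where
  "real_part_jordan_form A J \<longleftrightarrow>
     (\<exists>cs bs. jordan_nf (cmat_of A) cs \<and>
        mset bs = mset (map (\<lambda>(k, z). (k, Re z)) cs) \<and>
        canonical_block_order bs \<and> J = jordan_matrix bs)"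

text \<open>
  \<open>real^'n^'n\<close> is not an instance of \<open>real_normed_algebra_1\<close> with respect to the
  matrix product, so the library's \<open>exp\<close> does not apply to it.
\<close>

definition matrix_exp :: "real^'n^'n \<Rightarrow> real^'n^'n" where
  "matrix_exp A = (\<Sum>k. (1 / fact k) *\<^sub>R (((**) A ^^ k) (Finite_Cartesian_Product.mat 1)))"

definition GA_mult ::
    "real^'n^'n \<Rightarrow> (real^'n) \<times> real \<Rightarrow> (real^'n) \<times> real \<Rightarrow> (real^'n) \<times> real" where
  "GA_mult A p q = (fst p + matrix_exp (snd p *\<^sub>R A) *v fst q, snd p + snd q)"

definition inner_product_form :: "('v::real_vector \<Rightarrow> 'v \<Rightarrow> real) \<Rightarrow> bool" where
  "inner_product_form g \<longleftrightarrow>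
     bilinear g \<and> (\<forall>v w. g v w = g w v) \<and> (\<forall>v. v \<noteq> 0 \<longrightarrow> g v v > 0)"

text \<open>
  The tangent space of the group at a point \<open>p\<close> is identified with \<open>(real^'n) \<times> real\<close>, and
  \<open>g p\<close> is the inner product there.  Smoothness of \<open>g\<close> in \<open>p\<close> need not be required
  separately: a left invariant \<open>g\<close> is determined by its value at the identity through the
  smooth group law.
\<close>

definition left_invariant_metric ::
    "real^'n^'n \<Rightarrow>
     ((real^'n) \<times> real \<Rightarrow> (real^'n) \<times> real \<Rightarrow> (real^'n) \<times> real \<Rightarrow> real) \<Rightarrow> bool" where
  "left_invariant_metric A g \<longleftrightarrow>
     (\<forall>p. inner_product_form (g p)) \<and>
     (\<forall>p q dL. (GA_mult A p has_derivative dL) (at q) \<longrightarrow>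
        (\<forall>v w. g (GA_mult A p q) (dL v) (dL w) = g q v w))"

definition admissible_metric ::
    "real^'n^'n \<Rightarrow>
     ((real^'n) \<times> real \<Rightarrow> (real^'n) \<times> real \<Rightarrow> (real^'n) \<times> real \<Rightarrow> real) \<Rightarrow> bool" where
  "admissible_metric A g \<longleftrightarrow>
     left_invariant_metric A g \<and> (\<forall>p x t. g p (x, 0) (0, t) = 0)"

definition identity_norm ::
    "((real^'n) \<times> real \<Rightarrow> (real^'n) \<times> real \<Rightarrow> (real^'n) \<times> real \<Rightarrow> real) \<Rightarrow>
     real^'n \<Rightarrow> real" where
  "identity_norm g x = sqrt (g (0, 0) (x, 0) (x, 0))"

definition slice_dist ::
    "real^'n^'n \<Rightarrow>
     ((real^'n) \<times> real \<Rightarrow> (real^'n) \<times> real \<Rightarrow> (real^'n) \<times> real \<Rightarrow> real) \<Rightarrow>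
     real \<Rightarrow> real^'n \<Rightarrow> real^'n \<Rightarrow> real" where
  "slice_dist A g t x y = identity_norm g (matrix_exp ((- t) *\<^sub>R A) *v (x - y))"

definition visual_qmetric ::
    "real^'n^'n \<Rightarrow>
     ((real^'n) \<times> real \<Rightarrow> (real^'n) \<times> real \<Rightarrow> (real^'n) \<times> real \<Rightarrow> real) \<Rightarrow>
     real^'n \<Rightarrow> real^'n \<Rightarrow> real" where
  "visual_qmetric A g x y =
     (if x = y then 0 else exp (LEAST t. slice_dist A g t x y = 1))"

definition quasisymmetric ::
    "('a \<Rightarrow> 'a \<Rightarrow> real) \<Rightarrow> ('b \<Rightarrow> 'b \<Rightarrow> real) \<Rightarrow> ('a \<Rightarrow> 'b) \<Rightarrow> bool" where
  "quasisymmetric \<rho> \<sigma> F \<longleftrightarrow>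
     bij F \<and>
     (\<exists>\<eta> \<eta>'. homeomorphism {0::real..} {0::real..} \<eta> \<eta>' \<and>
        (\<forall>x y z. x \<noteq> y \<and> y \<noteq> z \<and> x \<noteq> z \<longrightarrow>
           \<sigma> (F x) (F y) / \<sigma> (F x) (F z) \<le> \<eta> (\<rho> x y / \<rho> x z)))"

definition biLipschitz ::
    "('a \<Rightarrow> 'a \<Rightarrow> real) \<Rightarrow> ('b \<Rightarrow> 'b \<Rightarrow> real) \<Rightarrow> ('a \<Rightarrow> 'b) \<Rightarrow> bool" where
  "biLipschitz \<rho> \<sigma> F \<longleftrightarrow>
     bij F \<and>
     (\<exists>L\<ge>1. \<forall>x y. (1 / L) * \<rho> x y \<le> \<sigma> (F x) (F y) \<and> \<sigma> (F x) (F y) \<le> L * \<rho> x y)"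

end

theory Submission
  imports Defs
begin

text \<open>
  For a function \<open>u\<close> and an exponent \<open>Q\<close>, consider the sums of the \<open>Q\<close>-th powers of the
  oscillations of \<open>u\<close> on (enlarged) disjoint balls in a bounded region.  Boundedness of these
  sums is invariant under quasisymmetric maps, hence so is the set \<open>H\<close> of all translations that
  leave every such function invariant.  \<open>H\<close> is a closed subgroup invariant under the dilations
  \<open>e\<^sup>t\<^sup>A\<close>, hence a linear subspace, and \<open>F\<close> maps cosets of \<open>H\<close> to cosets of the corresponding
  subspace \<open>H'\<close>.  When the real part Jordan form is not scalar, some \<open>Q\<close> makes \<open>H\<close> a proper
  nonzero subspace: with \<open>Q\<close> the trace of \<open>A\<close> divided by \<open>b\<close>, where \<open>b\<close> is the real part of an
  eigenvalue with a block of size at least two or, if there is none, a real part that is not the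
  smallest one, a left eigenvector gives an admissible function, while a length-area argument
  gives invariant directions.

  Parallel cosets have constant distance.  Therefore the scale \<open>S x r\<close> to which \<open>F\<close> takes
  radius \<open>r\<close> at \<open>x\<close> is, up to constants, the same along a coset of \<open>H\<close>, and counting separated
  points in a coset forces \<open>S x r\<close> to be a power of \<open>r\<close> with a factor independent of \<open>x\<close>.  So
  \<open>F\<close> is biLipschitz for some power of \<open>D\<^sub>A\<close>, and the exponent is determined by subdividing
  segments along slowest directions of \<open>A\<close> and \<open>B\<close>.
\<close>

section \<open>Spaces with a dilation flow\<close>

hide_const (open) VectorSpace.subspace Determinant.det
no_notation Matrix.vec_index (infixl "$" 100)

text \<open>The gauge \<open>rho\<close> is not assumed continuous or measurable:
  \<open>norm (T (- t) x)\<close> may cross 1 several times. What remains is homogeneity and the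
  norm bounds on the unit sphere of \<open>rho\<close>; hence volumes are those of dilated norm
  balls, and covers come from maximal separated sets.

  The exponent \<open>Q = tau / b\<close> is critical. A functional growing like
  \<open>exp (b * t)\<close> varies by \<open>r powr b\<close> on a ball of radius \<open>r\<close>,
  and the \<open>Q\<close>-th power of this is the volume \<open>r powr tau\<close>. Conversely, a
  displacement stretched by \<open>T s\<close> to less than order \<open>exp (b * s)\<close> is
  crossed in that many steps of size \<open>exp (- s)\<close>, while the mean variation per step is
  of order \<open>exp (- (b * s))\<close>. In a Jordan block the saving is only a factor
  \<open>1 / s\<close> and is visible only on vectors that vary with \<open>s\<close>; hence
  invariant directions arise as limits.

  Nothing is known about the Jordan form of \<open>B\<close>. That \<open>H'\<close> is proper and
  nonzero is read off from \<open>H\<close> through \<open>F\<close>, and the ratio of the two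
  growth exponents is identified only afterwards.\<close>

lemma exp_decay_tendsto:
  fixes C k M :: real
  assumes "k > 0"
  shows "((\<lambda>t. C * exp (k * (- t)) * M) \<longlongrightarrow> 0) at_top"
proof -
  have "filterlim (\<lambda>t::real. k * t) at_top at_top"
    using assms by (intro filterlim_tendsto_pos_mult_at_top[OF tendsto_const] filterlim_ident)
  then have "((\<lambda>t. C * exp (k * (- t)) * M) \<longlongrightarrow> C * 0 * M) at_top"
    by (intro tendsto_intros filterlim_compose[OF exp_at_bot]) (simp add: filterlim_uminus_at_bot)
  then show ?thesis by simp
qed

text \<open>\<open>T\<close> models the exponential of \<open>t\<close> times a matrix,
  \<open>X\<close> that matrix, and \<open>rho (x - y)\<close> the visual quasimetric, which is
  translation invariant.\<close>

locale dilation_space =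
  fixes T :: "real \<Rightarrow> real^'n::{finite,wellorder} \<Rightarrow> real^'n::{finite,wellorder}"
    and X :: "real^'n::{finite,wellorder} \<Rightarrow> real^'n::{finite,wellorder}"
    and rho :: "real^'n::{finite,wellorder} \<Rightarrow> real"
  assumes T_linear: "linear (T t)"
    and T_0 [simp]: "T 0 x = x"
    and T_add: "T (s + t) x = T s (T t x)"
    and T_deriv0: "((\<lambda>t. T t x) has_vector_derivative X x) (at 0)"
    and T_contract: "\<exists>C>0. \<exists>k>0. \<forall>t\<le>0. \<forall>x. norm (T t x) \<le> C * exp (k * t) * norm x"
    and rho_0 [simp]: "rho 0 = 0"
    and rho_pos: "x \<noteq> 0 \<Longrightarrow> rho x > 0"
    and rho_minus [simp]: "rho (- x) = rho x"
    and rho_T: "rho (T t x) = exp t * rho x"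
    and rho_unit: "\<exists>c>0. \<exists>C. \<forall>x. rho x = 1 \<longrightarrow> c \<le> norm x \<and> norm x \<le> C"
begin

lemma T_simps [simp]: "T t 0 = 0" "T t (x + y) = T t x + T t y" "T t (x - y) = T t x - T t y"
  "T t (c *\<^sub>R x) = c *\<^sub>R T t x" "T t (- x) = - T t x"
  using T_linear[of t] by (auto simp: linear_0 linear_add linear_diff linear_scale linear_neg)

lemma T_inv [simp]: "T (- t) (T t x) = x" "T t (T (- t) x) = x"
  using T_add[of "-t" t x] T_add[of t "-t" x] by simp_all

lemma rho_nonneg [simp]: "rho x \<ge> 0"
  using rho_pos[of x] by (cases "x = 0") auto

lemma rho_eq_0_iff [simp]: "rho x = 0 \<longleftrightarrow> x = 0"
  using rho_pos[of x] by (cases "x = 0") auto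

lemma rho_pos_iff [simp]: "rho x > 0 \<longleftrightarrow> x \<noteq> 0"
  using rho_pos[of x] by (cases "x = 0") auto

lemma rho_commute: "rho (x - y) = rho (y - x)"
  using rho_minus[of "x - y"] by simp

lemma T_bounded: "\<exists>B>0. \<forall>x. norm (T t x) \<le> B * norm x"
  using linear_bounded_pos[OF T_linear[of t]] by (auto simp: mult.commute)

lemma unit_rep:
  assumes "x \<noteq> 0"
  shows "rho (T (- ln (rho x)) x) = 1"
  using assms rho_pos[of x] by (simp add: rho_T exp_minus)

lemma T_contract1: "\<exists>C\<ge>1. \<exists>k>0. \<forall>t\<le>0. \<forall>x. norm (T t x) \<le> C * exp (k * t) * norm x"
proof -
  obtain C k where C: "C > 0" "k > 0" "\<forall>t\<le>0. \<forall>x. norm (T t x) \<le> C * exp (k * t) * norm x"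
    using T_contract by blast
  have "norm (T t x) \<le> max 1 C * exp (k * t) * norm x" if "t \<le> 0" for t x
    using C(3)[rule_format, OF that, of x]
    by (smt (verit, best) exp_ge_zero mult_right_mono norm_ge_zero)
  then show ?thesis using C(2) by (intro exI[of _ "max 1 C"]) auto
qed

text \<open>A point with \<open>rho x \<ge> 1\<close> is brought to the unit sphere of
  \<open>rho\<close> by a contracting \<open>T t\<close>, which increases the norm at most by the
  factor \<open>C\<close>; so its norm is at least \<open>c / C\<close>.\<close>

lemma small_norm_rho: "\<exists>c>0. \<forall>x. norm x < c \<longrightarrow> rho x < 1"
proof -
  obtain C k where C: "C \<ge> 1" "k > 0" "\<And>t x. t \<le> 0 \<Longrightarrow> norm (T t x) \<le> C * exp (k * t) * norm x"
    using T_contract1 by blast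
  obtain c where c: "c > 0" "\<And>x. rho x = 1 \<Longrightarrow> c \<le> norm x" using rho_unit by blast
  have "rho x < 1" if "norm x < c / C" for x
  proof (rule ccontr)
    assume "\<not> rho x < 1"
    then have r: "rho x \<ge> 1" and x: "x \<noteq> 0" by (auto simp: not_less)
    then have "c \<le> norm (T (- ln (rho x)) x)" using unit_rep c by blast
    also have "\<dots> \<le> C * exp (k * (- ln (rho x))) * norm x" using r by (intro C(3)) auto
    also have "\<dots> \<le> C * 1 * norm x"
      using C r by (intro mult_right_mono mult_left_mono) auto
    also have "\<dots> < c" using that C(1) by (simp add: field_simps)
    finally show False by simp
  qed
  then show ?thesis using c(1) C(1) by (intro exI[of _ "c / C"]) auto
qed

text \<open>For large \<open>t\<close> the map \<open>T (- t)\<close> takes the ball of radius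
  \<open>R\<close> into the ball of \<open>small_norm_rho\<close>; homogeneity turns this into the
  bound \<open>exp t\<close>.\<close>

lemma norm_le_rho_le: "\<exists>M>0. \<forall>x. norm x \<le> R \<longrightarrow> rho x \<le> M"
proof -
  obtain C k where C: "C \<ge> 1" "k > 0" "\<And>t x. t \<le> 0 \<Longrightarrow> norm (T t x) \<le> C * exp (k * t) * norm x"
    using T_contract1 by blast
  obtain c where c: "c > 0" "\<And>x. norm x < c \<Longrightarrow> rho x < 1" using small_norm_rho by blast
  have "eventually (\<lambda>t. C * exp (k * (- t)) * \<bar>R\<bar> < c) at_top"
    using order_tendstoD(2)[OF exp_decay_tendsto[OF C(2)] c(1)] .
  then have "eventually (\<lambda>t. C * exp (k * (- t)) * \<bar>R\<bar> < c \<and> t \<ge> 0) at_top"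
    by (intro eventually_conj eventually_ge_at_top)
  then obtain t where t: "C * exp (k * (- t)) * \<bar>R\<bar> < c" "t \<ge> 0"
    using eventually_happens by fastforce
  have "rho x \<le> exp t" if "norm x \<le> R" for x
  proof -
    have "norm (T (-t) x) \<le> C * exp (k * (- t)) * norm x" using t by (intro C(3)) auto
    also have "\<dots> \<le> C * exp (k * (- t)) * \<bar>R\<bar>" using that C(1) by (intro mult_left_mono) auto
    also have "\<dots> < c" by fact
    finally have "rho (T (-t) x) < 1" by (rule c(2))
    then show ?thesis by (simp add: rho_T exp_minus field_simps)
  qed
  then show ?thesis by (intro exI[of _ "exp t"]) auto
qed

lemma rho_le1_norm_le: "\<exists>M>0. \<forall>x. rho x \<le> 1 \<longrightarrow> norm x \<le> M"
proof -
  obtain C k where C: "C \<ge> 1" "k > 0" "\<And>t x. t \<le> 0 \<Longrightarrow> norm (T t x) \<le> C * exp (k * t) * norm x"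
    using T_contract1 by blast
  obtain c where c: "\<And>x. rho x = 1 \<Longrightarrow> norm x \<le> c" using rho_unit by blast
  have "norm x \<le> C * \<bar>c\<bar> + 1" if "rho x \<le> 1" for x
  proof (cases "x = 0")
    case False
    then have 0: "rho x > 0" by simp
    define u where "u = T (- ln (rho x)) x"
    have u: "rho u = 1" unfolding u_def by (rule unit_rep) fact
    have "x = T (ln (rho x)) u" by (simp add: u_def)
    then have "norm x \<le> C * exp (k * ln (rho x)) * norm u"
      using C(3)[of "ln (rho x)" u] that 0 by simp
    also have "\<dots> \<le> C * 1 * \<bar>c\<bar>"
      using that C 0 c[OF u] by (intro mult_mono) (auto simp: mult_nonneg_nonpos)
    finally show ?thesis by simp
  qed (use C in auto)
  moreover have "C * \<bar>c\<bar> + 1 > 0" using C by (smt (verit) mult_nonneg_nonneg)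
  ultimately show ?thesis by blast
qed

lemma rho_scaled: "r > 0 \<Longrightarrow> rho (T (ln r) x) = r * rho x" "r > 0 \<Longrightarrow> rho (T (- ln r) x) = rho x / r"
  by (simp_all add: rho_T exp_minus field_simps)

lemma rho_le_norm_le: "\<exists>M>0. \<forall>x. rho x \<le> R \<longrightarrow> norm x \<le> M"
proof -
  define S where "S = max R 1"
  have S: "S > 0" "R \<le> S" by (auto simp: S_def)
  obtain M where M: "M > 0" "\<And>x. rho x \<le> 1 \<Longrightarrow> norm x \<le> M" using rho_le1_norm_le by blast
  obtain B where B: "B > 0" "\<And>x. norm (T (ln S) x) \<le> B * norm x" using T_bounded by blast
  have "norm x \<le> B * M" if "rho x \<le> R" for x
  proof -
    have "rho (T (- ln S) x) \<le> 1" using that S by (simp add: rho_scaled)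
    then have "norm (T (- ln S) x) \<le> M" by (rule M)
    then have "B * norm (T (- ln S) x) \<le> B * M" using B by auto
    then show ?thesis using B(2)[of "T (- ln S) x"] by simp
  qed
  then show ?thesis using B M by (intro exI[of _ "B * M"]) auto
qed

lemma rho_small: 
  assumes "e > 0" shows "\<exists>d>0. \<forall>x. norm x < d \<longrightarrow> rho x < e"
proof -
  obtain c where c: "c > 0" "\<And>x. norm x < c \<Longrightarrow> rho x < 1" using small_norm_rho by blast
  obtain B where B: "B > 0" "\<And>x. norm (T (- ln e) x) \<le> B * norm x" using T_bounded by blast
  have "rho x < e" if "norm x < c / B" for x
  proof -
    have "norm (T (- ln e) x) < c" using B(2)[of x] that B(1) by (simp add: field_simps)
    then have "rho (T (- ln e) x) < 1" by (rule c)
    then show ?thesis using assms by (simp add: rho_scaled)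
  qed
  then show ?thesis using B c by (intro exI[of _ "c / B"]) auto
qed

lemma norm_small: 
  assumes "e > 0" shows "\<exists>d>0. \<forall>x. rho x < d \<longrightarrow> norm x < e"
proof -
  obtain C k where C: "C \<ge> 1" "k > 0" "\<And>t x. t \<le> 0 \<Longrightarrow> norm (T t x) \<le> C * exp (k * t) * norm x"
    using T_contract1 by blast
  obtain M where M: "M > 0" "\<And>x. rho x \<le> 1 \<Longrightarrow> norm x \<le> M" using rho_le1_norm_le by blast
  have "eventually (\<lambda>t. C * exp (k * (- t)) * M < e) at_top"
    using order_tendstoD(2)[OF exp_decay_tendsto[OF C(2)] assms] .
  then have "eventually (\<lambda>t. C * exp (k * (- t)) * M < e \<and> t \<ge> 0) at_top"
    by (intro eventually_conj eventually_ge_at_top)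
  then obtain t where t: "C * exp (k * (- t)) * M < e" "t \<ge> 0"
    using eventually_happens by fastforce
  have "norm x < e" if "rho x < exp (- t)" for x
  proof -
    have "rho (T t x) \<le> 1" using that by (simp add: rho_T exp_minus field_simps)
    then have "norm (T t x) \<le> M" by (rule M)
    have "norm x = norm (T (- t) (T t x))" by simp
    also have "\<dots> \<le> C * exp (k * (- t)) * norm (T t x)" using t by (intro C(3)) auto
    also have "\<dots> \<le> C * exp (k * (- t)) * M" using C \<open>norm (T t x) \<le> M\<close> by (intro mult_left_mono) auto
    finally show ?thesis using t by simp
  qed
  then show ?thesis by (intro exI[of _ "exp (-t)"]) auto
qed

text \<open>Rescaling by the larger of the two gauges puts both points into a fixed norm ball, where
  the triangle inequality of the norm applies.\<close>

lemma rho_quasi_triangle: "\<exists>M\<ge>1. \<forall>x y. rho (x + y) \<le> M * max (rho x) (rho y)"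
proof -
  obtain N where N: "N > 0" "\<And>x. rho x \<le> 1 \<Longrightarrow> norm x \<le> N" using rho_le1_norm_le by blast
  obtain M where M: "M > 0" "\<And>x. norm x \<le> 2 * N \<Longrightarrow> rho x \<le> M" using norm_le_rho_le by blast
  have "rho (x + y) \<le> max 1 M * max (rho x) (rho y)" for x y
  proof (cases "x = 0 \<and> y = 0")
    case False
    define m where "m = max (rho x) (rho y)"
    have m: "m > 0" "rho x \<le> m" "rho y \<le> m" using False by (auto simp: m_def less_max_iff_disj)
    have "norm (T (- ln m) x) \<le> N" "norm (T (- ln m) y) \<le> N"
      using m by (auto intro!: N simp: rho_scaled)
    then have "norm (T (- ln m) (x + y)) \<le> 2 * N"
      using norm_triangle_ineq[of "T (- ln m) x" "T (- ln m) y"] by simp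
    then have "rho (T (- ln m) (x + y)) \<le> M" by (rule M)
    then have "rho (x + y) \<le> M * m" using m by (simp only: rho_scaled) (simp add: field_simps)
    also have "\<dots> \<le> max 1 M * m" using m by (intro mult_right_mono) auto
    finally show ?thesis by (simp add: m_def)
  qed auto
  then show ?thesis by (intro exI[of _ "max 1 M"]) auto
qed

lemma T_has_vector_derivative: "((\<lambda>t. T t x) has_vector_derivative X (T s x)) (at s)"
proof -
  have "((\<lambda>h. T h (T s x)) \<circ> (\<lambda>t. t - s) has_vector_derivative (1 *\<^sub>R X (T s x))) (at s)"
    by (rule vector_diff_chain_at) (auto intro!: derivative_eq_intros T_deriv0)
  moreover have "(\<lambda>h. T h (T s x)) \<circ> (\<lambda>t. t - s) = (\<lambda>t. T t x)"
    by (auto simp: T_add[symmetric] fun_eq_iff)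
  ultimately show ?thesis by simp
qed

lemma continuous_T: "continuous_on S (\<lambda>t. T t x)"
  using T_has_vector_derivative[of x]
  by (meson continuous_at_imp_continuous_on has_vector_derivative_continuous)

lemma T_tendsto_0: "((\<lambda>t. T (- t) x) \<longlongrightarrow> 0) at_top"
proof -
  obtain C k where C: "C \<ge> 1" "k > 0" "\<And>t x. t \<le> 0 \<Longrightarrow> norm (T t x) \<le> C * exp (k * t) * norm x"
    using T_contract1 by blast
  show ?thesis
  proof (rule Lim_null_comparison)
    show "eventually (\<lambda>t. norm (T (- t) x) \<le> C * exp (k * (- t)) * norm x) at_top"
      using eventually_ge_at_top[of 0] by eventually_elim (rule C(3), simp)
  qed (rule exp_decay_tendsto[OF C(2)])
qed

lemma X_diff_quot: "((\<lambda>h. (T h x - x) /\<^sub>R h) \<longlongrightarrow> X x) (at 0)"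
proof -
  have "(\<lambda>h. norm (T h x - x - h *\<^sub>R X x) / norm h) \<midarrow>0\<rightarrow> 0"
    using T_deriv0[of x] by (simp add: has_vector_derivative_def has_derivative_at)
  moreover have "eventually (\<lambda>h. norm (T h x - x - h *\<^sub>R X x) / norm h = norm ((T h x - x) /\<^sub>R h - X x)) (at 0)"
  proof -
    have "norm (T h x - x - h *\<^sub>R X x) / norm h = norm ((T h x - x) /\<^sub>R h - X x)" if "h \<noteq> 0" for h
    proof -
      have "(T h x - x) /\<^sub>R h - X x = (T h x - x - h *\<^sub>R X x) /\<^sub>R h"
        using that by (simp add: algebra_simps)
      then show ?thesis by (simp only: norm_scaleR) (simp add: divide_inverse mult.commute)
    qed
    then show ?thesis by (simp add: eventually_at_filter)
  qed
  ultimately have "((\<lambda>h. norm ((T h x - x) /\<^sub>R h - X x)) \<longlongrightarrow> 0) (at 0)"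
    by (rule Lim_transform_eventually)
  then show ?thesis by (simp add: tendsto_norm_zero_iff LIM_zero_iff)
qed

lemma linear_X: "linear X"
proof (rule linearI)
  fix x y c
  have "((\<lambda>t. T t (x + y)) has_vector_derivative X x + X y) (at 0)"
    unfolding T_simps by (intro derivative_intros T_deriv0)
  then show "X (x + y) = X x + X y" using T_deriv0 vector_derivative_unique_at by blast
  have "((\<lambda>t. T t (c *\<^sub>R x)) has_vector_derivative c *\<^sub>R X x) (at 0)"
    unfolding T_simps by (auto intro!: derivative_eq_intros T_deriv0)
  then show "X (c *\<^sub>R x) = c *\<^sub>R X x" using T_deriv0 vector_derivative_unique_at by blast
qed

lemma T_X_commute: "X (T t x) = T t (X x)"
proof -
  have "((\<lambda>s. T t (T s x)) has_vector_derivative T t (X x)) (at 0)"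
    by (rule bounded_linear.has_vector_derivative[OF _ T_deriv0])
       (use T_linear linear_conv_bounded_linear in blast)
  moreover have "(\<lambda>s. T t (T s x)) = (\<lambda>s. T s (T t x))"
    by (simp add: T_add[symmetric] add.commute)
  ultimately show ?thesis using T_deriv0[of "T t x"] vector_derivative_unique_at by metis
qed

text \<open>A null vector of \<open>X\<close> would be fixed by the whole flow, but
  \<open>T (- t)\<close> contracts every vector to 0.\<close>

lemma inj_X: "X x = 0 \<Longrightarrow> x = 0"
proof -
  assume 0: "X x = 0"
  have "T t x = T 0 x" for t
  proof -
    have "((\<lambda>t. T t x) has_vector_derivative 0) (at s within UNIV)" for s
      using T_has_vector_derivative[of x s] by (simp add: T_X_commute 0)
    then show ?thesis
      using has_vector_derivative_zero_constant[of UNIV "\<lambda>t. T t x"] by (metis convex_UNIV UNIV_I)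
  qed
  then have "((\<lambda>t. x) \<longlongrightarrow> 0) (at_top :: real filter)" using T_tendsto_0[of x] by simp
  then show ?thesis by (simp add: tendsto_const_iff)
qed

end

section \<open>Functions of finite variation and their invariant directions\<close>

definition disj_balls :: "('a::ab_group_add \<Rightarrow> real) \<Rightarrow> 'a set \<Rightarrow> ('a \<Rightarrow> real) \<Rightarrow> bool" where
  "disj_balls rho I r \<longleftrightarrow>
     (\<forall>x\<in>I. \<forall>x'\<in>I. x \<noteq> x' \<longrightarrow> (\<forall>z. \<not> (rho (z - x) < r x \<and> rho (z - x') < r x')))"

text \<open>
  The choice function \<open>y\<close> stands for the oscillation of \<open>u\<close> on the ball of radius \<open>R * r x\<close>
  about \<open>x\<close>.  The single constant \<open>R\<close> bounds the region, the radii and the enlargement factor.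
\<close>

definition fin_var :: "('a::ab_group_add \<Rightarrow> real) \<Rightarrow> real \<Rightarrow> ('a \<Rightarrow> real) \<Rightarrow> bool" where
  "fin_var rho Q u \<longleftrightarrow> (\<forall>a R. \<exists>V. \<forall>I r y. finite I \<longrightarrow>
     (\<forall>x\<in>I. 0 < r x \<and> r x \<le> R \<and> rho (x - a) \<le> R \<and> rho (y x - x) \<le> R * r x) \<longrightarrow>
     disj_balls rho I r \<longrightarrow> (\<Sum>x\<in>I. \<bar>u (y x) - u x\<bar> powr Q) \<le> V)"

definition rho_continuous :: "('a::ab_group_add \<Rightarrow> real) \<Rightarrow> ('a \<Rightarrow> real) \<Rightarrow> bool" where
  "rho_continuous rho u \<longleftrightarrow> (\<forall>x. \<forall>e>0. \<exists>d>0. \<forall>y. rho (y - x) < d \<longrightarrow> \<bar>u y - u x\<bar> < e)"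

definition variation_class :: "('a::ab_group_add \<Rightarrow> real) \<Rightarrow> real \<Rightarrow> ('a \<Rightarrow> real) set" where
  "variation_class rho Q = {u. rho_continuous rho u \<and> fin_var rho Q u}"

definition invariant_dirs :: "('a::ab_group_add \<Rightarrow> real) \<Rightarrow> real \<Rightarrow> 'a set" where
  "invariant_dirs rho Q = {v. \<forall>u\<in>variation_class rho Q. \<forall>x. u (x + v) = u x}"

text \<open>The control function is reduced to one constant \<open>K'\<close> for each ratio bound
  \<open>K\<close>, and degenerate triples are included. In this form the property is assumed of a
  map and of its inverse alike.\<close>

definition weak_qs :: "('a::ab_group_add \<Rightarrow> real) \<Rightarrow> ('b::ab_group_add \<Rightarrow> real) \<Rightarrow> ('a \<Rightarrow> 'b) \<Rightarrow> bool" where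
  "weak_qs rho rho' F \<longleftrightarrow> (\<forall>K. \<exists>K'>0. \<forall>x y z.
     rho (y - x) \<le> K * rho (z - x) \<longrightarrow> rho' (F y - F x) \<le> K' * rho' (F z - F x))"

lemma weak_qsE:
  assumes "weak_qs rho rho' F"
  obtains K' where "K' > 0"
    "\<And>x y z. rho (y - x) \<le> K * rho (z - x) \<Longrightarrow> rho' (F y - F x) \<le> K' * rho' (F z - F x)"
  using assms unfolding weak_qs_def by blast

locale qs_pair = dom: dilation_space T X rho + cod: dilation_space T' X' rho'
  for T :: "real \<Rightarrow> real^'n::{finite,wellorder} \<Rightarrow> real^'n::{finite,wellorder}" and X rho
    and T' :: "real \<Rightarrow> real^'m::{finite,wellorder} \<Rightarrow> real^'m::{finite,wellorder}" and X' rho' +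
  fixes F :: "real^'n::{finite,wellorder} \<Rightarrow> real^'m::{finite,wellorder}" and G :: "real^'m::{finite,wellorder} \<Rightarrow> real^'n::{finite,wellorder}"
  assumes GF [simp]: "G (F x) = x" and FG [simp]: "F (G y) = y"
    and qsF: "weak_qs rho rho' F" and qsG: "weak_qs rho' rho G"

context dilation_space begin

lemma rho_surj: "r \<ge> 0 \<Longrightarrow> \<exists>p. rho p = r"
proof (cases "r = 0")
  case False
  assume r: "r \<ge> 0"
  obtain x :: "real^'n::{finite,wellorder}" where "x \<noteq> 0" using nonzero_Basis by blast
  then have "rho (T (ln r) (T (- ln (rho x)) x)) = r"
    using False r unit_rep[of x] by (subst rho_scaled) auto
  then show ?thesis by blast
qed (use rho_0 in blast)

lemma rho_continuous_imp_continuous_on: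
  assumes "rho_continuous rho u"
  shows "continuous_on S u"
  unfolding continuous_on_iff
proof (intro ballI allI impI)
  fix x and e :: real assume "e > 0"
  then obtain d where d: "d > 0" "\<And>y. rho (y - x) < d \<Longrightarrow> \<bar>u y - u x\<bar> < e"
    using assms unfolding rho_continuous_def by blast
  obtain d' where "d' > 0" "\<And>x. norm x < d' \<Longrightarrow> rho x < d" using rho_small[OF d(1)] by blast
  then show "\<exists>d>0. \<forall>x'\<in>S. dist x' x < d \<longrightarrow> dist (u x') (u x) < e"
    using d(2) by (auto simp: dist_norm intro!: exI[of _ d'])
qed

end

context qs_pair begin

lemma flip: "qs_pair T' X' rho' T X rho G F"
  by unfold_locales (use qsF qsG in auto)

lemma F_eq_iff [simp]: "F x = F y \<longleftrightarrow> x = y"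
  by (metis GF)

text \<open>\<open>z\<close> is the point whose image lies at gauge distance exactly
  \<open>e\<close> from \<open>F x\<close>. If \<open>F y\<close> were at least as far away,
  quasisymmetry of \<open>G\<close> would bound \<open>rho (z - x)\<close> by
  \<open>K * rho (y - x)\<close>.\<close>

lemma F_continuous:
  assumes "e > 0"
  shows "\<exists>d>0. \<forall>y. rho (y - x) < d \<longrightarrow> rho' (F y - F x) < e"
proof -
  obtain p where p: "rho' p = e" using cod.rho_surj[of e] assms by auto
  define z where "z = G (F x + p)"
  have z: "z \<noteq> x"
  proof
    assume "z = x"
    then have "F z = F x" by simp
    then have "p = 0" by (simp add: z_def)
    then show False using p assms by simp
  qed
  obtain K where K: "K > 0"
    "\<And>a b c. rho' (b - a) \<le> 1 * rho' (c - a) \<Longrightarrow> rho (G b - G a) \<le> K * rho (G c - G a)"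
    using weak_qsE[OF qsG] by metis
  have "rho' (F y - F x) < e" if "rho (y - x) < rho (z - x) / K" for y
  proof (rule ccontr)
    assume "\<not> rho' (F y - F x) < e"
    then have "rho' (F x + p - F x) \<le> 1 * rho' (F y - F x)" using p by simp
    from K(2)[OF this] have "rho (z - x) \<le> K * rho (y - x)" by (simp add: z_def)
    then show False using that K(1) by (simp add: field_simps)
  qed
  then show ?thesis using z K(1) by (intro exI[of _ "rho (z - x) / K"]) auto
qed

lemma F_bounded: "\<exists>S>0. \<forall>x. rho (x - a) \<le> R \<longrightarrow> rho' (F x - F a) \<le> S"
proof -
  obtain p where p: "rho p = max R 1" using dom.rho_surj[of "max R 1"] by (auto simp: le_max_iff_disj)
  obtain K where K: "K > 0"
    "\<And>x y z. rho (y - x) \<le> 1 * rho (z - x) \<Longrightarrow> rho' (F y - F x) \<le> K * rho' (F z - F x)"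
    using weak_qsE[OF qsF] by metis
  have "rho' (F x - F a) \<le> K * rho' (F (a + p) - F a) + 1" if "rho (x - a) \<le> R" for x
    using K(2)[of x a "a + p"] p that by (auto simp: le_max_iff_disj)
  then show ?thesis using K(1)
    by (intro exI[of _ "K * rho' (F (a + p) - F a) + 1"]) (auto intro: add_nonneg_pos)
qed

text \<open>Quasisymmetry maps a ball to a set containing a ball about the image centre, and maps
  the enlarged ball into a fixed multiple of that inner ball. Inner balls stay disjoint, so a sum
  for \<open>u \<circ> F\<close> is a sum for \<open>u\<close> over the image centres.\<close>

lemma fin_var_comp:
  assumes "fin_var rho' Q u"
  shows "fin_var rho Q (u \<circ> F)"
  unfolding fin_var_def
proof (intro allI)
  fix a R
  obtain M where M: "M \<ge> 1" "\<And>x y. rho (x + y) \<le> M * max (rho x) (rho y)"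
    using dom.rho_quasi_triangle by blast
  obtain M' where M': "M' \<ge> 1" "\<And>x y. rho' (x + y) \<le> M' * max (rho' x) (rho' y)"
    using cod.rho_quasi_triangle by blast
  obtain K where K: "K > 0"
    "\<And>x y z. rho (y - x) \<le> 1 * rho (z - x) \<Longrightarrow> rho' (F y - F x) \<le> K * rho' (F z - F x)"
    using weak_qsE[OF qsF] by metis
  obtain L where L: "L > 0"
    "\<And>x y z. rho (y - x) \<le> R * rho (z - x) \<Longrightarrow> rho' (F y - F x) \<le> L * rho' (F z - F x)"
    using weak_qsE[OF qsF] by metis
  obtain S where S: "S > 0" "\<And>x. rho (x - a) \<le> M * R \<Longrightarrow> rho' (F x - F a) \<le> S"
    using F_bounded by blast
  \<comment> \<open>The three terms bound the distance of the image centres from \<open>F a\<close>,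
    the image radii \<open>s x\<close>, and the enlargement factor of the image balls.\<close>
  define R' where "R' = max (M' * S) (max (M' * S / K) (L * K))"
  from spec[OF spec[OF assms[unfolded fin_var_def], of "F a"], of R']
  obtain V where V: "\<forall>I r y. finite I \<longrightarrow>
     (\<forall>x\<in>I. 0 < r x \<and> r x \<le> R' \<and> rho' (x - F a) \<le> R' \<and> rho' (y x - x) \<le> R' * r x) \<longrightarrow>
     disj_balls rho' I r \<longrightarrow> (\<Sum>x\<in>I. \<bar>u (y x) - u x\<bar> powr Q) \<le> V"
    by (elim exE)
  show "\<exists>V. \<forall>I r y. finite I \<longrightarrow>
     (\<forall>x\<in>I. 0 < r x \<and> r x \<le> R \<and> rho (x - a) \<le> R \<and> rho (y x - x) \<le> R * r x) \<longrightarrow>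
     disj_balls rho I r \<longrightarrow> (\<Sum>x\<in>I. \<bar>(u \<circ> F) (y x) - (u \<circ> F) x\<bar> powr Q) \<le> V"
  proof (intro exI[of _ V] allI impI)
    fix I r y
    assume fin: "finite I"
      and I: "\<forall>x\<in>I. 0 < r x \<and> r x \<le> R \<and> rho (x - a) \<le> R \<and> rho (y x - x) \<le> R * r x"
      and dj: "disj_balls rho I r"
    define p where "p x = x + (SOME q. rho q = r x)" for x
    have p: "rho (p x - x) = r x" if "x \<in> I" for x
    proof -
      have "\<exists>q. rho q = r x" using I that by (intro dom.rho_surj) auto
      from someI_ex[OF this] show ?thesis unfolding p_def by (simp del: cod.rho_pos_iff)
    qed
    \<comment> \<open>\<open>p x\<close> marks the sphere of radius \<open>r x\<close>. Dividing by
      \<open>K\<close> makes the ball of radius \<open>s x\<close> about \<open>F x\<close> lie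
      inside the image of the ball of radius \<open>r x\<close> about \<open>x\<close>; this is
      \<open>sub\<close> below.\<close>
    define s where "s x = rho' (F (p x) - F x) / K" for x
    have pos: "s x > 0" if "x \<in> I" for x
    proof -
      have "p x \<noteq> x" using p[OF that] I that by force
      then show ?thesis using K(1) by (simp add: s_def)
    qed
    have Sx: "rho' (F x - F a) \<le> S" if "x \<in> I" for x
    proof (rule S(2))
      have "rho (x - a) \<le> R" "0 \<le> R" using I that dom.rho_nonneg[of "x - a"] by force+
      then show "rho (x - a) \<le> M * R" using M(1) by (smt (verit) mult_le_cancel_right1)
    qed
    have Sp: "rho' (F (p x) - F x) \<le> M' * S" if "x \<in> I" for x
    proof -
      have "rho (p x - a) \<le> M * max (rho (p x - x)) (rho (x - a))" using M(2)[of "p x - x" "x - a"] by simp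
      also have "\<dots> \<le> M * R" using I that p M by (intro mult_left_mono) auto
      finally have 1: "rho' (F (p x) - F a) \<le> S" by (rule S(2))
      have "rho' (F (p x) - F x) \<le> M' * max (rho' (F (p x) - F a)) (rho' (F a - F x))"
        using M'(2)[of "F (p x) - F a" "F a - F x"] by simp
      also have "\<dots> \<le> M' * S" using 1 Sx[OF that] M' by (intro mult_left_mono) (auto simp: cod.rho_commute)
      finally show ?thesis .
    qed
    have "(\<Sum>x\<in>F ` I. \<bar>u ((F \<circ> y \<circ> G) x) - u x\<bar> powr Q) \<le> V"
    proof (rule V[rule_format, where r = "s \<circ> G"])
      show "finite (F ` I)" using fin by simp
      fix x' assume "x' \<in> F ` I"
      show "0 < (s \<circ> G) x' \<and> (s \<circ> G) x' \<le> R' \<and> rho' (x' - F a) \<le> R' \<and>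
          rho' ((F \<circ> y \<circ> G) x' - x') \<le> R' * (s \<circ> G) x'"
      proof -
        from \<open>x' \<in> F ` I\<close>        obtain x where x: "x \<in> I" "x' = F x" by auto
        have 1: "s x \<le> R'"
        proof -
          have "s x \<le> M' * S / K" unfolding s_def using Sp[OF x(1)] K(1) by (intro divide_right_mono) auto
          then show ?thesis by (simp add: R'_def)
        qed
        have "S \<le> M' * S" using S M' by (simp add: mult_le_cancel_right1)
        then have 2: "rho' (F x - F a) \<le> R'" using Sx[OF x(1)] by (simp add: R'_def)
        have "rho (y x - x) \<le> R * rho (p x - x)" using I x p by auto
        then have "rho' (F (y x) - F x) \<le> L * rho' (F (p x) - F x)" by (rule L(2))
        also have "\<dots> = L * K * s x" using K(1) by (simp add: s_def)
        also have "\<dots> \<le> R' * s x" using pos[OF x(1)] by (intro mult_right_mono) (auto simp: R'_def)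
        finally show "0 < (s \<circ> G) x' \<and> (s \<circ> G) x' \<le> R' \<and> rho' (x' - F a) \<le> R' \<and>
          rho' ((F \<circ> y \<circ> G) x' - x') \<le> R' * (s \<circ> G) x'"
          using 1 2 pos x by simp
      qed
    next
      have sub: "rho (G z - x) < r x" if "x \<in> I" "rho' (z - F x) < s x" for x z
      proof (rule ccontr)
        assume "\<not> rho (G z - x) < r x"
        then have "rho (p x - x) \<le> 1 * rho (G z - x)" using p[OF that(1)] by simp
        from K(2)[OF this] have "rho' (F (p x) - F x) \<le> K * rho' (z - F x)" by simp
        then show False using that K(1) by (simp add: s_def field_simps)
      qed
      show "disj_balls rho' (F ` I) (s \<circ> G)"
        unfolding disj_balls_def
      proof (intro ballI impI allI notI, elim imageE conjE)
        fix x1' x2' z x1 x2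
        assume *: "x1' \<noteq> x2'" "x1 \<in> I" "x2 \<in> I" "x1' = F x1" "x2' = F x2"
          "rho' (z - x1') < (s \<circ> G) x1'" "rho' (z - x2') < (s \<circ> G) x2'"
        then have "rho (G z - x1) < r x1 \<and> rho (G z - x2) < r x2" and "x1 \<noteq> x2" using sub by auto
        then show False using dj[unfolded disj_balls_def, rule_format, OF *(2,3)] by blast
      qed
    qed
    moreover have "inj_on F I" by (simp add: inj_on_def)
    ultimately show "(\<Sum>x\<in>I. \<bar>(u \<circ> F) (y x) - (u \<circ> F) x\<bar> powr Q) \<le> V"
      by (simp add: sum.reindex)
  qed
qed

lemma variation_class_comp:
  assumes "u \<in> variation_class rho' Q"
  shows "u \<circ> F \<in> variation_class rho Q"
proof -
  have "rho_continuous rho (u \<circ> F)"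
    unfolding rho_continuous_def
  proof (intro allI impI)
    fix x and e :: real assume "e > 0"
    then obtain d where "d > 0" "\<And>y. rho' (y - F x) < d \<Longrightarrow> \<bar>u y - u (F x)\<bar> < e"
      using assms unfolding variation_class_def rho_continuous_def by blast
    moreover obtain d' where "d' > 0" "\<And>y. rho (y - x) < d' \<Longrightarrow> rho' (F y - F x) < d"
      using F_continuous \<open>d > 0\<close> by metis
    ultimately show "\<exists>d>0. \<forall>y. rho (y - x) < d \<longrightarrow> \<bar>(u \<circ> F) y - (u \<circ> F) x\<bar> < e"
      by auto
  qed
  then show ?thesis using assms fin_var_comp by (simp add: variation_class_def)
qed

end

section \<open>The closed group of invariant directions\<close>

context dilation_space begin

text \<open>\<open>T t\<close> multiplies all gauge distances by \<open>exp t\<close>, so it is a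
  quasisymmetric map of the space to itself and \<open>variation_class_comp\<close> applies.\<close>

lemma variation_class_T:
  assumes "u \<in> variation_class rho Q"
  shows "(\<lambda>x. u (T t x)) \<in> variation_class rho Q"
proof -
  have qs: "weak_qs rho rho (T t)" for t
    unfolding weak_qs_def
  proof
    fix K show "\<exists>K'>0. \<forall>x y z. rho (y - x) \<le> K * rho (z - x) \<longrightarrow> rho (T t y - T t x) \<le> K' * rho (T t z - T t x)"
    proof (intro exI[of _ "max K 1"] conjI allI impI)
      fix x y z assume *: "rho (y - x) \<le> K * rho (z - x)"
      also have "\<dots> \<le> max K 1 * rho (z - x)" by (intro mult_right_mono) auto
      finally have "rho (T t (y - x)) \<le> max K 1 * rho (T t (z - x))"
        unfolding rho_T by (simp add: mult.left_commute)
      then show "rho (T t y - T t x) \<le> max K 1 * rho (T t z - T t x)" by simp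
    qed auto
  qed
  interpret qs_pair T X rho T X rho "T t" "T (- t)"
    by unfold_locales (use qs in auto)
  show ?thesis using variation_class_comp[OF assms] by (simp add: comp_def)
qed

lemma variation_class_translation:
  assumes "u \<in> variation_class rho Q"
  shows "(\<lambda>x. u (x + c)) \<in> variation_class rho Q"
proof -
  have qs: "weak_qs rho rho (\<lambda>x. x + c)" for c
    unfolding weak_qs_def
  proof
    fix K show "\<exists>K'>0. \<forall>x y z. rho (y - x) \<le> K * rho (z - x) \<longrightarrow> rho (y + c - (x + c)) \<le> K' * rho (z + c - (x + c))"
    proof (intro exI[of _ "max K 1"] conjI allI impI)
      fix x y z assume *: "rho (y - x) \<le> K * rho (z - x)"
      also have "\<dots> \<le> max K 1 * rho (z - x)" by (intro mult_right_mono) auto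
      finally show "rho (y + c - (x + c)) \<le> max K 1 * rho (z + c - (x + c))" by simp
    qed auto
  qed
  interpret qs_pair T X rho T X rho "\<lambda>x. x + c" "\<lambda>x. x + (- c)"
    by unfold_locales (use qs[of c] qs[of "- c"] in auto)
  show ?thesis using variation_class_comp[OF assms] by (simp add: comp_def)
qed

lemma invariant_dirsD: "v \<in> invariant_dirs rho Q \<Longrightarrow> u \<in> variation_class rho Q \<Longrightarrow> u (x + v) = u x"
  unfolding invariant_dirs_def by blast

lemma invariant_dirs_0 [simp]: "0 \<in> invariant_dirs rho Q"
  unfolding invariant_dirs_def by simp

lemma invariant_dirs_add:
  "v \<in> invariant_dirs rho Q \<Longrightarrow> w \<in> invariant_dirs rho Q \<Longrightarrow> v + w \<in> invariant_dirs rho Q"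
  unfolding invariant_dirs_def by (force simp: add.assoc[symmetric])

lemma invariant_dirs_minus:
  assumes "v \<in> invariant_dirs rho Q" shows "- v \<in> invariant_dirs rho Q"
  unfolding invariant_dirs_def
proof (intro CollectI ballI allI)
  fix u x assume "u \<in> variation_class rho Q"
  from invariant_dirsD[OF assms this, of "x + - v"] show "u (x + - v) = u x" by simp
qed

lemma invariant_dirs_diff:
  "v \<in> invariant_dirs rho Q \<Longrightarrow> w \<in> invariant_dirs rho Q \<Longrightarrow> v - w \<in> invariant_dirs rho Q"
  using invariant_dirs_add[OF _ invariant_dirs_minus, of v Q w] by simp

lemma invariant_dirs_T:
  assumes "v \<in> invariant_dirs rho Q" shows "T t v \<in> invariant_dirs rho Q"
  unfolding invariant_dirs_def
proof (intro CollectI ballI allI)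
  fix u x assume "u \<in> variation_class rho Q"
  from invariant_dirsD[OF assms variation_class_T[OF this, of t], of "T (- t) x"]
  show "u (x + T t v) = u x" by simp
qed

lemma invariant_dirs_of_int:
  assumes "v \<in> invariant_dirs rho Q" shows "of_int m *\<^sub>R v \<in> invariant_dirs rho Q"
proof -
  have nat: "of_nat k *\<^sub>R v \<in> invariant_dirs rho Q" for k
    by (induction k) (auto simp: algebra_simps assms invariant_dirs_add)
  show ?thesis
    by (cases m rule: int_cases2) (use nat invariant_dirs_minus in auto)
qed

lemma closed_invariant_dirs: "closed (invariant_dirs rho Q)"
proof -
  have "invariant_dirs rho Q = (\<Inter>u\<in>variation_class rho Q. \<Inter>x. {v. u (x + v) = u x})"
    unfolding invariant_dirs_def by auto
  moreover have "closed {v. u (x + v) = u x}" if "u \<in> variation_class rho Q" for u x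
  proof (rule closed_Collect_eq)
    show "continuous_on UNIV (\<lambda>v. u (x + v))"
      using that unfolding variation_class_def
      by (auto intro!: continuous_on_compose2[OF rho_continuous_imp_continuous_on[of u UNIV]] continuous_intros)
  qed simp
  ultimately show ?thesis by (auto intro!: closed_INT)
qed

text \<open>The differences \<open>T h v - v\<close> lie in the closed group of invariant
  directions. Their integer multiples, with \<open>m * h\<close> tending to \<open>c\<close>,
  converge to \<open>c *\<^sub>R X v\<close>; this is the passage from integer to real
  multiples.\<close>

lemma invariant_dirs_X:
  assumes "v \<in> invariant_dirs rho Q" shows "c *\<^sub>R X v \<in> invariant_dirs rho Q"
proof -
  define h where "h n = 1 / real (Suc n)" for n
  have h0: "h n > 0" for n by (simp add: h_def)
  have h: "h \<longlonglongrightarrow> 0" unfolding h_def using lim_inverse_n' LIMSEQ_Suc by blast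
  define m where "m n = \<lfloor>c / h n\<rfloor>" for n
  have "(\<lambda>n. of_int (m n) * h n) \<longlonglongrightarrow> c"
  proof -
    have "\<bar>of_int (m n) * h n - c\<bar> \<le> h n" for n
    proof -
      have "of_int (m n) \<le> c / h n" "c / h n < of_int (m n) + 1" unfolding m_def by linarith+
      then show ?thesis using h0[of n] by (simp add: field_simps abs_le_iff)
    qed
    then have "(\<lambda>n. of_int (m n) * h n - c) \<longlonglongrightarrow> 0"
      by (intro Lim_null_comparison[OF _ h]) auto
    then show ?thesis by (simp add: LIM_zero_iff)
  qed
  moreover have "(\<lambda>n. (T (h n) v - v) /\<^sub>R h n) \<longlonglongrightarrow> X v"
    using X_diff_quot[of v] h h0 by (intro filterlim_compose[OF X_diff_quot]) (auto simp: filterlim_at intro!: always_eventually less_imp_neq[THEN not_sym])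
  ultimately have "(\<lambda>n. (of_int (m n) * h n) *\<^sub>R ((T (h n) v - v) /\<^sub>R h n)) \<longlonglongrightarrow> c *\<^sub>R X v"
    by (intro tendsto_intros)
  moreover have "(of_int (m n) * h n) *\<^sub>R ((T (h n) v - v) /\<^sub>R h n) = of_int (m n) *\<^sub>R (T (h n) v - v)" for n
    using h0[of n] by (simp add: field_simps)
  ultimately have "(\<lambda>n. of_int (m n) *\<^sub>R (T (h n) v - v)) \<longlonglongrightarrow> c *\<^sub>R X v" by (simp only:)
  then show ?thesis
    by (rule closed_sequentially[OF closed_invariant_dirs, rotated])
       (use assms in \<open>auto intro: invariant_dirs_of_int invariant_dirs_diff invariant_dirs_T\<close>)
qed

text \<open>\<open>H0\<close> is the largest linear subspace inside \<open>H\<close>, and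
  \<open>X\<close> maps \<open>H\<close> into it. Being injective, \<open>X\<close> maps
  \<open>H0\<close> onto itself, so \<open>X v\<close> equals \<open>X w\<close> for some
  \<open>w\<close> in \<open>H0\<close>, and then \<open>v = w\<close>.\<close>

lemma subspace_invariant_dirs: "subspace (invariant_dirs rho Q)"
proof -
  define H where "H = invariant_dirs rho Q"
  define H0 where "H0 = {v. \<forall>c. c *\<^sub>R v \<in> H}"
  have sub: "subspace H0"
    unfolding Real_Vector_Spaces.subspace_def H0_def H_def
    by (auto simp: scaleR_add_right intro: invariant_dirs_add)
  have XH: "X v \<in> H0" if "v \<in> H" for v
    using that invariant_dirs_X unfolding H_def H0_def by blast
  have H0H: "H0 \<subseteq> H"
    unfolding H0_def by (metis (mono_tags, lifting) mem_Collect_eq scaleR_one subsetI)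
  have "X ` H0 = H0"
  proof (rule subspace_dim_equal)
    show "subspace (X ` H0)" by (rule linear_subspace_image[OF linear_X sub])
    show "X ` H0 \<subseteq> H0" using XH H0H by auto
    have "inj X" using inj_X linear_X by (simp add: linear_injective_0)
    then show "dim H0 \<le> dim (X ` H0)"
      using dim_image_eq[OF linear_X, of H0] by (simp add: inj_on_subset)
  qed (rule sub)
  have "v \<in> H0" if "v \<in> H" for v
  proof -
    obtain w where "w \<in> H0" "X v = X w" using XH \<open>v \<in> H\<close> \<open>X ` H0 = H0\<close> by blast
    then have "X (v - w) = 0" using linear_X by (simp add: linear_diff)
    then show ?thesis using inj_X \<open>w \<in> H0\<close> by fastforce
  qed
  then have "H = H0" using H0H by blast
  then show ?thesis using sub H_def by simp
qed

end

context qs_pair begin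

text \<open>Composition with \<open>F\<close> takes the variation class of the target into that of
  the source. Translating the test function beforehand moves the base point from \<open>F x\<close>
  to an arbitrary \<open>z\<close>.\<close>

lemma F_cosets:
  assumes "y - x \<in> invariant_dirs rho Q"
  shows "F y - F x \<in> invariant_dirs rho' Q"
  unfolding invariant_dirs_def
proof (intro CollectI ballI allI)
  fix u z assume "u \<in> variation_class rho' Q"
  from variation_class_comp[OF cod.variation_class_translation[OF this, of "z - F x"]]
  have "((\<lambda>w. u (w + (z - F x))) \<circ> F) (x + (y - x)) = ((\<lambda>w. u (w + (z - F x))) \<circ> F) x"
    by (rule dom.invariant_dirsD[OF assms])
  then show "u (z + (F y - F x)) = u z" by (simp add: algebra_simps)
qed

end

section \<open>Volume growth of invariant subspaces\<close>

lemma additive_bounded_imp_linear: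
  fixes f :: "real \<Rightarrow> real"
  assumes add: "\<And>s t. f (s + t) = f s + f t" and bnd: "\<And>t. 0 \<le> t \<Longrightarrow> t \<le> 1 \<Longrightarrow> \<bar>f t\<bar> \<le> B"
  shows "f t = t * f 1"
proof -
  \<comment> \<open>Without its linear part the function is additive and vanishes at the integers,
    so it is periodic and bounded everywhere; an additive bounded function is 0.\<close>
  define g where "g t = f t - t * f 1" for t
  have gadd: "g (s + t) = g s + g t" for s t by (simp add: g_def add algebra_simps)
  have g0: "g 0 = 0" using gadd[of 0 0] by simp
  have g1: "g 1 = 0" by (simp add: g_def)
  have gnat: "g (real n * t) = real n * g t" for n t
    by (induction n) (auto simp: g0 gadd algebra_simps)
  have gint: "g (of_int m) = 0" for m
  proof -
    have nat: "g (real n) = 0" for n using gnat[of n 1] g1 by simp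
    have neg: "g (- real n) = 0" for n using gadd[of "real n" "- real n"] nat g0 by simp
    show ?thesis by (cases m rule: int_cases2) (use nat neg in auto)
  qed
  define C where "C = B + \<bar>f 1\<bar>"
  have bound: "\<bar>g t\<bar> \<le> C" for t
  proof -
    have "g t = g (frac t)" using gadd[of "of_int \<lfloor>t\<rfloor>" "frac t"] gint by (simp add: frac_def)
    moreover have "\<bar>g (frac t)\<bar> \<le> C"
    proof -
      have "0 \<le> frac t" "frac t \<le> 1" using frac_lt_1[of t] by (auto simp: less_imp_le)
      then have "\<bar>f (frac t)\<bar> \<le> B" "\<bar>frac t * f 1\<bar> \<le> \<bar>f 1\<bar>"
        using bnd by (auto simp: abs_mult mult_left_le_one_le)
      then show ?thesis unfolding g_def C_def by linarith
    qed
    ultimately show ?thesis by simp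
  qed
  have "g t = 0"
  proof (rule ccontr)
    assume "g t \<noteq> 0"
    then obtain n :: nat where n: "C < real n * \<bar>g t\<bar>"
      using reals_Archimedean3[of "\<bar>g t\<bar>"] by auto
    have "real n * \<bar>g t\<bar> = \<bar>g (real n * t)\<bar>" by (simp add: gnat abs_mult)
    then show False using n bound[of "real n * t"] by simp
  qed
  then show ?thesis by (simp add: g_def)
qed

lemma tendsto_det_matrix:
  fixes S :: "'t \<Rightarrow> real^'n \<Rightarrow> real^'n"
  assumes "\<And>x. ((\<lambda>t. S t x) \<longlongrightarrow> L x) F"
  shows "((\<lambda>t. det (matrix (S t))) \<longlongrightarrow> det (matrix L)) F"
  unfolding Determinants.det_def matrix_def vec_lambda_beta
  by (intro tendsto_sum tendsto_mult tendsto_const tendsto_prod tendsto_vec_nth assms)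

text \<open>The logarithm of the absolute determinant is additive in \<open>t\<close> and, by
  continuity, bounded on the unit interval, so Cauchy's functional equation applies.\<close>

lemma one_parameter_det:
  fixes S :: "real \<Rightarrow> real^'n \<Rightarrow> real^'n"
  assumes lin: "\<And>t. linear (S t)" and S0: "\<And>x. S 0 x = x"
    and add: "\<And>s t x. S (s + t) x = S s (S t x)" and cont: "\<And>x. continuous_on UNIV (\<lambda>t. S t x)"
  shows "\<bar>det (matrix (S t))\<bar> = exp (ln \<bar>det (matrix (S 1))\<bar> * t)"
proof -
  define d where "d t = \<bar>det (matrix (S t))\<bar>" for t
  have d0: "d 0 = 1"
  proof -
    have "S 0 = id" using S0 by auto
    then show ?thesis by (simp add: d_def matrix_id_mat_1)
  qed
  have dmul: "d (s + t) = d s * d t" for s t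
  proof -
    have "S (s + t) = S s \<circ> S t" using add by auto
    then show ?thesis by (simp add: d_def matrix_compose lin det_mul abs_mult)
  qed
  have dpos: "d t > 0" for t
  proof -
    have "d t * d (- t) = 1" using dmul[of t "- t"] d0 by simp
    then have "d t \<noteq> 0" by auto
    then show ?thesis by (simp add: d_def)
  qed
  have "continuous_on UNIV (\<lambda>t. det (matrix (S t)))"
    unfolding continuous_on_def
    using cont by (auto intro!: tendsto_det_matrix simp: continuous_on_def)
  then have "continuous_on {0..1} (\<lambda>t. ln (d t))"
    using dpos unfolding d_def by (intro continuous_intros) (auto intro: continuous_on_subset)
  then have "bounded ((\<lambda>t. ln (d t)) ` {0..1})"
    by (intro compact_imp_bounded compact_continuous_image) auto
  then obtain B where "\<forall>t\<in>{0..1}. \<bar>ln (d t)\<bar> \<le> B"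
    unfolding bounded_iff by auto
  then have "ln (d t) = t * ln (d 1)"
    by (intro additive_bounded_imp_linear[of "\<lambda>t. ln (d t)"]) (auto simp: dmul ln_mult dpos[THEN less_imp_neq, THEN not_sym])
  then show ?thesis using dpos[of t] by (metis d_def exp_ln mult.commute)
qed

lemma sum_measure_le:
  fixes E :: "'i \<Rightarrow> 'a::euclidean_space set"
  assumes "finite I" "\<And>i. i \<in> I \<Longrightarrow> E i \<in> lmeasurable" "disjoint_family_on E I"
    and "\<And>i. i \<in> I \<Longrightarrow> E i \<subseteq> U" "U \<in> lmeasurable"
  shows "(\<Sum>i\<in>I. measure lebesgue (E i)) \<le> measure lebesgue U"
proof -
  have "(\<Sum>i\<in>I. measure lebesgue (E i)) = measure lebesgue (\<Union>i\<in>I. E i)"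
    using assms by (intro measure_finite_Union[symmetric]) (auto simp del: emeasure_completion dest: fmeasurableD2)
  also have "\<dots> \<le> measure lebesgue U"
    using assms by (intro measure_mono_fmeasurable) (auto intro!: sets.finite_UN)
  finally show ?thesis .
qed

lemma measure_pos_if_ball:
  fixes S :: "'a::euclidean_space set"
  assumes "S \<in> lmeasurable" "ball 0 e \<subseteq> S" "e > 0"
  shows "measure lebesgue S > 0"
proof -
  have "0 < measure lebesgue (ball (0::'a) e)"
    using content_ball_pos[OF assms(3), of "0::'a"] by (simp add: measure_completion)
  also have "\<dots> \<le> measure lebesgue S" using assms by (intro measure_mono_fmeasurable) auto
  finally show ?thesis .
qed

section \<open>Packing numbers and volume\<close>

definition separated :: "('a::ab_group_add \<Rightarrow> real) \<Rightarrow> real \<Rightarrow> 'a set \<Rightarrow> bool" where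
  "separated rho r I \<longleftrightarrow> (\<forall>v\<in>I. \<forall>w\<in>I. v \<noteq> w \<longrightarrow> r \<le> rho (v - w))"

context dilation_space begin

text \<open>For the flow of a matrix this is the trace, the exponential rate at which volumes
  grow.\<close>

definition tau :: real where "tau = ln \<bar>det (matrix (T 1))\<bar>"

lemma measure_T:
  assumes "S \<in> lmeasurable"
  shows "T t ` S \<in> lmeasurable" "measure lebesgue (T t ` S) = exp (tau * t) * measure lebesgue S"
proof -
  have "\<bar>det (matrix (T t))\<bar> = exp (tau * t)"
    unfolding tau_def by (rule one_parameter_det) (auto simp: T_linear T_add continuous_T)
  then show "measure lebesgue (T t ` S) = exp (tau * t) * measure lebesgue S"
    using measure_linear_image[OF T_linear assms] by simp
  show "T t ` S \<in> lmeasurable" by (rule measurable_linear_image[OF T_linear assms])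
qed

text \<open>The exponent in the maximal number of \<open>r\<close>-separated points of
  \<open>H\<close> within gauge \<open>R\<close>. Counting points instead of measuring makes it
  possible to transport the quantity by \<open>F\<close>, whose effect on volumes is not under
  control.\<close>

definition growth_exponent :: "(real^'n::{finite,wellorder}) set \<Rightarrow> real \<Rightarrow> bool" where
  "growth_exponent H a \<longleftrightarrow> a > 0 \<and>
     (\<exists>C>0. \<forall>r R I. 0 < r \<longrightarrow> r \<le> R \<longrightarrow> finite I \<longrightarrow> I \<subseteq> H \<longrightarrow> (\<forall>v\<in>I. rho v \<le> R) \<longrightarrow>
        separated rho r I \<longrightarrow> real (card I) \<le> C * (R / r) powr a) \<and>
     (\<exists>c>0. \<forall>r R. 0 < r \<longrightarrow> r \<le> R \<longrightarrow> (\<exists>I. finite I \<and> I \<subseteq> H \<and> (\<forall>v\<in>I. rho v \<le> R) \<and>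
        separated rho r I \<and> c * (R / r) powr a \<le> real (card I)))"

lemma growth_exponent_upper:
  assumes "growth_exponent H a"
  obtains C where "C > 0" "\<And>r R I. 0 < r \<Longrightarrow> r \<le> R \<Longrightarrow> finite I \<Longrightarrow> I \<subseteq> H \<Longrightarrow> (\<forall>v\<in>I. rho v \<le> R) \<Longrightarrow>
     separated rho r I \<Longrightarrow> real (card I) \<le> C * (R / r) powr a"
proof -
  from assms obtain C where C: "C > 0" "\<forall>r R I. 0 < r \<longrightarrow> r \<le> R \<longrightarrow> finite I \<longrightarrow> I \<subseteq> H \<longrightarrow> (\<forall>v\<in>I. rho v \<le> R) \<longrightarrow>
        separated rho r I \<longrightarrow> real (card I) \<le> C * (R / r) powr a"
    unfolding growth_exponent_def by (elim conjE exE)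
  show thesis by (rule that[OF C(1)], rule C(2)[rule_format]) auto
qed

lemma growth_exponent_lower:
  assumes "growth_exponent H a"
  obtains c where "c > 0" "\<And>r R. 0 < r \<Longrightarrow> r \<le> R \<Longrightarrow> \<exists>I. finite I \<and> I \<subseteq> H \<and> (\<forall>v\<in>I. rho v \<le> R) \<and>
        separated rho r I \<and> c * (R / r) powr a \<le> real (card I)"
proof -
  from assms obtain c where C: "c > 0" "\<forall>r R. 0 < r \<longrightarrow> r \<le> R \<longrightarrow> (\<exists>I. finite I \<and> I \<subseteq> H \<and> (\<forall>v\<in>I. rho v \<le> R) \<and>
        separated rho r I \<and> c * (R / r) powr a \<le> real (card I))"
    unfolding growth_exponent_def by (elim conjE exE)
  show thesis by (rule that[OF C(1)], rule C(2)[rule_format]) auto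
qed

lemma growth_exponent_pos: "growth_exponent H a \<Longrightarrow> a > 0"
  unfolding growth_exponent_def by (elim conjE)

text \<open>
  Lebesgue measure on an invariant subspace \<open>H\<close> is replaced by Lebesgue measure of slabs
  around \<open>H\<close>: with a projection \<open>P\<close> onto \<open>H\<close>, the maps
  \<open>x \<mapsto> T t (P x) + (x - P x)\<close> form a one-parameter group that fixes the transversal part.
\<close>

lemma volume_exponent:
  assumes H: "subspace H" and inv: "\<And>t v. v \<in> H \<Longrightarrow> T t v \<in> H" and ne: "v0 \<in> H" "v0 \<noteq> 0"
  shows "\<exists>a. growth_exponent H a \<and> (H = UNIV \<longrightarrow> a = tau)"
proof -
  obtain P :: "real^'n::{finite,wellorder} \<Rightarrow> real^'n::{finite,wellorder}" where P: "range P \<subseteq> H" "linear P" "\<And>x. x \<in> H \<Longrightarrow> P x = x"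
    using linear_exists_left_inverse_on[OF linear_id H, simplified] by auto
  have PH: "P x \<in> H" for x using P(1) by auto
  have PP [simp]: "P (P x) = P x" for x using P(3)[OF PH] .
  note Psimps [simp] = linear_0[OF P(2)] linear_add[OF P(2)] linear_diff[OF P(2)]
  have PT [simp]: "P (T t (P x)) = T t (P x)" for t x using P(3)[OF inv[OF PH]] .
  define S where "S t x = T t (P x) + (x - P x)" for t x
  have S_lin: "linear (S t)" for t unfolding S_def
    using linear_compose[OF P(2) T_linear[of t]] P(2)
    by (intro linear_compose_add linear_compose_sub linear_id[unfolded id_def]) (simp_all add: comp_def)
  have PS: "P (S t x) = T t (P x)" "S t x - P (S t x) = x - P x" for t x by (auto simp: S_def)
  have S0: "S 0 x = x" for x by (simp add: S_def)
  have S_add: "S (s + t) x = S s (S t x)" for s t x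
    unfolding S_def[of s] PS by (simp add: S_def T_add)
  have S_inv: "S t (S (- t) x) = x" for t x using S_add[of t "- t" x] S0 by simp
  have S_cont: "continuous_on UNIV (\<lambda>t. S t x)" for x
    unfolding S_def by (intro continuous_intros continuous_T)
  define a where "a = ln \<bar>det (matrix (S 1))\<bar>"
  have detS: "\<bar>det (matrix (S t))\<bar> = exp (a * t)" for t
    unfolding a_def by (rule one_parameter_det[OF S_lin S0 S_add S_cont])
  have mS: "S t ` Z \<in> lmeasurable" "measure lebesgue (S t ` Z) = exp (a * t) * measure lebesgue Z"
    if "Z \<in> lmeasurable" for t Z
    using measurable_linear_image[OF S_lin that] measure_linear_image[OF S_lin that] detS by auto
  \<comment> \<open>As \<open>t\<close> grows, \<open>S (- t)\<close> converges to the map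
    \<open>x - P x\<close>, which kills \<open>v0\<close>. The limit has determinant 0, so
    \<open>exp (- (a * t))\<close> tends to 0.\<close>
  have "a > 0"
  proof -
    have "((\<lambda>t. S (- t) x) \<longlongrightarrow> x - P x) at_top" for x
      unfolding S_def using tendsto_add[OF T_tendsto_0[of "P x"] tendsto_const[of "x - P x"]] by simp
    then have "((\<lambda>t. det (matrix (S (- t)))) \<longlongrightarrow> det (matrix (\<lambda>x. x - P x))) at_top"
      by (intro tendsto_det_matrix)
    moreover have "det (matrix (\<lambda>x. x - P x)) = 0"
    proof -
      have lin: "linear (\<lambda>x. x - P x)" by (intro linear_compose_sub P linear_id[unfolded id_def])
      have "\<not> inj (\<lambda>x. x - P x)"
      proof
        assume "inj (\<lambda>x. x - P x)"
        from injD[OF this, of v0 0] show False using P(3)[OF ne(1)] ne(2) by simp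
      qed
      then show ?thesis using det_nz_iff_inj[OF lin] by blast
    qed
    ultimately have "((\<lambda>t. \<bar>det (matrix (S (- t)))\<bar>) \<longlongrightarrow> 0) at_top"
      using tendsto_rabs_zero by metis
    then have "((\<lambda>t. exp (- (a * t))) \<longlongrightarrow> 0) at_top" unfolding detS by simp
    then have "eventually (\<lambda>t. exp (- (a * t)) < 1) at_top" by (rule order_tendstoD) simp
    then have "eventually (\<lambda>t. exp (- (a * t)) < 1 \<and> t > 0) at_top"
      by (intro eventually_conj eventually_gt_at_top)
    then obtain t where "exp (- (a * t)) < 1" "t > 0" using eventually_happens by fastforce
    then show ?thesis by (simp add: zero_less_mult_iff)
  qed
  \<comment> \<open>A slab of radius \<open>e\<close> along \<open>H\<close> and of unit size across
    it; \<open>S t\<close> dilates only the first part.\<close>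
  define Z where "Z e = {x. norm (P x) \<le> e \<and> norm (x - P x) \<le> 1}" for e
  have Z_meas: "Z e \<in> lmeasurable" for e
  proof (rule lmeasurable_compact, unfold compact_eq_bounded_closed, rule conjI)
    have "norm x \<le> e + 1" if "x \<in> Z e" for x
      using that norm_triangle_ineq[of "P x" "x - P x"] by (auto simp: Z_def)
    then show "bounded (Z e)" unfolding bounded_iff by blast
    have "continuous_on UNIV P" using P(2) by (simp add: linear_continuous_on linear_conv_bounded_linear[symmetric])
    then show "closed (Z e)" unfolding Z_def
      by (intro closed_Collect_conj closed_Collect_le continuous_intros) auto
  qed
  have Z_pos: "measure lebesgue (Z e) > 0" if "e > 0" for e
  proof -
    obtain B where B: "B > 0" "\<And>x. norm (P x) \<le> B * norm x" using linear_bounded_pos[OF P(2)] by blast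
    define d where "d = min (e / B) (1 / (1 + B))"
    have "norm (P x) \<le> e" "norm (x - P x) \<le> 1" if "norm x < d" for x
    proof -
      have "norm x \<le> e / B" "norm x \<le> 1 / (1 + B)" using that by (auto simp: d_def)
      then have *: "B * norm x \<le> e" "(1 + B) * norm x \<le> 1" using B(1) by (auto simp: field_simps)
      then show "norm (P x) \<le> e" using B(2)[of x] by linarith
      show "norm (x - P x) \<le> 1" using norm_triangle_ineq4[of x "P x"] B(2)[of x] * by (simp add: algebra_simps)
    qed
    then have "ball 0 d \<subseteq> Z e" by (auto simp: Z_def dist_norm)
    moreover have "d > 0" using B that by (simp add: d_def)
    ultimately show ?thesis using measure_pos_if_ball Z_meas by blast
  qed
  define W where "W w e = (+) w ` Z e" for w e
  have W_meas: "W w e \<in> lmeasurable" "measure lebesgue (W w e) = measure lebesgue (Z e)" for w e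
    using Z_meas by (auto simp: W_def measurable_translation measure_translation)
  have W_iff: "x \<in> W w e \<longleftrightarrow> norm (P x - w) \<le> e \<and> norm (x - P x) \<le> 1" if "w \<in> H" for x w e
  proof -
    have "x \<in> W w e \<longleftrightarrow> x - w \<in> Z e" by (force simp: W_def image_iff)
    then show ?thesis using P(3)[OF that] by (simp add: Z_def)
  qed
  have S_iff: "x \<in> S t ` Z e \<longleftrightarrow> norm (T (- t) (P x)) \<le> e \<and> norm (x - P x) \<le> 1" for x t e
  proof -
    have "x \<in> S t ` Z e \<longleftrightarrow> S (- t) x \<in> Z e"
    proof
      assume "x \<in> S t ` Z e"
      then obtain y where "y \<in> Z e" "x = S t y" by blast
      then show "S (- t) x \<in> Z e" using S_inv[of "- t" y] by simp
    next
      assume "S (- t) x \<in> Z e"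
      then show "x \<in> S t ` Z e" by (rule rev_image_eqI) (rule S_inv[symmetric])
    qed
    also have "\<dots> \<longleftrightarrow> norm (P (S (- t) x)) \<le> e \<and> norm (S (- t) x - P (S (- t) x)) \<le> 1"
      by (simp add: Z_def)
    also have "\<dots> \<longleftrightarrow> norm (T (- t) (P x)) \<le> e \<and> norm (x - P x) \<le> 1"
      by (simp only: arg_cong[OF PS(1), of norm] arg_cong[OF PS(2), of norm])
    finally show ?thesis .
  qed
  obtain M where M: "M \<ge> 1" "\<And>x y. rho (x + y) \<le> M * max (rho x) (rho y)"
    using rho_quasi_triangle by blast
  obtain N where N: "N > 0" "\<And>x. rho x \<le> 1 \<Longrightarrow> norm x \<le> N" using rho_le1_norm_le by blast
  obtain e where e: "e > 0" "\<And>x. norm x < e \<Longrightarrow> rho x < 1" using small_norm_rho by blast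
  \<comment> \<open>The translates of \<open>Z (e / 3)\<close> at separated points are disjoint,
    because two radii \<open>e / 3\<close> add up to less than \<open>e\<close>. All of them lie in
    \<open>Z N\<close> dilated by \<open>M * q\<close>, where \<open>M\<close> comes from the
    quasi-triangle inequality.\<close>
  define C where "C = M powr a * measure lebesgue (Z N) / measure lebesgue (Z (e / 3))"
  have C: "C > 0" using Z_pos N e M by (simp add: C_def)
  have upper1: "real (card I) \<le> C * q powr a"
    if q: "q \<ge> 1" and I: "finite I" "I \<subseteq> H" "\<And>v. v \<in> I \<Longrightarrow> rho v \<le> q" "separated rho 1 I" for q I
  proof -
    have "(\<Sum>w\<in>I. measure lebesgue (W w (e / 3))) \<le> measure lebesgue (S (ln (M * q)) ` Z N)"
    proof (rule sum_measure_le[OF I(1)])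
      show "disjoint_family_on (\<lambda>w. W w (e / 3)) I"
        unfolding disjoint_family_on_def
      proof (intro ballI impI equals0I)
        fix w w' x assume w: "w \<in> I" "w' \<in> I" "w \<noteq> w'" "x \<in> W w (e / 3) \<inter> W w' (e / 3)"
        then have "norm (P x - w) \<le> e / 3" "norm (P x - w') \<le> e / 3" using W_iff I(2) by auto
        then have "norm (w - w') \<le> e / 3 + e / 3"
          using norm_triangle_ineq4[of "P x - w'" "P x - w"] by simp
        then have "rho (w - w') < 1" using e by (intro e(2)) auto
        then show False using w I(4) unfolding separated_def by force
      qed
      show "W w (e / 3) \<subseteq> S (ln (M * q)) ` Z N" if w: "w \<in> I" for w
      proof
        fix x assume "x \<in> W w (e / 3)"
        then have x: "norm (P x - w) \<le> e / 3" "norm (x - P x) \<le> 1" using W_iff I(2) w by auto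
        have "rho (P x - w) < 1" using x e by (intro e(2)) auto
        then have "max (rho w) (rho (P x - w)) \<le> q" using I(3)[OF w] q by auto
        then have "rho (P x) \<le> M * q"
          using M(2)[of w "P x - w"] M(1) by (smt (verit) add_diff_cancel_left' diff_add_cancel add.commute mult_left_mono)
        then have "rho (T (- ln (M * q)) (P x)) \<le> 1" using M(1) q by (simp add: rho_scaled divide_le_eq_1)
        then show "x \<in> S (ln (M * q)) ` Z N" using N(2) x unfolding S_iff by blast
      qed
    qed (use W_meas mS Z_meas in auto)
    then have "real (card I) * measure lebesgue (Z (e / 3)) \<le> exp (a * ln (M * q)) * measure lebesgue (Z N)"
      using W_meas mS[OF Z_meas] by simp
    moreover have "exp (a * ln (M * q)) = M powr a * q powr a"
      using M(1) q by (simp add: powr_def ln_mult distrib_left exp_add)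
    ultimately show ?thesis using Z_pos[of "e / 3"] e(1) by (simp add: C_def field_simps)
  qed
  define c where "c = measure lebesgue (Z (e / 3)) / measure lebesgue (Z N)"
  have c: "c > 0" using Z_pos N e by (simp add: c_def)
  have lower1: "\<exists>I. finite I \<and> I \<subseteq> H \<and> (\<forall>v\<in>I. rho v \<le> q) \<and> separated rho 1 I \<and> c * q powr a \<le> real (card I)"
    if q: "q \<ge> 1" for q
  proof -
    \<comment> \<open>\<open>upper1\<close> bounds the cardinality of separated sets, so a largest
      one exists; its maximality makes it a cover by balls of radius 1.\<close>
    define adm where "adm I \<longleftrightarrow> finite I \<and> I \<subseteq> H \<and> (\<forall>v\<in>I. rho v \<le> q) \<and> separated rho 1 I" for I
    have "adm {}" by (simp add: adm_def separated_def)
    moreover have "card I < Suc (nat \<lfloor>C * q powr a\<rfloor>)" if "adm I" for I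
    proof -
      have "real (card I) \<le> C * q powr a" using that upper1[OF q] by (auto simp: adm_def)
      then show ?thesis by (simp add: le_nat_floor less_Suc_eq_le)
    qed
    ultimately obtain I where I: "adm I" "\<And>J. adm J \<Longrightarrow> card J \<le> card I"
      using ex_has_greatest_nat[of adm "{}" card] by metis
    have fin: "finite I" using I(1) by (simp add: adm_def)
    have cover: "\<exists>w\<in>I. rho (v - w) < 1" if v: "v \<in> H" "rho v \<le> q" for v
    proof (rule ccontr)
      assume *: "\<not> ?thesis"
      then have "v \<notin> I" by force
      have "adm (insert v I)" using I(1) v * rho_commute[of v] unfolding adm_def separated_def
        by (auto simp: not_less)
      from I(2)[OF this] show False using \<open>v \<notin> I\<close> fin by simp
    qed
    have "S (ln q) ` Z (e / 3) \<subseteq> (\<Union>w\<in>I. W w N)"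
    proof
      fix x assume "x \<in> S (ln q) ` Z (e / 3)"
      then have x: "norm (T (- ln q) (P x)) \<le> e / 3" "norm (x - P x) \<le> 1" unfolding S_iff by auto
      have "rho (T (- ln q) (P x)) < 1" using x e by (intro e(2)) auto
      then have "rho (P x) \<le> q" using q by (simp add: rho_scaled divide_less_eq_1)
      then obtain w where "w \<in> I" "rho (P x - w) < 1" using cover[OF PH] by blast
      moreover have "norm (P x - w) \<le> N" using \<open>rho (P x - w) < 1\<close> by (intro N) auto
      moreover have "w \<in> H" using I(1) \<open>w \<in> I\<close> by (auto simp: adm_def)
      ultimately have "x \<in> W w N" using x(2) W_iff by blast
      then show "x \<in> (\<Union>w\<in>I. W w N)" using \<open>w \<in> I\<close> by blast
    qed
    then have "measure lebesgue (S (ln q) ` Z (e / 3)) \<le> measure lebesgue (\<Union>w\<in>I. W w N)"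
      using W_meas mS Z_meas fin by (intro measure_mono_fmeasurable) (auto intro!: fmeasurable.finite_UN)
    also have "\<dots> \<le> (\<Sum>w\<in>I. measure lebesgue (W w N))"
      using W_meas fin by (intro measure_UNION_le) auto
    finally have "exp (a * ln q) * measure lebesgue (Z (e / 3)) \<le> real (card I) * measure lebesgue (Z N)"
      using W_meas mS[OF Z_meas] by simp
    moreover have "exp (a * ln q) = q powr a" using q by (simp add: powr_def)
    ultimately have "c * q powr a \<le> real (card I)" using Z_pos[OF N(1)] by (simp add: c_def field_simps)
    then show ?thesis using I(1) by (auto simp: adm_def)
  qed
  have inj_T: "inj (T t)" for t by (metis T_inv(1) injI)
  have sep_T: "separated rho (s * r) (T (ln s) ` I)" if "separated rho r I" "s > 0" for s r I
    using that unfolding separated_def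
    by (auto simp: rho_scaled simp flip: T_simps(3))
  have upper: "real (card I) \<le> C * (R / r) powr a"
    if "0 < r" "r \<le> R" "finite I" "I \<subseteq> H" "\<forall>v\<in>I. rho v \<le> R" "separated rho r I" for r R I
  proof -
    have "real (card (T (ln (1 / r)) ` I)) \<le> C * (R / r) powr a"
    proof (rule upper1)
      show "separated rho 1 (T (ln (1 / r)) ` I)" using sep_T[OF that(6), of "1 / r"] that(1) by simp
      show "rho v \<le> R / r" if "v \<in> T (ln (1 / r)) ` I" for v
        using that \<open>\<forall>v\<in>I. rho v \<le> R\<close> \<open>0 < r\<close> by (auto simp: rho_scaled divide_right_mono simp del: ln_div)
    qed (use that inv in auto)
    then show ?thesis by (simp add: card_image[OF inj_on_subset[OF inj_T subset_UNIV]])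
  qed
  have lower: "\<exists>I. finite I \<and> I \<subseteq> H \<and> (\<forall>v\<in>I. rho v \<le> R) \<and> separated rho r I \<and> c * (R / r) powr a \<le> real (card I)"
    if "0 < r" "r \<le> R" for r R
  proof -
    have "1 \<le> R / r" using that by simp
    from lower1[OF this]
    obtain I where I: "finite I" "I \<subseteq> H" "\<forall>v\<in>I. rho v \<le> R / r" "separated rho 1 I" "c * (R / r) powr a \<le> real (card I)"
      by blast
    have "separated rho r (T (ln r) ` I)" using sep_T[OF I(4), of r] that by simp
    moreover have "card (T (ln r) ` I) = card I" by (simp add: card_image[OF inj_on_subset[OF inj_T subset_UNIV]])
    moreover have "\<forall>v\<in>T (ln r) ` I. rho v \<le> R" using I(3) that by (auto simp: rho_scaled field_simps)
    ultimately show ?thesis using I inv by (intro exI[of _ "T (ln r) ` I"]) auto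
  qed
  have a_tau: "a = tau" if "H = UNIV"
  proof -
    have "S 1 = T 1" using P(3) that by (auto simp: S_def)
    then show ?thesis by (simp add: a_def tau_def)
  qed
  have "\<exists>C>0. \<forall>r R I. 0 < r \<longrightarrow> r \<le> R \<longrightarrow> finite I \<longrightarrow> I \<subseteq> H \<longrightarrow> (\<forall>v\<in>I. rho v \<le> R) \<longrightarrow>
      separated rho r I \<longrightarrow> real (card I) \<le> C * (R / r) powr a"
    using C upper by blast
  moreover have "\<exists>c>0. \<forall>r R. 0 < r \<longrightarrow> r \<le> R \<longrightarrow> (\<exists>I. finite I \<and> I \<subseteq> H \<and> (\<forall>v\<in>I. rho v \<le> R) \<and>
      separated rho r I \<and> c * (R / r) powr a \<le> real (card I))"
    using c lower by blast
  ultimately have "growth_exponent H a" unfolding growth_exponent_def using \<open>a > 0\<close> by (intro conjI)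
  then show ?thesis using a_tau by (intro exI[of _ a] conjI impI)
qed

end

section \<open>Bounds for the variation\<close>

text \<open>A single chain from \<open>p\<close> to \<open>p + real k *\<^sub>R h\<close> gives no
  relation to the volumes of the cells \<open>E j\<close>, so the telescoped variation is integrated
  over all starting points. By translation invariance each of the \<open>k\<close> steps contributes
  at most the integral of the one-step variation over the larger ball.\<close>

lemma translated_measure_bound:
  fixes u :: "'a::euclidean_space \<Rightarrow> real"
  assumes u: "continuous_on UNIV u" and c: "c \<ge> 0"
    and low: "\<And>p. p \<in> cball x0 d \<Longrightarrow> c \<le> \<bar>u (p + real k *\<^sub>R h) - u p\<bar>"
    and I: "finite I" and E: "\<And>j. j \<in> I \<Longrightarrow> compact (E j)"
    and cover: "cball x0 (d + real k * norm h) \<subseteq> (\<Union>j\<in>I. E j)"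
    and G: "\<And>j x. j \<in> I \<Longrightarrow> x \<in> E j \<Longrightarrow> \<bar>u (x + h) - u x\<bar> \<le> G j"  "\<And>j. j \<in> I \<Longrightarrow> G j \<ge> 0"
  shows "c * measure lebesgue (cball x0 d) \<le> real k * (\<Sum>j\<in>I. measure lebesgue (E j) * G j)"
proof -
  define g where "g x = \<bar>u (x + h) - u x\<bar>" for x
  have "continuous_on UNIV g" unfolding g_def
    by (intro continuous_intros continuous_on_compose2[OF u] u) auto
  then have g [measurable]: "g \<in> borel_measurable borel" by (rule borel_measurable_continuous_onI)
  have Em [measurable]: "E j \<in> sets borel" if "j \<in> I" for j
    using E[OF that] by (simp add: borel_compact)
  define A where "A = (\<integral>\<^sup>+x. indicator (cball x0 (d + real k * norm h)) x * ennreal (g x) \<partial>lborel)"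
  have shift: "(\<integral>\<^sup>+p. indicator (cball x0 d) p * ennreal (g (p + real i *\<^sub>R h)) \<partial>lborel) \<le> A" if "i < k" for i
  proof -
    have "(\<integral>\<^sup>+p. indicator (cball x0 d) p * ennreal (g (p + real i *\<^sub>R h)) \<partial>lborel)
       \<le> (\<integral>\<^sup>+p. indicator (cball x0 (d + real k * norm h)) (real i *\<^sub>R h + p) * ennreal (g (real i *\<^sub>R h + p)) \<partial>lborel)"
    proof (rule nn_integral_mono)
      fix p
      have "real i *\<^sub>R h + p \<in> cball x0 (d + real k * norm h)" if p: "p \<in> cball x0 d"
      proof -
        have "dist x0 (real i *\<^sub>R h + p) \<le> dist x0 p + norm (real i *\<^sub>R h)"
          using dist_triangle[of x0 "real i *\<^sub>R h + p" p] by (simp add: dist_norm)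
        also have "\<dots> \<le> d + real k * norm h"
          using p \<open>i < k\<close> by (intro add_mono) (auto intro: mult_right_mono)
        finally show ?thesis by simp
      qed
      then show "indicator (cball x0 d) p * ennreal (g (p + real i *\<^sub>R h))
         \<le> indicator (cball x0 (d + real k * norm h)) (real i *\<^sub>R h + p) * ennreal (g (real i *\<^sub>R h + p))"
        by (auto simp: indicator_def add.commute)
    qed
    also have "\<dots> = (\<integral>\<^sup>+x. indicator (cball x0 (d + real k * norm h)) x * ennreal (g x) \<partial>distr lborel borel ((+) (real i *\<^sub>R h)))"
      by (subst nn_integral_distr)
         (auto intro!: borel_measurable_times_ennreal borel_measurable_indicator measurable_compose[OF g measurable_ennreal])
    also have "\<dots> = A" by (simp only: lborel_distr_plus A_def)
    finally show ?thesis .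
  qed
  have "ennreal c * emeasure lborel (cball x0 d) = (\<integral>\<^sup>+p. ennreal c * indicator (cball x0 d) p \<partial>lborel)"
    by (simp add: nn_integral_cmult_indicator)
  also have "\<dots> \<le> (\<integral>\<^sup>+p. (\<Sum>i<k. indicator (cball x0 d) p * ennreal (g (p + real i *\<^sub>R h))) \<partial>lborel)"
  proof (rule nn_integral_mono)
    fix p
    have "ennreal c \<le> (\<Sum>i<k. ennreal (g (p + real i *\<^sub>R h)))" if "p \<in> cball x0 d"
    proof -
      have "u (p + real k *\<^sub>R h) - u p = (\<Sum>i<k. u (p + real (Suc i) *\<^sub>R h) - u (p + real i *\<^sub>R h))"
        by (subst sum_lessThan_telescope) simp
      then have "\<bar>u (p + real k *\<^sub>R h) - u p\<bar> \<le> (\<Sum>i<k. \<bar>u (p + real (Suc i) *\<^sub>R h) - u (p + real i *\<^sub>R h)\<bar>)"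
        by (simp only: sum_abs)
      also have "\<dots> = (\<Sum>i<k. g (p + real i *\<^sub>R h))"
        by (intro sum.cong refl) (simp add: g_def algebra_simps)
      finally have "c \<le> (\<Sum>i<k. g (p + real i *\<^sub>R h))" using low[OF that] by linarith
      then show ?thesis by (subst sum_ennreal) (auto simp: g_def)
    qed
    then show "ennreal c * indicator (cball x0 d) p \<le> (\<Sum>i<k. indicator (cball x0 d) p * ennreal (g (p + real i *\<^sub>R h)))"
      by (auto simp: indicator_def)
  qed
  also have "\<dots> = (\<Sum>i<k. (\<integral>\<^sup>+p. indicator (cball x0 d) p * ennreal (g (p + real i *\<^sub>R h)) \<partial>lborel))"
    by (rule nn_integral_sum)
       (intro borel_measurable_times_ennreal borel_measurable_indicator borel_measurable_add borel_measurable_const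
          measurable_compose[OF measurable_compose[OF _ g] measurable_ennreal]; simp)
  also have "\<dots> \<le> (\<Sum>i<k. A)" by (intro sum_mono shift) auto
  also have "\<dots> = of_nat k * A" by simp
  also have "A \<le> (\<integral>\<^sup>+x. (\<Sum>j\<in>I. ennreal (G j) * indicator (E j) x) \<partial>lborel)"
    unfolding A_def
  proof (rule nn_integral_mono)
    fix x
    show "indicator (cball x0 (d + real k * norm h)) x * ennreal (g x) \<le> (\<Sum>j\<in>I. ennreal (G j) * indicator (E j) x)"
    proof (cases "x \<in> cball x0 (d + real k * norm h)")
      case True
      then obtain j where j: "j \<in> I" "x \<in> E j" using cover by blast
      have "ennreal (g x) \<le> ennreal (G j) * indicator (E j) x"
        using G(1)[OF j] j by (simp add: g_def ennreal_leI)
      also have "\<dots> \<le> (\<Sum>j\<in>I. ennreal (G j) * indicator (E j) x)"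
        using I j by (intro member_le_sum) auto
      finally show ?thesis using True by simp
    qed auto
  qed
  also have "\<dots> = (\<Sum>j\<in>I. ennreal (G j) * emeasure lborel (E j))"
    by (subst nn_integral_sum) (auto simp: nn_integral_cmult_indicator)
  also have "\<dots> = (\<Sum>j\<in>I. ennreal (measure lebesgue (E j) * G j))"
  proof (rule sum.cong[OF refl])
    fix j assume j: "j \<in> I"
    have "emeasure lborel (E j) = ennreal (measure lborel (E j))"
      using emeasure_bounded_finite[OF compact_imp_bounded[OF E[OF j]]] by (simp add: emeasure_eq_ennreal_measure)
    then show "ennreal (G j) * emeasure lborel (E j) = ennreal (measure lebesgue (E j) * G j)"
      using G(2)[OF j] Em[OF j] by (simp add: measure_completion ennreal_mult mult.commute)
  qed
  also have "\<dots> = ennreal (\<Sum>j\<in>I. measure lebesgue (E j) * G j)"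
    using G(2) by (subst sum_ennreal) auto
  also have "of_nat k * \<dots> = ennreal (real k * (\<Sum>j\<in>I. measure lebesgue (E j) * G j))"
    using G(2) by (subst ennreal_mult) (auto simp: sum_nonneg ennreal_of_nat_eq_real_of_nat)
  also have "emeasure lborel (cball x0 d) = ennreal (measure lebesgue (cball x0 d))"
    using emeasure_bounded_finite[of "cball x0 d"] by (simp add: emeasure_eq_ennreal_measure measure_completion)
  finally have "ennreal (c * measure lebesgue (cball x0 d)) \<le> ennreal (real k * (\<Sum>j\<in>I. measure lebesgue (E j) * G j))"
    using c by (simp add: ennreal_mult mult_left_mono)
  then show ?thesis
    using G(2) by (subst (asm) ennreal_le_iff) (auto intro!: sum_nonneg mult_nonneg_nonneg)
qed

section \<open>Admissible functionals and the length-area estimate\<close>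

context dilation_space begin

lemma tau_pos: "tau > 0"
proof -
  obtain b :: "real^'n::{finite,wellorder}" where "b \<noteq> 0" using nonzero_Basis by blast
  from volume_exponent[OF subspace_UNIV _ UNIV_I this] show ?thesis
    using growth_exponent_pos by auto
qed

text \<open>A largest \<open>r\<close>-separated subset of the Euclidean ball covers it, and the
  packing bound for the whole space, whose exponent is \<open>tau\<close>, limits its size.\<close>

lemma ball_cover:
  "\<exists>C>0. \<forall>r. 0 < r \<longrightarrow> r \<le> 1 \<longrightarrow> (\<exists>I. finite I \<and> I \<subseteq> cball x0 S \<and> separated rho r I \<and>
     real (card I) \<le> C * r powr - tau \<and> (\<forall>x\<in>cball x0 S. \<exists>w\<in>I. rho (x - w) < r))"
proof -
  obtain b :: "real^'n::{finite,wellorder}" where b: "b \<noteq> 0" using nonzero_Basis by blast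
  from volume_exponent[OF subspace_UNIV _ UNIV_I b] have "growth_exponent UNIV tau" by auto
  then obtain C where C: "C > 0" "\<And>r R I. 0 < r \<Longrightarrow> r \<le> R \<Longrightarrow> finite I \<Longrightarrow> I \<subseteq> UNIV \<Longrightarrow>
      (\<forall>v\<in>I. rho v \<le> R) \<Longrightarrow> separated rho r I \<Longrightarrow> real (card I) \<le> C * (R / r) powr tau"
    by (rule growth_exponent_upper) (rule that)
  obtain R where R: "R > 0" "\<And>x. norm x \<le> S \<Longrightarrow> rho x \<le> R" using norm_le_rho_le by blast
  define C' where "C' = C * (max R 1) powr tau"
  have bound: "real (card I) \<le> C' * r powr - tau"
    if "0 < r" "r \<le> 1" "finite I" "I \<subseteq> cball x0 S" "separated rho r I" for r I
  proof -
    have "real (card ((\<lambda>x. x - x0) ` I)) \<le> C * (max R 1 / r) powr tau"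
    proof (rule C(2))
      show "\<forall>v\<in>(\<lambda>x. x - x0) ` I. rho v \<le> max R 1"
        using that(4) R(2) by (fastforce simp: dist_norm norm_minus_commute le_max_iff_disj)
      show "separated rho r ((\<lambda>x. x - x0) ` I)" using that(5) by (auto simp: separated_def)
    qed (use that in auto)
    moreover have "(max R 1 / r) powr tau = max R 1 powr tau * r powr - tau"
      using that(1) by (subst powr_divide) (auto simp: powr_minus_divide)
    moreover have "card ((\<lambda>x. x - x0) ` I) = card I" by (intro card_image) simp
    ultimately show ?thesis by (simp add: C'_def mult.assoc)
  qed
  have "\<exists>I. finite I \<and> I \<subseteq> cball x0 S \<and> separated rho r I \<and>
     real (card I) \<le> C' * r powr - tau \<and> (\<forall>x\<in>cball x0 S. \<exists>w\<in>I. rho (x - w) < r)" if r: "0 < r" "r \<le> 1" for r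
  proof -
    define adm where "adm I \<longleftrightarrow> finite I \<and> I \<subseteq> cball x0 S \<and> separated rho r I" for I
    have "adm {}" by (simp add: adm_def separated_def)
    moreover have "card I < Suc (nat \<lfloor>C' * r powr - tau\<rfloor>)" if "adm I" for I
      using bound[OF r, of I] that by (simp add: le_nat_floor less_Suc_eq_le adm_def)
    ultimately obtain I where I: "adm I" "\<And>J. adm J \<Longrightarrow> card J \<le> card I"
      using ex_has_greatest_nat[of adm "{}" card] by metis
    have "\<exists>w\<in>I. rho (x - w) < r" if x: "x \<in> cball x0 S" for x
    proof (rule ccontr)
      assume *: "\<not> ?thesis"
      then have "x \<notin> I" using r by force
      have "adm (insert x I)" using I(1) x * rho_commute[of x] unfolding adm_def separated_def
        by (auto simp: not_less)
      from I(2)[OF this] show False using \<open>x \<notin> I\<close> I(1) by (simp add: adm_def)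
    qed
    then show ?thesis using I(1) bound[OF r, of I] by (auto simp: adm_def)
  qed
  moreover have "C' > 0" using C(1) by (simp add: C'_def)
  ultimately show ?thesis by blast
qed

text \<open>On a ball of radius \<open>r\<close> such a functional varies by at most a constant
  times \<open>r powr b\<close>. The power \<open>tau / b\<close> of this is
  \<open>r powr tau\<close>, the volume of a dilated norm ball inside the ball up to a constant, and
  disjointness bounds the total volume.\<close>

lemma variation_class_linear:
  assumes lin: "linear phi" and bnd: "\<And>t x. \<bar>phi (T t x)\<bar> \<le> C * exp (b * t) * norm x"
    and b: "b > 0"
  shows "phi \<in> variation_class rho (tau / b)"
proof -
  obtain M where M: "M \<ge> 1" "\<And>x y. rho (x + y) \<le> M * max (rho x) (rho y)"
    using rho_quasi_triangle by blast
  obtain N where N: "N > 0" "\<And>x. rho x \<le> 1 \<Longrightarrow> norm x \<le> N" using rho_le1_norm_le by blast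
  obtain e where e: "e > 0" "\<And>x. norm x < e \<Longrightarrow> rho x < 1" using small_norm_rho by blast
  have "rho_continuous rho phi"
    unfolding rho_continuous_def
  proof (intro allI impI)
    fix x and e :: real assume e: "e > 0"
    obtain B where B: "B > 0" "\<And>x. norm (phi x) \<le> B * norm x" using linear_bounded_pos[OF lin] by blast
    obtain d where d: "d > 0" "\<And>x. rho x < d \<Longrightarrow> norm x < e / B" using norm_small[of "e / B"] e B by auto
    have "\<bar>phi y - phi x\<bar> < e" if "rho (y - x) < d" for y
    proof -
      have "\<bar>phi y - phi x\<bar> \<le> B * norm (y - x)" using B(2)[of "y - x"] lin by (simp add: linear_diff)
      also have "\<dots> < e" using d(2)[OF that] B(1) by (simp add: field_simps)
      finally show ?thesis .
    qed
    then show "\<exists>d>0. \<forall>y. rho (y - x) < d \<longrightarrow> \<bar>phi y - phi x\<bar> < e" using d(1) by blast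
  qed
  moreover have "fin_var rho (tau / b) phi"
    unfolding fin_var_def
  proof (intro allI)
    fix a :: "real^'n::{finite,wellorder}" and R :: real
    define D where "D = \<bar>C\<bar> * N * R powr b"
    define m where "m = measure lebesgue (cball (0::real^'n::{finite,wellorder}) (e / 2))"
    have m: "m > 0" unfolding m_def using e(1) by (intro measure_pos_if_ball[where e = "e / 2"]) auto
    obtain S where S: "S > 0" "\<And>x. rho x \<le> M * R \<Longrightarrow> norm x \<le> S" using rho_le_norm_le by blast
    define V where "V = D powr (tau / b) * (measure lebesgue (cball a S) / m)"
    show "\<exists>V. \<forall>I r y. finite I \<longrightarrow>
     (\<forall>x\<in>I. 0 < r x \<and> r x \<le> R \<and> rho (x - a) \<le> R \<and> rho (y x - x) \<le> R * r x) \<longrightarrow>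
     disj_balls rho I r \<longrightarrow> (\<Sum>x\<in>I. \<bar>phi (y x) - phi x\<bar> powr (tau / b)) \<le> V"
    proof (intro exI[of _ V] allI impI)
      fix I r y
      assume fin: "finite I"
        and I: "\<forall>x\<in>I. 0 < r x \<and> r x \<le> R \<and> rho (x - a) \<le> R \<and> rho (y x - x) \<le> R * r x"
        and dj: "disj_balls rho I r"
      \<comment> \<open>Radius \<open>e / 2\<close> puts the closed ball inside the open one of
        radius \<open>e\<close>, where \<open>rho\<close> is below 1; so \<open>E x\<close> lies in
        the gauge ball of radius \<open>r x\<close>.\<close>
      define E where "E x = (+) x ` T (ln (r x)) ` cball 0 (e / 2)" for x
      have E_rho: "rho (z - x) < r x" if "x \<in> I" "z \<in> E x" for x z
      proof -
        from that(2) obtain q where q: "norm q \<le> e / 2" "z = x + T (ln (r x)) q" by (auto simp: E_def)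
        have "rho q < 1" using q(1) e by (intro e(2)) auto
        then show ?thesis using I that(1) q(2) by (simp add: rho_scaled)
      qed
      have E_meas: "E x \<in> lmeasurable" "measure lebesgue (E x) = r x powr tau * m" if "x \<in> I" for x
      proof -
        have "T (ln (r x)) ` cball 0 (e / 2) \<in> lmeasurable" by (rule measure_T) simp
        then show "E x \<in> lmeasurable" unfolding E_def by (rule measurable_translation)
        have "measure lebesgue (E x) = exp (tau * ln (r x)) * m"
          unfolding E_def m_def by (simp add: measure_translation measure_T)
        moreover have "r x > 0" using I that by blast
        ultimately show "measure lebesgue (E x) = r x powr tau * m" by (simp add: powr_def)
      qed
      have "(\<Sum>x\<in>I. measure lebesgue (E x)) \<le> measure lebesgue (cball a S)"
      proof (rule sum_measure_le[OF fin])
        show "disjoint_family_on E I"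
          unfolding disjoint_family_on_def
        proof (intro ballI impI equals0I)
          fix x x' z assume "x \<in> I" "x' \<in> I" "x \<noteq> x'" "z \<in> E x \<inter> E x'"
          then show False using E_rho dj unfolding disj_balls_def by blast
        qed
        show "E x \<subseteq> cball a S" if x: "x \<in> I" for x
        proof
          fix z assume "z \<in> E x"
          then have "max (rho (z - x)) (rho (x - a)) \<le> R" using I x E_rho by fastforce
          then have "rho (z - a) \<le> M * R"
            using M(2)[of "z - x" "x - a"] M(1) by (smt (verit) add_diff_eq diff_add_cancel mult_left_mono)
          then show "z \<in> cball a S" using S(2)[of "z - a"] by (auto simp: dist_norm norm_minus_commute)
        qed
      qed (use E_meas in auto)
      then have "(\<Sum>x\<in>I. r x powr tau) * m \<le> measure lebesgue (cball a S)"
        using E_meas by (simp add: sum_distrib_right)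
      then have vol: "(\<Sum>x\<in>I. r x powr tau) \<le> measure lebesgue (cball a S) / m"
        using m by (simp add: field_simps)
      have "(\<Sum>x\<in>I. \<bar>phi (y x) - phi x\<bar> powr (tau / b)) \<le> (\<Sum>x\<in>I. D powr (tau / b) * r x powr tau)"
      proof (rule sum_mono)
        fix x assume x: "x \<in> I"
        then have r: "r x > 0" "R > 0" using I by force+
        define q where "q = T (- ln (R * r x)) (y x - x)"
        have "rho q \<le> 1" unfolding q_def using r I x by (subst rho_scaled) (auto simp: divide_le_eq_1)
        have Rr: "exp (b * ln (R * r x)) = R powr b * r x powr b"
          using r by (simp add: powr_def ln_mult distrib_left exp_add)
        have "y x - x = T (ln (R * r x)) q" by (simp add: q_def)
        then have "\<bar>phi (y x) - phi x\<bar> = \<bar>phi (T (ln (R * r x)) q)\<bar>" using lin by (simp flip: linear_diff)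
        also have "\<dots> \<le> C * exp (b * ln (R * r x)) * norm q" by (rule bnd)
        also have "\<dots> \<le> \<bar>C\<bar> * exp (b * ln (R * r x)) * N"
          using N(2)[OF \<open>rho q \<le> 1\<close>] by (intro mult_mono) auto
        also have "\<dots> = D * r x powr b" by (simp add: D_def Rr)
        finally have "\<bar>phi (y x) - phi x\<bar> powr (tau / b) \<le> (D * r x powr b) powr (tau / b)"
          using tau_pos b by (intro powr_mono2) auto
        also have "\<dots> = D powr (tau / b) * r x powr tau"
          using b N(1) by (simp add: powr_mult powr_powr D_def)
        finally show "\<bar>phi (y x) - phi x\<bar> powr (tau / b) \<le> D powr (tau / b) * r x powr tau" .
      qed
      also have "\<dots> \<le> V" unfolding V_def sum_distrib_left[symmetric] using vol by (intro mult_left_mono) auto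
      finally show "(\<Sum>x\<in>I. \<bar>phi (y x) - phi x\<bar> powr (tau / b)) \<le> V" .
    qed
  qed
  ultimately show ?thesis by (simp add: variation_class_def)
qed

text \<open>A volume count: about \<open>exp (b * t)\<close> translates of the image of the unit
  ball under \<open>T (- t)\<close> are separated by the values of \<open>phi\<close> and stay in a
  fixed ball, and each has volume of order \<open>exp (- (tau * t))\<close>. The result makes the
  exponent \<open>tau / b\<close> at least 1.\<close>

lemma tau_ge:
  assumes lin: "linear phi" and nz: "phi x1 \<noteq> 0"
    and bnd: "\<And>t x. \<bar>phi (T t x)\<bar> \<le> C * exp (b * t) * norm x"
  shows "b \<le> tau"
proof (rule ccontr)
  assume "\<not> b \<le> tau"
  then have bt: "b - tau > 0" by simp
  define x2 where "x2 = x1 /\<^sub>R phi x1"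
  have x2: "phi x2 = 1" using nz lin by (simp add: x2_def linear_scale)
  obtain K k where K: "K \<ge> 1" "k > 0" "\<And>t x. t \<le> 0 \<Longrightarrow> norm (T t x) \<le> K * exp (k * t) * norm x"
    using T_contract1 by blast
  define C1 where "C1 = max C 1"
  have C1: "C1 > 0" "C \<le> C1" by (auto simp: C1_def)
  define V where "V = measure lebesgue (cball (0::real^'n::{finite,wellorder}) (K + norm x2))"
  define m where "m = measure lebesgue (cball (0::real^'n::{finite,wellorder}) 1)"
  have m: "m > 0" unfolding m_def by (intro measure_pos_if_ball[where e = 1]) auto
  have bound: "exp ((b - tau) * t) \<le> 3 * C1 * (V / m + 1)" if t: "t \<ge> 0" for t
  proof -
    \<comment> \<open>On each copy \<open>phi\<close> deviates from its value at the centre by at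
      most \<open>del\<close>, so values \<open>3 * del\<close> apart give disjoint copies. The
      number \<open>J\<close> keeps all these values below 1, hence the centres bounded.\<close>
    define del where "del = C1 * exp (- (b * t))"
    have del: "del > 0" using C1 by (simp add: del_def)
    define J where "J = nat \<lfloor>1 / (3 * del)\<rfloor>"
    have J: "real J \<le> 1 / (3 * del)" "1 / (3 * del) < real J + 1"
      using del unfolding J_def by auto
    define E where "E j = (+) ((real j * (3 * del)) *\<^sub>R x2) ` T (- t) ` cball 0 1" for j
    have Tm: "T (- t) ` cball 0 1 \<in> lmeasurable" by (rule measure_T) simp
    have E_phi: "\<bar>phi z - real j * (3 * del)\<bar> \<le> del"  "norm (z - (real j * (3 * del)) *\<^sub>R x2) \<le> K"
      if "z \<in> E j" for z j
    proof -
      from that obtain q where q: "norm q \<le> 1" "z = (real j * (3 * del)) *\<^sub>R x2 + T (- t) q"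
        by (auto simp: E_def)
      have "phi z - real j * (3 * del) = phi (T (- t) q)"
        using x2 lin by (simp add: q(2) linear_add linear_scale)
      moreover have "\<bar>phi (T (- t) q)\<bar> \<le> C1 * exp (b * (- t)) * 1"
        by (rule order_trans[OF bnd]) (use q(1) C1 in \<open>intro mult_mono; auto\<close>)
      ultimately show "\<bar>phi z - real j * (3 * del)\<bar> \<le> del" by (simp add: del_def)
      have "norm (T (- t) q) \<le> K * exp (k * (- t)) * norm q" using t by (intro K(3)) simp
      also have "\<dots> \<le> K * 1 * 1" using K q(1) t by (intro mult_mono) auto
      finally show "norm (z - (real j * (3 * del)) *\<^sub>R x2) \<le> K" using q(2) by simp
    qed
    have "(\<Sum>j<J. measure lebesgue (E j)) \<le> V"
      unfolding V_def
    proof (rule sum_measure_le)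
      show "disjoint_family_on E {..<J}"
        unfolding disjoint_family_on_def
      proof (intro ballI impI equals0I)
        fix i j z assume ij: "i \<noteq> j" "z \<in> E i \<inter> E j"
        then have "\<bar>real i * (3 * del) - real j * (3 * del)\<bar> \<le> 2 * del" using E_phi(1)[of z i] E_phi(1)[of z j] by auto
        moreover have "\<bar>real i * (3 * del) - real j * (3 * del)\<bar> = \<bar>real i - real j\<bar> * (3 * del)"
          using del by (simp add: abs_mult flip: left_diff_distrib)
        moreover have "\<bar>real i - real j\<bar> \<ge> 1" using ij(1) by linarith
        then have "\<bar>real i - real j\<bar> * (3 * del) \<ge> 1 * (3 * del)" using del by (intro mult_right_mono) auto
        ultimately show False using del by simp
      qed
      show "E j \<subseteq> cball 0 (K + norm x2)" if "j \<in> {..<J}" for j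
      proof
        fix z assume z: "z \<in> E j"
        have "real j * (3 * del) \<le> 1"
        proof -
          have "real j \<le> 1 / (3 * del)" using that J(1) by simp
          then show ?thesis using del by (simp add: field_simps)
        qed
        then have "norm ((real j * (3 * del)) *\<^sub>R x2) \<le> norm x2"
          using del by (simp add: mult_left_le_one_le)
        then show "z \<in> cball 0 (K + norm x2)"
          using E_phi(2)[OF z] norm_triangle_sub[of z "(real j * (3 * del)) *\<^sub>R x2"] by simp
      qed
    qed (auto simp: E_def intro!: measurable_translation Tm)
    moreover have "measure lebesgue (E j) = exp (- (tau * t)) * m" for j
      unfolding E_def m_def by (simp add: measure_translation measure_T)
    ultimately have J_le: "real J * (exp (- (tau * t)) * m) \<le> V" by simp
    have "exp (- (tau * t)) \<le> 1" using tau_pos t by simp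
    have "(1 / (3 * del)) * (exp (- (tau * t)) * m) \<le> (real J + 1) * (exp (- (tau * t)) * m)"
      using J(2) m by (intro mult_right_mono) auto
    also have "\<dots> \<le> V + 1 * m"
      using J_le mult_right_mono[OF \<open>exp (- (tau * t)) \<le> 1\<close>, of m] m unfolding distrib_right by linarith
    finally have f1: "exp (- (tau * t)) / del \<le> 3 * (V / m + 1)"
      using m del by (simp add: field_simps)
    have f2: "exp (- (tau * t)) / del = exp ((b - tau) * t) / C1"
      unfolding del_def by (simp add: exp_diff exp_minus left_diff_distrib field_simps)
    show ?thesis using f1[unfolded f2 pos_divide_le_eq[OF C1(1)]] by (simp only: mult_ac)
  qed
  define L where "L = 3 * C1 * (V / m + 1)"
  have "L > 0" using bound[of 0] unfolding L_def by (smt (verit) exp_gt_zero)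
  \<comment> \<open>For this \<open>t\<close> the left side of \<open>bound\<close> is
    \<open>exp (\<bar>ln L\<bar> + 1)\<close>, which exceeds \<open>L\<close>.\<close>
  define t where "t = (\<bar>ln L\<bar> + 1) / (b - tau)"
  have "t \<ge> 0" using bt by (simp add: t_def)
  from bound[OF this] have "exp (\<bar>ln L\<bar> + 1) \<le> L" using bt by (simp add: t_def L_def)
  then have "\<bar>ln L\<bar> + 1 \<le> ln L" using \<open>L > 0\<close> by (simp add: ln_ge_iff)
  then show False by simp
qed

text \<open>
  Length-area argument: chains of steps \<open>w s / k\<close>, of size about \<open>exp (- s)\<close>, against a cover
  by balls of radius \<open>exp (- s)\<close>.  The number \<open>k\<close> of steps is about \<open>norm (T s (w s))\<close>.
\<close>

lemma invariant_dirs_limit: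
  assumes b: "b > 0" "b \<le> tau"
    and w: "(w \<longlongrightarrow> v) at_top" and decay: "((\<lambda>s. norm (T s (w s)) * exp (- (b * s))) \<longlongrightarrow> 0) at_top"
  shows "v \<in> invariant_dirs rho (tau / b)"
  unfolding invariant_dirs_def
proof (intro CollectI ballI allI, rule ccontr)
  fix u x0 assume u: "u \<in> variation_class rho (tau / b)" and ne: "u (x0 + v) \<noteq> u x0"
  define Q where "Q = tau / b"
  have Q: "Q \<ge> 1" "b * Q = tau" using b by (auto simp: Q_def)
  have uc: "continuous_on UNIV u"
    using u rho_continuous_imp_continuous_on by (simp add: variation_class_def)
  \<comment> \<open>A third of the difference: \<open>u\<close> changes by less than
    \<open>c\<close> near each of the two endpoints, so a difference of at least \<open>c\<close>
    survives for all starting points in a small ball and all displacements close to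
    \<open>v\<close>.\<close>
  define c where "c = \<bar>u (x0 + v) - u x0\<bar> / 3"
  have c: "c > 0" using ne by (simp add: c_def)
  obtain d1 where d1: "d1 > 0" "\<And>p. dist p x0 < d1 \<Longrightarrow> \<bar>u p - u x0\<bar> < c"
    using uc c unfolding continuous_on_iff dist_real_def by (metis UNIV_I)
  obtain d2 where d2: "d2 > 0" "\<And>p. dist p (x0 + v) < d2 \<Longrightarrow> \<bar>u p - u (x0 + v)\<bar> < c"
    using uc c unfolding continuous_on_iff dist_real_def by (metis UNIV_I)
  define d where "d = min (min d1 d2) 1 / 3"
  have d: "d > 0" "d < d1" "2 * d < d2" "d < 1" using d1 d2 by (auto simp: d_def)
  have low: "c \<le> \<bar>u (p + w') - u p\<bar>" if "p \<in> cball x0 d" "norm (w' - v) < d" for p w'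
  proof -
    have "\<bar>u p - u x0\<bar> < c" using that(1) d by (intro d1) (auto simp: dist_commute)
    moreover have "dist (p + w') (x0 + v) < d2"
    proof -
      have "dist (p + w') (x0 + v) = norm ((p - x0) + (w' - v))" by (simp add: dist_norm algebra_simps)
      also have "\<dots> \<le> norm (p - x0) + norm (w' - v)" by (rule norm_triangle_ineq)
      also have "\<dots> < d2" using that d by (simp add: dist_norm norm_minus_commute)
      finally show ?thesis .
    qed
    then have "\<bar>u (p + w') - u (x0 + v)\<bar> < c" by (rule d2)
    moreover have "\<bar>u (x0 + v) - u x0\<bar> = 3 * c" by (simp add: c_def)
    ultimately show ?thesis by linarith
  qed
  obtain M where M: "M \<ge> 1" "\<And>x y. rho (x + y) \<le> M * max (rho x) (rho y)"
    using rho_quasi_triangle by blast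
  obtain N where N: "N > 0" "\<And>x. rho x \<le> 1 \<Longrightarrow> norm x \<le> N" using rho_le1_norm_le by blast
  obtain B where B: "B > 0" "\<And>x. norm x \<le> N \<Longrightarrow> rho x \<le> B" using norm_le_rho_le by blast
  obtain e where e: "e > 0" "\<And>x. norm x < e \<Longrightarrow> rho x < 1" using small_norm_rho by blast
  define S where "S = norm v + 3"
  obtain C where C: "C > 0" "\<And>r. 0 < r \<Longrightarrow> r \<le> 1 \<Longrightarrow> (\<exists>I. finite I \<and> I \<subseteq> cball x0 S \<and> separated rho r I \<and>
     real (card I) \<le> C * r powr - tau \<and> (\<forall>x\<in>cball x0 S. \<exists>w\<in>I. rho (x - w) < r))"
    using ball_cover[of x0 S] by blast
  obtain R0 where R0: "R0 > 0" "\<And>x. norm x \<le> S \<Longrightarrow> rho x \<le> R0" using norm_le_rho_le by blast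
  \<comment> \<open>One constant bounds the radii, the position of the centres and the enlargement
    factor. One factor \<open>M\<close> makes up for the radii being divided by \<open>M\<close>,
    the other comes from the quasi-triangle inequality.\<close>
  define R where "R = max (max 1 R0) (M * M * max B 1)"
  have "fin_var rho Q u" using u by (simp add: variation_class_def Q_def)
  from spec[OF spec[OF this[unfolded fin_var_def], of x0], of R]
  obtain V where V: "\<forall>I r y. finite I \<longrightarrow>
     (\<forall>x\<in>I. 0 < r x \<and> r x \<le> R \<and> rho (x - x0) \<le> R \<and> rho (y x - x) \<le> R * r x) \<longrightarrow>
     disj_balls rho I r \<longrightarrow> (\<Sum>x\<in>I. \<bar>u (y x) - u x\<bar> powr Q) \<le> V"
    by (elim exE)
  define mN where "mN = measure lebesgue (cball (0::real^'n::{finite,wellorder}) N)"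
  define mU where "mU = measure lebesgue (cball x0 d)"
  have mU: "mU > 0" unfolding mU_def using content_cball_pos[OF d(1), of x0] by (simp add: measure_completion)
  define A where "A = mN * (2 * (C + V))"
  have main: "c * mU \<le> (norm (T s (w s)) / e + 2) * (A * exp (- (b * s)))"
    if s: "s \<ge> 0" "norm (w s - v) < d" for s
  proof -
    \<comment> \<open>With this many steps the dilated step \<open>T s h\<close> has norm below
      \<open>e\<close>, so \<open>h\<close> has gauge below \<open>r\<close>. Adding 1 after
      rounding down keeps \<open>k\<close> positive even if \<open>w s\<close> is 0.\<close>
    define k where "k = nat \<lfloor>norm (T s (w s)) / e\<rfloor> + 1"
    have k: "norm (T s (w s)) / e < real k" "real k \<le> norm (T s (w s)) / e + 1" "k \<ge> 1"
      using e(1) by (auto simp: k_def) linarith+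
    define h where "h = w s /\<^sub>R real k"
    have kh: "real k *\<^sub>R h = w s" using k by (simp add: h_def)
    define r where "r = exp (- s)"
    have r: "0 < r" "r \<le> 1" "ln r = - s" using s by (auto simp: r_def)
    have "rho (T s h) < 1"
    proof (rule e(2))
      have "norm (T s h) = norm (T s (w s)) / real k" using k(3) by (simp add: h_def divide_inverse mult.commute)
      also have "\<dots> < e" using k e(1) by (simp add: field_simps)
      finally show "norm (T s h) < e" .
    qed
    then have h: "rho h < r" by (simp add: rho_T r_def exp_minus field_simps)
    obtain I where I: "finite I" "I \<subseteq> cball x0 S" "separated rho r I"
       "real (card I) \<le> C * r powr - tau" "\<And>x. x \<in> cball x0 S \<Longrightarrow> \<exists>w\<in>I. rho (x - w) < r"
      using C(2)[OF r(1,2)] by blast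
    define E where "E j = (+) j ` T (- s) ` cball 0 N" for j
    have cont_T: "continuous_on UNIV (T (- s))"
      using T_linear by (simp add: linear_continuous_on linear_conv_bounded_linear[symmetric])
    have E_comp: "compact (E j)" for j
      unfolding E_def by (intro compact_translation compact_continuous_image continuous_on_subset[OF cont_T]) auto
    have E_ne: "E j \<noteq> {}" for j using N by (auto simp: E_def)
    have E_rho: "rho (z - j) \<le> B * r" if "z \<in> E j" for z j
      using that B(2) by (auto simp: E_def rho_T r_def mult.commute)
    have E_meas: "measure lebesgue (E j) = exp (- (tau * s)) * mN" for j
      unfolding E_def mN_def by (simp add: measure_translation measure_T)
    \<comment> \<open>The largest one-step variation on a cell is attained, so it is a difference of
      values of \<open>u\<close> at actual points, as in the sums of \<open>fin_var\<close>.\<close>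
    have "\<exists>y\<in>E j. \<forall>x\<in>E j. \<bar>u (x + h) - u x\<bar> \<le> \<bar>u (y + h) - u y\<bar>" for j
      by (rule continuous_attains_sup[OF E_comp E_ne])
         (intro continuous_intros continuous_on_compose2[OF uc] continuous_on_subset[OF uc], auto)
    then obtain y where y: "\<And>j. y j \<in> E j" "\<And>j x. x \<in> E j \<Longrightarrow> \<bar>u (x + h) - u x\<bar> \<le> \<bar>u (y j + h) - u (y j)\<bar>"
      by metis
    define G where "G j = \<bar>u (y j + h) - u (y j)\<bar>" for j
    have step1: "c * mU \<le> real k * (\<Sum>j\<in>I. measure lebesgue (E j) * G j)"
      unfolding mU_def
    proof (rule translated_measure_bound[OF uc less_imp_le[OF c] _ I(1) E_comp])
      show "c \<le> \<bar>u (p + real k *\<^sub>R h) - u p\<bar>" if "p \<in> cball x0 d" for p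
        unfolding kh using that s(2) by (rule low)
      show "cball x0 (d + real k * norm h) \<subseteq> (\<Union>j\<in>I. E j)"
      proof
        fix x assume x: "x \<in> cball x0 (d + real k * norm h)"
        have "real k * norm h = norm (w s)" using arg_cong[OF kh, of norm] by simp
        also have "\<dots> \<le> norm v + d" using norm_triangle_sub[of "w s" v] s(2) by simp
        finally have "x \<in> cball x0 S" using x d(4) by (simp add: S_def)
        then obtain j where j: "j \<in> I" "rho (x - j) < r" using I(5) by blast
        have "rho (T s (x - j)) \<le> 1" using j(2) by (simp only: rho_T) (simp add: r_def exp_minus field_simps)
        then have "norm (T s (x - j)) \<le> N" by (rule N)
        then have "x \<in> E j" unfolding E_def
          by (intro image_eqI[where x = "T (- s) (T s (x - j))"] image_eqI[where x = "T s (x - j)"]) (simp_all del: T_simps)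
        then show "x \<in> (\<Union>j\<in>I. E j)" using j by blast
      qed
    qed (use y in \<open>auto simp: G_def\<close>)
    \<comment> \<open>By the quasi-triangle inequality, separation by \<open>r\<close> gives
      disjoint balls only for the radius \<open>r / M\<close>.\<close>
    have dj: "disj_balls rho I (\<lambda>_. r / M)"
      unfolding disj_balls_def
    proof (intro ballI impI allI notI, elim conjE)
      fix x x' z assume x: "x \<in> I" "x' \<in> I" "x \<noteq> x'" "rho (z - x) < r / M" "rho (z - x') < r / M"
      have "rho (x - x') \<le> M * max (rho (x - z)) (rho (z - x'))" using M(2)[of "x - z" "z - x'"] by simp
      also have "\<dots> < M * (r / M)" using x M(1) rho_commute[of x z] by (intro mult_strict_left_mono) auto
      finally have "rho (x - x') < r" using M(1) by simp
      then show False using x I(3) unfolding separated_def by force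
    qed
    have var: "(\<Sum>x\<in>I. \<bar>u (y' x) - u x\<bar> powr Q) \<le> V"
      if y': "\<And>x. x \<in> I \<Longrightarrow> rho (y' x - x) \<le> M * max B 1 * r" for y'
    proof (rule V[rule_format, OF I(1) _ dj])
      fix x assume x: "x \<in> I"
      have "r / M \<le> 1" using r M(1) by (simp add: divide_le_eq_1)
      moreover have "rho (x - x0) \<le> R0" using x I(2) by (intro R0) (auto simp: dist_norm norm_minus_commute)
      moreover have "rho (y' x - x) \<le> R * (r / M)"
      proof -
        have "M * max B 1 * r = (M * M * max B 1) * (r / M)" using M(1) by simp
        also have "\<dots> \<le> R * (r / M)" using r M(1) by (intro mult_right_mono) (auto simp: R_def)
        finally show ?thesis using y'[OF x] by linarith
      qed
      moreover have "1 \<le> R" "R0 \<le> R" by (auto simp: R_def)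
      moreover have "0 < r / M" using r M(1) by simp
      ultimately show "0 < r / M \<and> r / M \<le> R \<and> rho (x - x0) \<le> R \<and> rho (y' x - x) \<le> R * (r / M)"
        by linarith
    qed
    have lin_sum: "(\<Sum>x\<in>I. \<bar>u (y' x) - u x\<bar>) \<le> (C + V) * exp (s * (tau - b))"
      if y': "\<And>x. x \<in> I \<Longrightarrow> rho (y' x - x) \<le> M * max B 1 * r" for y'
    proof -
      \<comment> \<open>This value balances the two terms: the number of cells times
        \<open>l\<close>, and \<open>l powr (1 - Q)\<close> times the variation bound, are both of
        order \<open>exp (s * (tau - b))\<close>. The pointwise inequality with threshold
        \<open>l\<close> takes the place of Hoelder's inequality and uses
        \<open>Q \<ge> 1\<close>.\<close>
      define l where "l = exp (- (b * s))"
      have l: "l > 0" by (simp add: l_def)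
      have "(\<Sum>x\<in>I. \<bar>u (y' x) - u x\<bar>) \<le> (\<Sum>x\<in>I. l + l powr (1 - Q) * \<bar>u (y' x) - u x\<bar> powr Q)"
      proof (rule sum_mono)
        fix x assume "x \<in> I"
        define q where "q = \<bar>u (y' x) - u x\<bar>"
        have q0: "q \<ge> 0" by (simp add: q_def)
        have "q \<le> l + l powr (1 - Q) * q powr Q"
        proof (cases "q \<le> l")
          case True
          then show ?thesis by (simp add: add_increasing2)
        next
          case False
          then have "q / l \<ge> 1" using l by simp
          then have "(q / l) powr 1 \<le> (q / l) powr Q" using Q(1) by (intro powr_mono) auto
          then have "q / l \<le> (q / l) powr Q" using l q0 by simp
          also have "\<dots> = q powr Q / l powr Q" using l q0 by (simp add: powr_divide)
          finally have "q \<le> l * (q powr Q / l powr Q)" using l by (simp add: field_simps)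
          also have "\<dots> = l powr (1 - Q) * q powr Q" using l by (simp add: powr_diff)
          finally show ?thesis using l by simp
        qed
        then show "\<bar>u (y' x) - u x\<bar> \<le> l + l powr (1 - Q) * \<bar>u (y' x) - u x\<bar> powr Q" by (simp add: q_def)
      qed
      also have "\<dots> = real (card I) * l + l powr (1 - Q) * (\<Sum>x\<in>I. \<bar>u (y' x) - u x\<bar> powr Q)"
        by (simp add: sum.distrib sum_distrib_left)
      also have "\<dots> \<le> (C * r powr - tau) * l + l powr (1 - Q) * V"
        using I(4) l var[OF y'] by (intro add_mono mult_right_mono mult_left_mono) auto
      also have "r powr - tau * l = exp (s * (tau - b))"
        by (simp add: powr_def r_def l_def algebra_simps flip: exp_add)
      then have "C * r powr - tau * l = C * exp (s * (tau - b))" by (simp add: mult.assoc)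
      also have "l powr (1 - Q) = exp (s * (tau - b))"
        using Q(2) by (simp add: powr_def l_def algebra_simps)
      finally show ?thesis by (simp add: algebra_simps)
    qed
    \<comment> \<open>The difference is split at the value \<open>u j\<close>, since the variation
      sums compare values with the value at the centre of the ball.\<close>
    have "(\<Sum>j\<in>I. G j) \<le> (\<Sum>j\<in>I. \<bar>u (y j + h) - u j\<bar>) + (\<Sum>j\<in>I. \<bar>u (y j) - u j\<bar>)"
      unfolding sum.distrib[symmetric] G_def by (intro sum_mono) linarith
    also have "\<dots> \<le> (C + V) * exp (s * (tau - b)) + (C + V) * exp (s * (tau - b))"
    proof (rule add_mono; rule lin_sum)
      fix j
      have *: "rho (y j - j) \<le> max B 1 * r" using E_rho[OF y(1)[of j]] r
        by (smt (verit) mult_right_mono max.cobounded1)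
      also have "\<dots> \<le> M * (max B 1 * r)"
        using mult_right_mono[OF M(1), of "max B 1 * r"] r by (simp add: zero_le_mult_iff le_max_iff_disj)
      finally show "rho (y j - j) \<le> M * max B 1 * r" by simp
      have "r \<le> max B 1 * r" using r by (simp add: mult_le_cancel_right1)
      then have "max (rho (y j - j)) (rho h) \<le> max B 1 * r" using * h by linarith
      then have "rho ((y j - j) + h) \<le> M * (max B 1 * r)"
        using M(2)[of "y j - j" h] M(1) by (smt (verit) mult_left_mono)
      then show "rho (y j + h - j) \<le> M * max B 1 * r" by (simp add: algebra_simps)
    qed
    finally have G: "(\<Sum>j\<in>I. G j) \<le> 2 * (C + V) * exp (s * (tau - b))" by (simp add: algebra_simps)
    have "(\<Sum>j\<in>I. measure lebesgue (E j) * G j) = exp (- (tau * s)) * mN * (\<Sum>j\<in>I. G j)"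
      by (simp add: E_meas sum_distrib_left)
    also have "\<dots> \<le> exp (- (tau * s)) * mN * (2 * (C + V) * exp (s * (tau - b)))"
      using G by (intro mult_left_mono) (auto simp: mN_def)
    also have "\<dots> = A * (exp (- (tau * s)) * exp (s * (tau - b)))" by (simp add: A_def)
    also have "exp (- (tau * s)) * exp (s * (tau - b)) = exp (- (b * s))"
      by (simp add: algebra_simps flip: exp_add)
    finally have step2: "(\<Sum>j\<in>I. measure lebesgue (E j) * G j) \<le> A * exp (- (b * s))" .
    have "0 \<le> (\<Sum>j\<in>I. measure lebesgue (E j) * G j)" by (intro sum_nonneg) (auto simp: G_def)
    then have "0 \<le> A * exp (- (b * s))" using step2 by linarith
    have "c * mU \<le> real k * (A * exp (- (b * s)))"
      using step1 mult_left_mono[OF step2, of "real k"] by simp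
    also have "\<dots> \<le> (norm (T s (w s)) / e + 2) * (A * exp (- (b * s)))"
      using k(2) \<open>0 \<le> A * exp (- (b * s))\<close> by (intro mult_right_mono) auto
    finally show ?thesis .
  qed
  \<comment> \<open>The first summand tends to 0 by \<open>decay\<close>; the second accounts for
    rounding the number of steps.\<close>
  have "((\<lambda>s. (norm (T s (w s)) * exp (- (b * s))) * (A / e) + 1 * exp (b * (- s)) * (2 * A)) \<longlongrightarrow> 0 * (A / e) + 0) at_top"
    by (intro tendsto_add tendsto_mult decay tendsto_const exp_decay_tendsto b)
  then have "((\<lambda>s. (norm (T s (w s)) / e + 2) * (A * exp (- (b * s)))) \<longlongrightarrow> 0) at_top"
    by (simp add: algebra_simps)
  moreover have "c * mU > 0" using c mU by simp
  ultimately have 1: "eventually (\<lambda>s. (norm (T s (w s)) / e + 2) * (A * exp (- (b * s))) < c * mU) at_top"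
    by (rule order_tendstoD)
  have 2: "eventually (\<lambda>s. norm (w s - v) < d) at_top"
    using tendstoD[OF w d(1)] by (simp add: dist_norm)
  obtain s where "s \<ge> 0" "norm (w s - v) < d" "(norm (T s (w s)) / e + 2) * (A * exp (- (b * s))) < c * mU"
    using eventually_happens[OF eventually_conj[OF eventually_conj[OF 1 2] eventually_ge_at_top[of 0]]] by auto
  then show False using main[of s] by linarith
qed

end

section \<open>The coset argument\<close>

text \<open>Of the variation classes only the invariant subspaces and the preservation of cosets are
  retained. The assumptions are symmetric in \<open>F\<close> and \<open>G\<close>, so every
  estimate also holds for the inverse.\<close>

locale qs_coset_pair = qs_pair +
  fixes H H'
  assumes H: "subspace H" "\<And>t v. v \<in> H \<Longrightarrow> T t v \<in> H" "\<exists>v\<in>H. v \<noteq> 0" "H \<noteq> UNIV"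
    and H': "subspace H'" "\<And>t v. v \<in> H' \<Longrightarrow> T' t v \<in> H'" "\<exists>v\<in>H'. v \<noteq> 0" "H' \<noteq> UNIV"
    and cosets: "y - x \<in> H \<Longrightarrow> F y - F x \<in> H'"
    and cosets': "y' - x' \<in> H' \<Longrightarrow> G y' - G x' \<in> H"
begin

lemma flip_coset: "qs_coset_pair T' X' rho' T X rho G F H' H"
proof -
  interpret f: qs_pair T' X' rho' T X rho G F by (rule flip)
  show ?thesis by unfold_locales (use H H' cosets cosets' in auto)
qed

definition q0 where "q0 = (SOME q. rho q = 1)"
definition pt where "pt r = T (ln r) q0"
text \<open>The quantity \<open>S x r\<close> of the overview, measured along one reference
  displacement \<open>pt r\<close>; quasisymmetry makes any other displacement of gauge
  \<open>r\<close> comparable.\<close>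

definition scale where "scale x r = rho' (F (x + pt r) - F x)"

lemma rho_pt: "r > 0 \<Longrightarrow> rho (pt r) = r"
proof -
  have "rho q0 = 1" unfolding q0_def by (rule someI_ex) (rule dom.rho_surj, simp)
  then show "r > 0 \<Longrightarrow> rho (pt r) = r" by (simp add: pt_def dom.rho_scaled)
qed

lemma scale_pos: "r > 0 \<Longrightarrow> scale x r > 0"
proof -
  assume "r > 0"
  then have "pt r \<noteq> 0" using rho_pt[of r] by force
  then show ?thesis by (simp add: scale_def)
qed

lemma scale_upper:
  obtains K' where "K' > 0"
    "\<And>x y r. r > 0 \<Longrightarrow> rho (y - x) \<le> K * r \<Longrightarrow> rho' (F y - F x) \<le> K' * scale x r"
proof -
  obtain K' where "K' > 0"
    "\<And>x y z. rho (y - x) \<le> K * rho (z - x) \<Longrightarrow> rho' (F y - F x) \<le> K' * rho' (F z - F x)"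
    using weak_qsE[OF qsF] by metis
  then show ?thesis by (intro that[of K']) (auto simp: scale_def rho_pt)
qed

lemma scale_lower:
  obtains K' where "K' > 0"
    "\<And>x y r. r > 0 \<Longrightarrow> r \<le> K * rho (y - x) \<Longrightarrow> scale x r \<le> K' * rho' (F y - F x)"
proof -
  obtain K' where "K' > 0"
    "\<And>x y z. rho (y - x) \<le> K * rho (z - x) \<Longrightarrow> rho' (F y - F x) \<le> K' * rho' (F z - F x)"
    using weak_qsE[OF qsF] by metis
  then show ?thesis by (intro that[of K']) (auto simp: scale_def rho_pt)
qed

text \<open>
  Parallel cosets of \<open>H\<close> and of \<open>H'\<close> have constant distance, so the image of a parallel
  coset at distance \<open>r\<close> determines the scale at all points of a coset simultaneously.
\<close>

lemma scale_uniform: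
  obtains C where "C > 0" "\<And>x h r. h \<in> H \<Longrightarrow> r > 0 \<Longrightarrow> scale (x + h) r \<le> C * scale x r"
proof -
  obtain z where z: "z \<notin> H" using H(4) by blast
  then have "z \<noteq> 0" using subspace_0[OF H(1)] by auto
  define q1 where "q1 = T (- ln (rho z)) z"
  have q1: "rho q1 = 1" unfolding q1_def by (rule dom.unit_rep) fact
  have "q1 \<notin> H"
  proof
    assume "q1 \<in> H"
    then have "T (ln (rho z)) q1 \<in> H" by (rule H(2))
    then show False using z by (simp add: q1_def)
  qed
  \<comment> \<open>Homogeneity reduces the distance between a coset at radius \<open>r\<close> and
    \<open>H\<close> to radius 1, where \<open>q1\<close> has positive distance from the closed set
    \<open>H\<close>.\<close>
  have "closed H" using H(1) by (rule closed_subspace)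
  then obtain e where e: "e > 0" "\<And>h. h \<in> H \<Longrightarrow> e \<le> dist q1 h"
    using separate_point_closed[OF _ \<open>q1 \<notin> H\<close>] by blast
  obtain d where d: "d > 0" "\<And>x. rho x < d \<Longrightarrow> norm x < e" using dom.norm_small[OF e(1)] by blast
  have far1: "d \<le> rho (q1 + h)" if "h \<in> H" for h
  proof (rule ccontr)
    assume "\<not> d \<le> rho (q1 + h)"
    then have "norm (q1 + h) < e" by (intro d(2)) auto
    moreover have "e \<le> dist q1 (- h)" using that subspace_neg[OF H(1)] by (intro e(2)) blast
    ultimately show False by (simp add: dist_norm)
  qed
  define q where "q r = T (ln r) q1" for r
  have q: "rho (q r) = r" if "r > 0" for r using q1 that by (simp add: q_def dom.rho_scaled)
  have far: "d * r \<le> rho (q r + h)" if "h \<in> H" "r > 0" for h r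
  proof -
    have "q r + h = T (ln r) (q1 + T (- ln r) h)" by (simp add: q_def)
    then have "rho (q r + h) = r * rho (q1 + T (- ln r) h)" using that by (simp only: dom.rho_scaled)
    moreover have "d \<le> rho (q1 + T (- ln r) h)" using that H(2) by (intro far1) blast
    ultimately show ?thesis using that by (simp add: mult.commute)
  qed
  obtain K1 where K1: "K1 > 0"
    "\<And>x y r. r > 0 \<Longrightarrow> rho (y - x) \<le> 1 * r \<Longrightarrow> rho' (F y - F x) \<le> K1 * scale x r"
    using scale_upper[of 1] by metis
  obtain K2 where K2: "K2 > 0"
    "\<And>x y r. r > 0 \<Longrightarrow> r \<le> 1 / d * rho (y - x) \<Longrightarrow> scale x r \<le> K2 * rho' (F y - F x)"
    using scale_lower[of "1 / d"] by metis
  have "scale (x + h) r \<le> K2 * K1 * scale x r" if h: "h \<in> H" and r: "r > 0" for x h r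
  proof -
    \<comment> \<open>Moving \<open>F (x + q r)\<close> by a vector of \<open>H'\<close> and pulling
      back gives a point of the coset through \<open>x + q r\<close>, hence at distance at least
      \<open>d * r\<close> from \<open>x + h\<close>. Its image is displaced from
      \<open>F (x + h)\<close> exactly as \<open>F (x + q r)\<close> is from
      \<open>F x\<close>.\<close>
    define z where "z = G (F (x + q r) + (F (x + h) - F x))"
    have "F z - F (x + q r) \<in> H'" using cosets[of "x + h" x] h by (simp add: z_def)
    then have zH: "z - (x + q r) \<in> H" using cosets'[of "F z" "F (x + q r)"] by simp
    have "z - (x + h) = q r + ((z - (x + q r)) - h)" by simp
    then have "d * r \<le> rho (z - (x + h))" using far[OF subspace_diff[OF H(1) zH h] r] by metis
    then have "r \<le> 1 / d * rho (z - (x + h))" using d(1) by (simp add: field_simps)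
    then have "scale (x + h) r \<le> K2 * rho' (F z - F (x + h))" by (rule K2(2)[OF r])
    also have "F z - F (x + h) = F (x + q r) - F x" by (simp add: z_def)
    also have "rho' \<dots> \<le> K1 * scale x r" using q[OF r] by (intro K1(2)[OF r]) simp
    finally show ?thesis using K2(1) by simp
  qed
  then show ?thesis using K1(1) K2(1) by (intro that[of "K2 * K1"]) auto
qed

text \<open>An \<open>r\<close>-separated set within radius \<open>R\<close> in a coset of
  \<open>H\<close> is mapped into a coset of \<open>H'\<close>, within a multiple of
  \<open>scale x R\<close>. Its separation near \<open>F (x + v)\<close> is governed by the scale at
  \<open>x + v\<close>, which \<open>scale_uniform\<close> replaces by the scale at
  \<open>x\<close>; then the two packing bounds are compared.\<close>

lemma growth_le:
  assumes a: "dom.growth_exponent H a" and b: "cod.growth_exponent H' b"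
  shows "\<exists>C>0. \<forall>x r R. 0 < r \<longrightarrow> r \<le> R \<longrightarrow> (R / r) powr a \<le> C * (scale x R / scale x r) powr b"
proof -
  from a obtain c where c: "c > 0" "\<And>r R. 0 < r \<Longrightarrow> r \<le> R \<Longrightarrow> \<exists>I. finite I \<and> I \<subseteq> H \<and> (\<forall>v\<in>I. rho v \<le> R) \<and>
          separated rho r I \<and> c * (R / r) powr a \<le> real (card I)"
    by (rule dom.growth_exponent_lower) (rule that)
  from b obtain C where C: "C > 0" "\<And>r R I. 0 < r \<Longrightarrow> r \<le> R \<Longrightarrow> finite I \<Longrightarrow> I \<subseteq> H' \<Longrightarrow> (\<forall>v\<in>I. rho' v \<le> R) \<Longrightarrow>
          separated rho' r I \<Longrightarrow> real (card I) \<le> C * (R / r) powr b"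
    by (rule cod.growth_exponent_upper) (rule that)
  obtain K1 where K1: "K1 > 0"
    "\<And>x y r. r > 0 \<Longrightarrow> rho (y - x) \<le> 1 * r \<Longrightarrow> rho' (F y - F x) \<le> K1 * scale x r"
    using scale_upper[of 1] by metis
  obtain K2 where K2: "K2 > 0"
    "\<And>x y r. r > 0 \<Longrightarrow> r \<le> 1 * rho (y - x) \<Longrightarrow> scale x r \<le> K2 * rho' (F y - F x)"
    using scale_lower[of 1] by metis
  obtain U where U: "U > 0" "\<And>x h r. h \<in> H \<Longrightarrow> r > 0 \<Longrightarrow> scale (x + h) r \<le> U * scale x r"
    using scale_uniform by metis
  \<comment> \<open>The maximum with 1 keeps the separation \<open>scale x r / W\<close> below the
    outer radius \<open>K1 * scale x R\<close>, as the packing bound requires.\<close>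
  define W where "W = max 1 (U * K2)"
  have W: "W \<ge> 1" "U * K2 \<le> W" by (auto simp: W_def)
  have main: "(R / r) powr a \<le> C * (K1 * W) powr b / c * (scale x R / scale x r) powr b" if r: "0 < r" "r \<le> R" for x r R
  proof -
    obtain I where I: "finite I" "I \<subseteq> H" "\<forall>v\<in>I. rho v \<le> R" "separated rho r I" "c * (R / r) powr a \<le> real (card I)"
      using c(2)[OF r] by blast
    define J where "J = (\<lambda>v. F (x + v) - F x) ` I"
    have "real (card J) \<le> C * ((K1 * scale x R) / (scale x r / W)) powr b"
    proof (rule C(2))
      show "0 < scale x r / W" using scale_pos[OF r(1)] W by simp
      have "scale x r / W \<le> scale x r" using W scale_pos[OF r(1), of x] by (simp add: divide_le_eq mult_le_cancel_left1)
      also have "scale x r \<le> K1 * scale x R"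
        using K1(2)[of R "x + pt r" x] r rho_pt[OF r(1)] by (simp add: scale_def)
      finally show "scale x r / W \<le> K1 * scale x R" .
      show "finite J" using I by (simp add: J_def)
      show "J \<subseteq> H'" using I(2) cosets[of "x + v" x for v] by (auto simp: J_def)
      show "\<forall>v\<in>J. rho' v \<le> K1 * scale x R" using I(3) r K1(2)[of R _ x] by (auto simp: J_def)
      show "separated rho' (scale x r / W) J"
        unfolding separated_def J_def
      proof (intro ballI impI, elim imageE)
        fix v' w' v w assume *: "v' \<noteq> w'" "v' = F (x + v) - F x" "w' = F (x + w) - F x" "v \<in> I" "w \<in> I"
        then have "r \<le> rho (w - v)" using I(4) unfolding separated_def by (metis dom.rho_commute)
        then have k2: "scale (x + v) r \<le> K2 * rho' (F (x + w) - F (x + v))" using r by (intro K2(2)) auto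
        have "scale x r \<le> U * scale (x + v) r"
          using U(2)[of "- v" r "x + v"] I(2) *(4) r subspace_neg[OF H(1)] by auto
        then have "scale x r \<le> U * (K2 * rho' (F (x + w) - F (x + v)))"
          by (rule order_trans[OF _ mult_left_mono[OF k2 less_imp_le[OF U(1)]]])
        also have "\<dots> \<le> W * rho' (F (x + w) - F (x + v))"
          using mult_right_mono[OF W(2), of "rho' (F (x + w) - F (x + v))"] by (simp add: mult.assoc)
        finally have "scale x r / W \<le> rho' (F (x + w) - F (x + v))" using W(1) by (simp add: field_simps)
        then show "scale x r / W \<le> rho' (v' - w')" using * by (simp add: cod.rho_commute)
      qed
    qed
    moreover have "card J = card I" unfolding J_def by (intro card_image) (auto simp: inj_on_def)
    moreover have "((K1 * scale x R) / (scale x r / W)) powr b = (K1 * W) powr b * (scale x R / scale x r) powr b"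
    proof -
      have "(K1 * scale x R) / (scale x r / W) = (K1 * W) * (scale x R / scale x r)" by simp
      then show ?thesis by (simp only: powr_mult[of "K1 * W"])
    qed
    ultimately have "c * (R / r) powr a \<le> C * ((K1 * W) powr b * (scale x R / scale x r) powr b)"
      using I(5) by (simp only:)
    then show ?thesis using c(1) by (simp add: field_simps)
  qed
  have pos: "C * (K1 * W) powr b / c > 0" using C(1) c(1) K1(1) W(1) by simp
  show ?thesis
    by (rule exI[of _ "C * (K1 * W) powr b / c"], rule conjI[OF pos], intro allI impI, rule main)
qed

text \<open>This is \<open>growth_le\<close> for the inverse map, read at the radii
  \<open>scale x r\<close> and \<open>scale x R\<close>. By \<open>near\<close> the inverse takes
  these back to \<open>r\<close> and \<open>R\<close> up to a factor.\<close>

lemma growth_ge: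
  assumes a: "dom.growth_exponent H a" and b: "cod.growth_exponent H' b"
  shows "\<exists>C>0. \<forall>x r R. 0 < r \<longrightarrow> r \<le> R \<longrightarrow> (scale x R / scale x r) powr b \<le> C * (R / r) powr a"
proof -
  interpret f: qs_coset_pair T' X' rho' T X rho G F H' H by (rule flip_coset)
  have a0: "a > 0" "b > 0" using dom.growth_exponent_pos[OF a] cod.growth_exponent_pos[OF b] .
  obtain C where C0: "C > 0" "\<forall>y r R. 0 < r \<longrightarrow> r \<le> R \<longrightarrow> (R / r) powr b \<le> C * (f.scale y R / f.scale y r) powr a"
    using f.growth_le[OF b a] by (elim exE conjE)
  note C = C0(1) C0(2)[rule_format]
  obtain K where K: "K > 0"
    "\<And>x y z. rho' (y - x) \<le> 1 * rho' (z - x) \<Longrightarrow> rho (G y - G x) \<le> K * rho (G z - G x)"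
    using weak_qsE[OF qsG] by metis
  have near: "f.scale (F x) (scale x r) \<le> K * r" "r \<le> K * f.scale (F x) (scale x r)" if "r > 0" for x r
  proof -
    have pt: "rho' (f.pt (scale x r)) = rho' (F (x + pt r) - F x)"
      using f.rho_pt[OF scale_pos[OF that, of x]] by (simp add: scale_def)
    have "rho (G (F x + f.pt (scale x r)) - G (F x)) \<le> K * rho (G (F (x + pt r)) - G (F x))"
      by (rule K(2)) (simp add: pt)
    then show "f.scale (F x) (scale x r) \<le> K * r" using rho_pt[OF that] by (simp add: f.scale_def)
    have "rho (G (F (x + pt r)) - G (F x)) \<le> K * rho (G (F x + f.pt (scale x r)) - G (F x))"
      by (rule K(2)) (simp add: pt)
    then show "r \<le> K * f.scale (F x) (scale x r)" using rho_pt[OF that] by (simp add: f.scale_def)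
  qed
  \<comment> \<open>\<open>scale x\<close> is monotone only up to a constant. If it decreases from
    \<open>r\<close> to \<open>R\<close>, the ratio on the left is at most 1 and the bound is
    immediate.\<close>
  have main: "(scale x R / scale x r) powr b \<le> max 1 (C * (K * K) powr a) * (R / r) powr a" if r: "0 < r" "r \<le> R" for x r R
  proof (cases "scale x r \<le> scale x R")
    case True
    have R: "R > 0" using r by simp
    have "(scale x R / scale x r) powr b \<le> C * (f.scale (F x) (scale x R) / f.scale (F x) (scale x r)) powr a"
      by (rule C(2)[OF scale_pos[OF r(1)] True])
    also have "\<dots> \<le> C * ((K * R) / (r / K)) powr a"
    proof (intro mult_left_mono powr_mono2 frac_le)
      show "f.scale (F x) (scale x R) \<le> K * R" by (rule near[OF R])
      show "r / K \<le> f.scale (F x) (scale x r)" using near(2)[OF r(1), of x] K(1) by (simp add: field_simps)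
    qed (use a0(1) K(1) r(1) R C(1) f.scale_pos[OF scale_pos[OF R, of x], of "F x"]
        f.scale_pos[OF scale_pos[OF r(1), of x], of "F x"] in \<open>simp_all add: less_imp_le\<close>)
    also have "(K * R) / (r / K) = (K * K) * (R / r)" by simp
    also have "C * ((K * K) * (R / r)) powr a = C * (K * K) powr a * (R / r) powr a"
      by (simp only: powr_mult[of "K * K" "R / r"] mult.assoc[of C])
    also have "\<dots> \<le> max 1 (C * (K * K) powr a) * (R / r) powr a" by (intro mult_right_mono) auto
    finally show ?thesis .
  next
    case False
    then have "scale x R / scale x r \<le> 1" using scale_pos[OF r(1), of x] by simp
    then have "(scale x R / scale x r) powr b \<le> 1 powr b"
      using a0 scale_pos[of r x] scale_pos[of R x] r by (intro powr_mono2) auto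
    moreover have "1 powr a \<le> (R / r) powr a" using a0 r by (intro powr_mono2) auto
    moreover have "1 * (R / r) powr a \<le> max 1 (C * (K * K) powr a) * (R / r) powr a" by (intro mult_right_mono) auto
    ultimately show ?thesis by simp
  qed
  have "max 1 (C * (K * K) powr a) > 0" by simp
  show ?thesis
    by (rule exI[of _ "max 1 (C * (K * K) powr a)"], rule conjI[OF \<open>max 1 (C * (K * K) powr a) > 0\<close>],
        intro allI impI, rule main)
qed

text \<open>The exponent is the ratio \<open>a / b\<close> of the growth exponents of
  \<open>H\<close> and \<open>H'\<close>. For \<open>r \<le> R\<close> the bound is
  \<open>growth_ge\<close>; for \<open>R < r\<close> it is \<open>growth_le\<close> with the radii
  exchanged.\<close>

lemma scale_power:
  "\<exists>al>0. \<exists>C>0. \<forall>x r R. 0 < r \<longrightarrow> 0 < R \<longrightarrow> scale x R \<le> C * (R / r) powr al * scale x r"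
proof -
  obtain a where a: "dom.growth_exponent H a" using dom.volume_exponent[OF H(1,2)] H(3) by blast
  obtain b where b: "cod.growth_exponent H' b" using cod.volume_exponent[OF H'(1,2)] H'(3) by blast
  have a0: "a > 0" "b > 0" using dom.growth_exponent_pos[OF a] cod.growth_exponent_pos[OF b] .
  obtain C1 where C10: "C1 > 0" "\<forall>x r R. 0 < r \<longrightarrow> r \<le> R \<longrightarrow> (R / r) powr a \<le> C1 * (scale x R / scale x r) powr b"
    using growth_le[OF a b] by (elim exE conjE)
  note C1 = C10(1) C10(2)[rule_format]
  obtain C2 where C20: "C2 > 0" "\<forall>x r R. 0 < r \<longrightarrow> r \<le> R \<longrightarrow> (scale x R / scale x r) powr b \<le> C2 * (R / r) powr a"
    using growth_ge[OF a b] by (elim exE conjE)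
  note C2 = C20(1) C20(2)[rule_format]
  define C where "C = max C1 C2 powr (1 / b)"
  have recip: "s \<le> c * p" if "1 / p \<le> c / s" "p > 0" "s > 0" for p c s :: real
    using that by (simp add: field_simps)
  have root: "u \<le> C * v powr (a / b)" if "u powr b \<le> max C1 C2 * v powr a" "u > 0" "v > 0" for u v
  proof -
    have "u = (u powr b) powr (1 / b)" using that a0 by (simp add: powr_powr)
    also have "\<dots> \<le> (max C1 C2 * v powr a) powr (1 / b)" using that a0 by (intro powr_mono2) auto
    also have "\<dots> = C * v powr (a / b)" using that C1(1) by (simp add: C_def powr_mult powr_powr)
    finally show ?thesis .
  qed
  have main: "scale x R \<le> C * (R / r) powr (a / b) * scale x r" if r: "0 < r" "0 < R" for x r R
  proof -
    have pos: "scale x r > 0" "scale x R > 0" using r scale_pos by auto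
    have "(scale x R / scale x r) powr b \<le> max C1 C2 * (R / r) powr a"
    proof (cases "r \<le> R")
      case True
      then have "(scale x R / scale x r) powr b \<le> C2 * (R / r) powr a" by (rule C2(2)[OF r(1)])
      also have "\<dots> \<le> max C1 C2 * (R / r) powr a" by (intro mult_right_mono) auto
      finally show ?thesis .
    next
      case False
      then have *: "(r / R) powr a \<le> C1 * (scale x r / scale x R) powr b" using C1(2)[OF r(2), of r x] by simp
      have "(r / R) powr a = 1 / (R / r) powr a" using r by (simp add: powr_divide)
      moreover have "(scale x r / scale x R) powr b = 1 / (scale x R / scale x r) powr b"
        using pos by (simp add: powr_divide)
      ultimately have "1 / (R / r) powr a \<le> C1 / (scale x R / scale x r) powr b" using * by simp
      then have "(scale x R / scale x r) powr b \<le> C1 * (R / r) powr a"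
        using recip[of "(R / r) powr a" C1 "(scale x R / scale x r) powr b"] pos r by simp
      also have "\<dots> \<le> max C1 C2 * (R / r) powr a" by (intro mult_right_mono) auto
      finally show ?thesis .
    qed
    then have "scale x R / scale x r \<le> C * (R / r) powr (a / b)" using pos r by (intro root) simp_all
    then show ?thesis using pos by (simp add: field_simps)
  qed
  have "max C1 C2 > 0" using C1(1) by (simp add: less_max_iff_disj)
  then have "C > 0" by (simp add: C_def)
  have "a / b > 0" using a0 by simp
  show ?thesis
    by (rule exI[of _ "a / b"], rule conjI[OF \<open>a / b > 0\<close>], rule exI[of _ C], rule conjI[OF \<open>C > 0\<close>],
        intro allI impI, rule main)
qed

text \<open>At radius \<open>rho (y - x)\<close> the scales at \<open>x\<close> and \<open>y\<close>
  are comparable, since both measure the distance from \<open>F x\<close> to \<open>F y\<close>. The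
  power law carries this to all radii, so that the single number \<open>m\<close> serves for all
  points.\<close>

lemma biLipschitz_power:
  "\<exists>al>0. \<exists>L>0. \<forall>x y. rho' (F y - F x) \<le> L * rho (y - x) powr al \<and> rho (y - x) powr al \<le> L * rho' (F y - F x)"
proof -
  obtain al C where al: "al > 0" "C > 0" "\<forall>x r R. 0 < r \<longrightarrow> 0 < R \<longrightarrow> scale x R \<le> C * (R / r) powr al * scale x r"
    using scale_power by (elim exE conjE)
  note C = al(1,2) al(3)[rule_format]
  obtain K1 where K1: "K1 > 0"
    "\<And>x y r. r > 0 \<Longrightarrow> rho (y - x) \<le> 1 * r \<Longrightarrow> rho' (F y - F x) \<le> K1 * scale x r"
    using scale_upper[of 1] by metis
  obtain K2 where K2: "K2 > 0"
    "\<And>x y r. r > 0 \<Longrightarrow> r \<le> 1 * rho (y - x) \<Longrightarrow> scale x r \<le> K2 * rho' (F y - F x)"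
    using scale_lower[of 1] by metis
  have comp: "scale x (rho (y - x)) \<le> K2 * K1 * scale y (rho (y - x))" if "x \<noteq> y" for x y
  proof -
    have r: "rho (y - x) > 0" using that by simp
    have "scale x (rho (y - x)) \<le> K2 * rho' (F y - F x)" by (rule K2(2)[OF r]) simp
    also have "rho' (F y - F x) \<le> K1 * scale y (rho (y - x))"
      using K1(2)[OF r, of x y] by (simp add: cod.rho_commute dom.rho_commute)
    finally show ?thesis using K2(1) by (simp add: mult_left_mono)
  qed
  define m where "m = scale 0 1"
  have m: "m > 0" by (simp add: m_def scale_pos)
  define U where "U = max 1 (K2 * K1)"
  have U: "U \<ge> 1" "K2 * K1 \<le> U" by (auto simp: U_def)
  have comp': "scale x r \<le> C * C * U * (r / s) powr al * scale y s" if "r > 0" "s > 0" for x y r s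
  proof (cases "x = y")
    case True
    have "1 \<le> C" using C(3)[of 1 1 x] scale_pos[of 1 x] by simp
    then have "1 * 1 \<le> C * U" using U(1) by (intro mult_mono) auto
    then have "C * 1 \<le> C * (C * U)" using C(2) by (intro mult_left_mono) auto
    then have "C * ((r / s) powr al * scale y s) \<le> C * C * U * ((r / s) powr al * scale y s)"
      using scale_pos[OF that(2), of y] by (intro mult_right_mono) auto
    then show ?thesis using C(3)[OF that(2,1), of x] True by (simp add: mult.assoc)
  next
    case False
    \<comment> \<open>The comparison passes through the common radius \<open>q\<close>: from
      \<open>r\<close> to \<open>q\<close> at \<open>x\<close>, across to \<open>y\<close>, and from
      \<open>q\<close> to \<open>s\<close>. The powers of \<open>q\<close> cancel.\<close>
    define q where "q = rho (y - x)"
    have q: "q > 0" using False by (simp add: q_def)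
    have "scale x r \<le> C * (r / q) powr al * scale x q" using C(3) that q by blast
    also have "\<dots> \<le> C * (r / q) powr al * (U * scale y q)"
    proof (intro mult_left_mono)
      have "scale x q \<le> K2 * K1 * scale y q" unfolding q_def using comp[OF False] .
      also have "\<dots> \<le> U * scale y q" using U scale_pos[OF q, of y] by (intro mult_right_mono) auto
      finally show "scale x q \<le> U * scale y q" .
    qed (use C in auto)
    also have "\<dots> \<le> C * (r / q) powr al * (U * (C * (q / s) powr al * scale y s))"
      using C U that q by (intro mult_left_mono C(3)) auto
    also have "\<dots> = C * C * U * ((r / q) powr al * (q / s) powr al) * scale y s" by simp
    also have "(r / q) powr al * (q / s) powr al = (r / s) powr al"
      using that q by (simp flip: powr_mult)
    finally show ?thesis .
  qed
  define D where "D = C * C * U"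
  have D: "D > 0" using C(2) U(1) by (simp add: D_def)
  define L where "L = max (K1 * D * m) (D * K2 / m)"
  have L: "L > 0" using K1(1) D m by (auto simp: L_def less_max_iff_disj)
  have "rho' (F y - F x) \<le> L * rho (y - x) powr al \<and> rho (y - x) powr al \<le> L * rho' (F y - F x)" for x y
  proof (cases "x = y")
    case False
    define R where "R = rho (y - x)"
    have R: "R > 0" using False by (simp add: R_def)
    have "rho' (F y - F x) \<le> K1 * scale x R" using R by (intro K1(2)) (auto simp: R_def)
    also have "\<dots> \<le> K1 * (D * (R / 1) powr al * m)"
      unfolding m_def D_def using K1(1) R by (intro mult_left_mono comp') auto
    also have "\<dots> = (K1 * D * m) * R powr al" by simp
    also have "\<dots> \<le> L * R powr al" by (intro mult_right_mono) (auto simp: L_def)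
    finally have 1: "rho' (F y - F x) \<le> L * R powr al" .
    have "m \<le> D * (1 / R) powr al * scale x R" unfolding m_def D_def using R by (intro comp') auto
    also have "\<dots> \<le> D * (1 / R) powr al * (K2 * rho' (F y - F x))"
      using D R by (intro mult_left_mono K2(2)) (auto simp: R_def)
    finally have "R powr al \<le> (D * K2 / m) * rho' (F y - F x)"
      using m R by (simp add: powr_divide field_simps)
    also have "\<dots> \<le> L * rho' (F y - F x)" by (intro mult_right_mono) (auto simp: L_def)
    finally show ?thesis using 1 by (simp add: R_def)
  qed simp
  then show ?thesis using C(1) L by blast
qed

end

section \<open>Determination of the exponent\<close>

context qs_pair begin

text \<open>
  Subdividing a segment along a slowest direction \<open>v\<close> of \<open>T\<close> bounds the Hoelder exponent of \<open>F\<close>.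
\<close>

lemma exponent_le:
  assumes hold: "\<And>x y. rho' (F y - F x) \<le> L * rho (y - x) powr al" and al: "al > 0"
    and v: "v \<noteq> 0" "\<And>s. s \<ge> 0 \<Longrightarrow> norm (T s v) \<le> C * exp (lam * s)" and lam: "lam > 0"
    and b: "b > 0" "\<And>t y. t \<le> 0 \<Longrightarrow> norm (T' t y) \<le> C' * exp (b * t) * norm y"
  shows "al * b \<le> lam"
proof (rule ccontr)
  assume "\<not> al * b \<le> lam"
  then have gap: "al * b - lam > 0" by simp
  obtain e where e: "e > 0" "\<And>x. norm x < e \<Longrightarrow> rho x < 1" using dom.small_norm_rho by blast
  obtain N where N: "N > 0" "\<And>x. rho' x \<le> 1 \<Longrightarrow> norm x \<le> N" using cod.rho_le1_norm_le by blast
  define L1 where "L1 = max L 1"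
  define C1 where "C1 = max C 1"
  define C2 where "C2 = max C' 1"
  have pos: "L1 > 0" "C1 > 0" "C2 > 0" by (auto simp: L1_def C1_def C2_def)
  define A where "A = (2 * C1 / e) * (C2 * N * exp (b * ln L1))"
  have bound: "norm (F v - F 0) \<le> A * exp ((al * b - lam) * (- (ln (real k * (e / (2 * C1))) / lam))) * 1"
    if k: "real k * (e / (2 * C1)) \<ge> 1" "ln (real k * (e / (2 * C1))) / lam \<ge> ln L1 / al" for k :: nat
  proof -
    \<comment> \<open>The time \<open>s\<close> is tied to the number \<open>k\<close> of pieces so
      that \<open>T s\<close> stretches one piece \<open>h\<close> to norm at most
      \<open>e / 2\<close>; then \<open>rho h < exp (- s)\<close>.\<close>
    define s where "s = ln (real k * (e / (2 * C1))) / lam"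
    have s: "s \<ge> 0" unfolding s_def using k(1) lam by (intro divide_nonneg_pos) auto
    have k0: "k > 0" using k(1) by (cases k) auto
    have es: "exp (lam * s) = real k * (e / (2 * C1))"
      using k(1) lam by (simp add: s_def)
    define h where "h = v /\<^sub>R real k"
    have kh: "real k *\<^sub>R h = v" using k0 by (simp add: h_def)
    have "norm (T s h) = norm (T s v) / real k" using k0 by (simp add: h_def divide_inverse mult.commute)
    also have "\<dots> \<le> C1 * exp (lam * s) / real k"
      by (intro divide_right_mono order_trans[OF v(2)[OF s]]) (auto simp: C1_def)
    also have "\<dots> = e / 2" using k0 pos by (simp add: es field_simps)
    also have "\<dots> < e" using e(1) by simp
    finally have "rho (T s h) < 1" by (rule e(2))
    then have rh: "rho h < exp (- s)" by (simp add: dom.rho_T exp_minus field_simps)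
    have step: "norm (F (x + h) - F x) \<le> C2 * N * exp (b * ln L1) * exp (- (al * b * s))" for x
    proof -
      \<comment> \<open>\<open>exp t\<close> bounds the gauge of one image step. The contraction
        estimate on the target holds for \<open>t \<le> 0\<close>, and this is what the second
        condition on \<open>k\<close> ensures.\<close>
      define t where "t = ln L1 - al * s"
      have t: "t \<le> 0" using k(2) al unfolding t_def s_def[symmetric] by (simp add: pos_divide_le_eq mult.commute)
      define y where "y = F (x + h) - F x"
      have "rho' y \<le> L * rho h powr al" using hold[of "x + h" x] by (simp add: y_def)
      also have "\<dots> \<le> L1 * exp (- s) powr al"
        using rh al by (intro mult_mono powr_mono2) (auto simp: L1_def)
      also have "\<dots> = exp t"
        using pos by (simp add: t_def powr_def diff_conv_add_uminus exp_add del: add_uminus_conv_diff)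
      finally have "rho' (T' (- t) y) \<le> 1" by (simp add: cod.rho_T exp_minus field_simps)
      then have "norm (T' (- t) y) \<le> N" by (rule N)
      have "norm y = norm (T' t (T' (- t) y))" by simp
      also have "\<dots> \<le> C' * exp (b * t) * norm (T' (- t) y)" using t by (rule b(2))
      also have "\<dots> \<le> C2 * exp (b * t) * N"
        using \<open>norm (T' (- t) y) \<le> N\<close> by (intro mult_mono) (auto simp: C2_def)
      also have "\<dots> = C2 * N * (exp (b * ln L1) * exp (- (al * b * s)))"
        by (simp add: t_def algebra_simps flip: exp_add)
      finally show ?thesis by (simp add: y_def mult.assoc)
    qed
    have "F v - F 0 = (\<Sum>i<k. F (real (Suc i) *\<^sub>R h) - F (real i *\<^sub>R h))"
      by (subst sum_lessThan_telescope) (simp add: kh)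
    then have "norm (F v - F 0) \<le> (\<Sum>i<k. norm (F (real (Suc i) *\<^sub>R h) - F (real i *\<^sub>R h)))"
      by (simp only: norm_sum)
    also have "\<dots> \<le> (\<Sum>i<k. C2 * N * exp (b * ln L1) * exp (- (al * b * s)))"
    proof (rule sum_mono)
      fix i
      have "real (Suc i) *\<^sub>R h = real i *\<^sub>R h + h" by (simp add: algebra_simps)
      then show "norm (F (real (Suc i) *\<^sub>R h) - F (real i *\<^sub>R h)) \<le> C2 * N * exp (b * ln L1) * exp (- (al * b * s))"
        using step by metis
    qed
    also have "\<dots> = real k * (C2 * N * exp (b * ln L1) * exp (- (al * b * s)))" by simp
    also have "real k = (2 * C1 / e) * exp (lam * s)" using e(1) pos by (simp add: es)
    also have "(2 * C1 / e) * exp (lam * s) * (C2 * N * exp (b * ln L1) * exp (- (al * b * s)))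
       = A * (exp (lam * s) * exp (- (al * b * s)))" by (simp add: A_def)
    also have "exp (lam * s) * exp (- (al * b * s)) = exp ((al * b - lam) * (- s))"
      by (simp add: algebra_simps flip: exp_add)
    finally show ?thesis by (simp add: s_def)
  qed
  have "filterlim (\<lambda>k. real k * (e / (2 * C1))) at_top sequentially"
    using e(1) pos by (intro filterlim_at_top_mult_tendsto_pos[OF tendsto_const] filterlim_real_sequentially) auto
  then have kinf: "filterlim (\<lambda>k. ln (real k * (e / (2 * C1)))) at_top sequentially"
    by (rule filterlim_compose[OF ln_at_top])
  then have sinf: "filterlim (\<lambda>k. ln (real k * (e / (2 * C1))) / lam) at_top sequentially"
    unfolding divide_inverse using lam
    by (intro filterlim_at_top_mult_tendsto_pos[OF tendsto_const]) auto
  have "((\<lambda>k. A * exp ((al * b - lam) * (- (ln (real k * (e / (2 * C1))) / lam))) * 1) \<longlongrightarrow> 0) sequentially"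
    by (rule filterlim_compose[OF exp_decay_tendsto[OF gap] sinf])
  moreover have "norm (F v - F 0) > 0" using v(1) by simp
  ultimately have 1: "eventually (\<lambda>k. A * exp ((al * b - lam) * (- (ln (real k * (e / (2 * C1))) / lam))) * 1 < norm (F v - F 0)) sequentially"
    by (rule order_tendstoD)
  have 2: "eventually (\<lambda>k. real k * (e / (2 * C1)) \<ge> 1) sequentially"
    using \<open>filterlim (\<lambda>k. real k * (e / (2 * C1))) at_top sequentially\<close> unfolding filterlim_at_top by blast
  have 3: "eventually (\<lambda>k. ln (real k * (e / (2 * C1))) / lam \<ge> ln L1 / al) sequentially"
    using sinf unfolding filterlim_at_top by blast
  obtain k where "A * exp ((al * b - lam) * (- (ln (real k * (e / (2 * C1))) / lam))) * 1 < norm (F v - F 0)"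
    "real k * (e / (2 * C1)) \<ge> 1" "ln (real k * (e / (2 * C1))) / lam \<ge> ln L1 / al"
    using eventually_happens[OF eventually_conj[OF 1 eventually_conj[OF 2 3]]] by auto
  then show False using bound[of k] by linarith
qed

text \<open>\<open>phi\<close> shows that \<open>H\<close> is not the whole space and the family
  \<open>w\<close> that it is nonzero; both belong to the same rate \<open>b\<close>, which fixes
  \<open>Q\<close>. The vectors \<open>v\<close>, \<open>v'\<close> and the contraction rates serve
  only to identify the exponent.\<close>

theorem biLipschitz_of_split:
  assumes phi: "linear phi" "phi x1 \<noteq> 0" "\<And>t x. \<bar>phi (T t x)\<bar> \<le> Cphi * exp (b * t) * norm x" and b: "b > 0"
    and w: "(w \<longlongrightarrow> w0) at_top" "w0 \<noteq> 0"
      "((\<lambda>s. norm (T s (w s)) * exp (- (b * s))) \<longlongrightarrow> 0) at_top"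
    and v: "v \<noteq> 0" "\<And>s. s \<ge> 0 \<Longrightarrow> norm (T s v) \<le> C * exp (lam * s)" and lam: "lam > 0"
    and v': "v' \<noteq> 0" "\<And>s. s \<ge> 0 \<Longrightarrow> norm (T' s v') \<le> C' * exp (mu * s)" and mu: "mu > 0"
    and low: "\<And>b. 0 < b \<Longrightarrow> b < lam \<Longrightarrow> \<exists>C. \<forall>t\<le>0. \<forall>y. norm (T t y) \<le> C * exp (b * t) * norm y"
    and low': "\<And>b. 0 < b \<Longrightarrow> b < mu \<Longrightarrow> \<exists>C. \<forall>t\<le>0. \<forall>y. norm (T' t y) \<le> C * exp (b * t) * norm y"
  shows "\<exists>L\<ge>1. \<forall>x y. (1 / L) * rho (y - x) powr (lam / mu) \<le> rho' (F y - F x) \<and>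
           rho' (F y - F x) \<le> L * rho (y - x) powr (lam / mu)"
proof -
  interpret f: qs_pair T' X' rho' T X rho G F by (rule flip)
  define Q where "Q = dom.tau / b"
  define H where "H = invariant_dirs rho Q"
  define H' where "H' = invariant_dirs rho' Q"
  have w0: "w0 \<in> H" unfolding H_def Q_def
    by (rule dom.invariant_dirs_limit[OF b dom.tau_ge[OF phi] w(1,3)])
  have x1: "x1 \<notin> H"
  proof
    assume "x1 \<in> H"
    from dom.invariant_dirsD[OF this[unfolded H_def Q_def] dom.variation_class_linear[OF phi(1,3) b], of 0]
    show False using phi(1,2) by (simp add: linear_0)
  qed
  interpret c: qs_coset_pair T X rho T' X' rho' F G H H'
  proof unfold_locales
    show "subspace H" "subspace H'" unfolding H_def H'_def
      by (rule dom.subspace_invariant_dirs cod.subspace_invariant_dirs)+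
    show "T t v \<in> H" if "v \<in> H" for t v using that unfolding H_def by (rule dom.invariant_dirs_T)
    show "T' t v \<in> H'" if "v \<in> H'" for t v using that unfolding H'_def by (rule cod.invariant_dirs_T)
    show co: "F y - F x \<in> H'" if "y - x \<in> H" for x y using that unfolding H_def H'_def by (rule F_cosets)
    show co': "G y - G x \<in> H" if "y - x \<in> H'" for x y using that unfolding H_def H'_def by (rule f.F_cosets)
    show "\<exists>v\<in>H. v \<noteq> 0" using w0 w(2) by blast
    have "F w0 - F 0 \<in> H'" using co[of w0 0] w0 by simp
    moreover have "F w0 - F 0 \<noteq> 0" using w(2) by simp
    ultimately show "\<exists>v\<in>H'. v \<noteq> 0" by blast
    show "H \<noteq> UNIV" using x1 by blast
    have "F x1 - F 0 \<notin> H'" using co'[of "F x1" "F 0"] x1 by auto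
    then show "H' \<noteq> UNIV" by blast
  qed
  obtain al L where al: "al > 0" "L > 0"
    "\<And>x y. rho' (F y - F x) \<le> L * rho (y - x) powr al" "\<And>x y. rho (y - x) powr al \<le> L * rho' (F y - F x)"
    using c.biLipschitz_power by blast
  \<comment> \<open>Polynomial factors may spoil contraction at the exact rate \<open>mu\<close>, so
    \<open>exponent_le\<close> is applied at a slightly smaller rate \<open>be\<close>. The reverse
    inequality is the same argument for \<open>G\<close>, whose Hoelder exponent is
    \<open>1 / al\<close>.\<close>
  have "al * mu \<le> lam"
  proof (rule ccontr)
    assume *: "\<not> al * mu \<le> lam"
    then have "lam / al < mu" using al(1) by (simp add: field_simps)
    then obtain be where be: "lam / al < be" "be < mu" using dense by blast
    have "be > 0" using be(1) lam al(1) by (smt (verit) divide_pos_pos)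
    obtain D where D: "\<And>t y. t \<le> 0 \<Longrightarrow> norm (T' t y) \<le> D * exp (be * t) * norm y"
      using low'[OF \<open>be > 0\<close> be(2)] by blast
    have "al * be \<le> lam" by (rule exponent_le[OF al(3,1) v lam \<open>be > 0\<close> D])
    then show False using be(1) al(1) by (simp add: field_simps)
  qed
  moreover have "(1 / al) * lam \<le> mu"
  proof (rule ccontr)
    assume *: "\<not> (1 / al) * lam \<le> mu"
    then have "mu * al < lam" using al(1) by (simp add: field_simps)
    then obtain be where be: "mu * al < be" "be < lam" using dense by blast
    have "be > 0" using be(1) mu al(1) by (smt (verit) mult_pos_pos)
    obtain D where D: "\<And>t y. t \<le> 0 \<Longrightarrow> norm (T t y) \<le> D * exp (be * t) * norm y"
      using low[OF \<open>be > 0\<close> be(2)] by blast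
    have inv: "rho (G y - G x) \<le> L powr (1 / al) * rho' (y - x) powr (1 / al)" for x y
    proof -
      have "rho (G y - G x) = (rho (G y - G x) powr al) powr (1 / al)" using al(1) by (simp add: powr_powr)
      also have "\<dots> \<le> (L * rho' (F (G y) - F (G x))) powr (1 / al)"
        by (rule powr_mono2[OF _ _ al(4)]) (use al(1) in auto)
      also have "\<dots> = L powr (1 / al) * rho' (y - x) powr (1 / al)" using al by (simp add: powr_mult)
      finally show ?thesis .
    qed
    have "(1 / al) * be \<le> mu" by (rule f.exponent_le[OF inv _ v' mu \<open>be > 0\<close> D]) (use al in auto)
    then show False using be(1) al(1) by (simp add: field_simps)
  qed
  ultimately have "al = lam / mu" using al(1) mu by (simp add: field_simps)
  have "(1 / max L 1) * rho (y - x) powr (lam / mu) \<le> rho' (F y - F x) \<and>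
           rho' (F y - F x) \<le> max L 1 * rho (y - x) powr (lam / mu)" for x y
  proof
    have "rho (y - x) powr al \<le> max L 1 * rho' (F y - F x)"
      by (rule order_trans[OF al(4)]) (auto intro!: mult_right_mono)
    then show "(1 / max L 1) * rho (y - x) powr (lam / mu) \<le> rho' (F y - F x)"
      unfolding \<open>al = lam / mu\<close>[symmetric] by (simp add: divide_le_eq mult.commute)
    have "rho' (F y - F x) \<le> max L 1 * rho (y - x) powr al"
      by (rule order_trans[OF al(3)]) (auto intro!: mult_right_mono)
    then show "rho' (F y - F x) \<le> max L 1 * rho (y - x) powr (lam / mu)"
      unfolding \<open>al = lam / mu\<close>[symmetric] .
  qed
  then show ?thesis by (intro exI[of _ "max L 1"]) auto
qed

end

section \<open>The flow of a matrix\<close>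

definition matpow :: "real^'n^'n \<Rightarrow> nat \<Rightarrow> real^'n^'n" where
  "matpow A k = ((**) A ^^ k) (Finite_Cartesian_Product.mat 1)"

lemma matpow_0 [simp]: "matpow A 0 = Finite_Cartesian_Product.mat 1"
  by (simp add: matpow_def)

lemma matpow_Suc: "matpow A (Suc k) = A ** matpow A k"
  by (simp add: matpow_def)

lemma matpow_Suc': "matpow A (Suc k) = matpow A k ** A"
proof (induction k)
  case (Suc k)
  have "matpow A (Suc (Suc k)) = A ** (matpow A k ** A)" by (simp only: matpow_Suc[of A "Suc k"] Suc.IH)
  also have "\<dots> = matpow A (Suc k) ** A" by (simp only: matrix_mul_assoc matpow_Suc[of A k])
  finally show ?case .
qed (simp add: matpow_Suc)

lemma matpow_scaleR: "matpow (t *\<^sub>R A) k = t ^ k *\<^sub>R matpow A k"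
proof (induction k)
  case (Suc k)
  then show ?case
    by (simp add: matpow_Suc matrix_matrix_mult_def Finite_Cartesian_Product.vec_eq_iff sum_distrib_left mult_ac)
qed simp

lemma matpow_bound: "\<bar>matpow A k $ i $ j\<bar> \<le> (\<Sum>i\<in>UNIV. \<Sum>j\<in>UNIV. \<bar>A $ i $ j\<bar>) ^ k"
proof (induction k arbitrary: i j)
  case 0
  then show ?case by (simp add: Finite_Cartesian_Product.mat_def)
next
  case (Suc k)
  let ?B = "\<Sum>i\<in>UNIV. \<Sum>j\<in>UNIV. \<bar>A $ i $ j\<bar>"
  have B: "?B \<ge> 0" by (intro sum_nonneg) auto
  have "\<bar>matpow A (Suc k) $ i $ j\<bar> \<le> (\<Sum>l\<in>UNIV. \<bar>A $ i $ l\<bar> * \<bar>matpow A k $ l $ j\<bar>)"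
    unfolding matpow_Suc matrix_matrix_mult_def by (simp add: abs_mult[symmetric] sum_abs)
  also have "\<dots> \<le> (\<Sum>l\<in>UNIV. \<bar>A $ i $ l\<bar> * ?B ^ k)"
    by (intro sum_mono mult_left_mono Suc.IH) auto
  also have "\<dots> = (\<Sum>l\<in>UNIV. \<bar>A $ i $ l\<bar>) * ?B ^ k" by (simp add: sum_distrib_right)
  also have "(\<Sum>l\<in>UNIV. \<bar>A $ i $ l\<bar>) \<le> ?B"
    by (rule member_le_sum[of i UNIV "\<lambda>i. \<Sum>j\<in>UNIV. \<bar>A $ i $ j\<bar>"]) (auto intro: sum_nonneg)
  finally show ?case using B by (simp add: mult_right_mono)
qed

text \<open>An entry of the matrix exponential as a scalar power series in \<open>t\<close>, so that
  termwise differentiation of real series applies.\<close>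

definition exp_entry :: "real^'n^'n \<Rightarrow> 'n \<Rightarrow> 'n \<Rightarrow> real \<Rightarrow> real" where
  "exp_entry A i j t = (\<Sum>k. (matpow A k $ i $ j / fact k) * t ^ k)"

lemma exp_entry_summable: "summable (\<lambda>k. (matpow A k $ i $ j / fact k) * t ^ k)"
proof (rule summable_comparison_test')
  let ?B = "\<Sum>i\<in>UNIV. \<Sum>j\<in>UNIV. \<bar>A $ i $ j\<bar>"
  show "summable (\<lambda>k. inverse (fact k) * (?B * \<bar>t\<bar>) ^ k)" by (rule summable_exp)
  show "norm ((matpow A k $ i $ j / fact k) * t ^ k) \<le> inverse (fact k) * (?B * \<bar>t\<bar>) ^ k"
    if "k \<ge> 0" for k
  proof -
    have "norm ((matpow A k $ i $ j / fact k) * t ^ k) = inverse (fact k) * (\<bar>matpow A k $ i $ j\<bar> * \<bar>t\<bar> ^ k)"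
      by (simp add: abs_mult power_abs divide_inverse)
    also have "\<dots> \<le> inverse (fact k) * (?B ^ k * \<bar>t\<bar> ^ k)"
      by (intro mult_left_mono mult_right_mono matpow_bound) auto
    finally show ?thesis by (simp only: power_mult_distrib)
  qed
qed

lemma matrix_exp_nth: "matrix_exp (t *\<^sub>R A) $ i $ j = exp_entry A i j t"
proof -
  have "(\<lambda>k. (1 / fact k) *\<^sub>R matpow (t *\<^sub>R A) k) sums (\<chi> i j. exp_entry A i j t)"
    unfolding sums_def
  proof (intro vec_tendstoI)
    fix i j
    have "(\<lambda>n. \<Sum>k<n. (matpow A k $ i $ j / fact k) * t ^ k) \<longlonglongrightarrow> exp_entry A i j t"
      using summable_sums[OF exp_entry_summable] unfolding exp_entry_def sums_def .
    then show "(\<lambda>n. ((\<Sum>k<n. (1 / fact k) *\<^sub>R matpow (t *\<^sub>R A) k) $ i) $ j) \<longlonglongrightarrow> ((\<chi> i j. exp_entry A i j t) $ i) $ j"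
      by (simp add: matpow_scaleR sum_component mult.commute)
  qed
  from sums_unique[OF this, symmetric] show ?thesis
    unfolding matrix_exp_def matpow_def[symmetric] by simp
qed

text \<open>Both forms come from \<open>matpow A (Suc k)\<close>, with the factor \<open>A\<close>
  split off on the left or on the right. Their equality says that \<open>A\<close> commutes with its
  exponential.\<close>

lemma exp_entry_deriv:
  "(exp_entry A i j has_real_derivative (\<Sum>l\<in>UNIV. A $ i $ l * exp_entry A l j t)) (at t)" (is ?thesis1)
  "(\<Sum>l\<in>UNIV. A $ i $ l * exp_entry A l j t) = (\<Sum>l\<in>UNIV. exp_entry A i l t * A $ l $ j)" (is ?thesis2)
proof -
  have "(exp_entry A i j has_real_derivative (\<Sum>k. diffs (\<lambda>k. matpow A k $ i $ j / fact k) k * t ^ k)) (at t)"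
    unfolding exp_entry_def[abs_def] by (rule termdiffs_strong_converges_everywhere) (rule exp_entry_summable)
  note deriv = this
  have d: "diffs (\<lambda>k. matpow A k $ i $ j / fact k) k = matpow A (Suc k) $ i $ j / fact k" for k
    by (simp add: diffs_def divide_simps)
  have 1: "(\<Sum>k. (matpow A (Suc k) $ i $ j / fact k) * t ^ k) = (\<Sum>l\<in>UNIV. A $ i $ l * exp_entry A l j t)"
  proof -
    have "(\<Sum>k. (matpow A (Suc k) $ i $ j / fact k) * t ^ k)
       = (\<Sum>k. \<Sum>l\<in>UNIV. A $ i $ l * ((matpow A k $ l $ j / fact k) * t ^ k))"
      by (simp add: matpow_Suc matrix_matrix_mult_def sum_divide_distrib sum_distrib_right sum_distrib_left mult_ac)
    also have "\<dots> = (\<Sum>l\<in>UNIV. \<Sum>k. A $ i $ l * ((matpow A k $ l $ j / fact k) * t ^ k))"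
      by (rule suminf_sum) (intro summable_mult exp_entry_summable)
    also have "\<dots> = (\<Sum>l\<in>UNIV. A $ i $ l * exp_entry A l j t)"
      unfolding exp_entry_def by (intro sum.cong refl suminf_mult exp_entry_summable)
    finally show ?thesis .
  qed
  have 2: "(\<Sum>k. (matpow A (Suc k) $ i $ j / fact k) * t ^ k) = (\<Sum>l\<in>UNIV. exp_entry A i l t * A $ l $ j)"
  proof -
    have "(\<Sum>k. (matpow A (Suc k) $ i $ j / fact k) * t ^ k)
       = (\<Sum>k. \<Sum>l\<in>UNIV. A $ l $ j * ((matpow A k $ i $ l / fact k) * t ^ k))"
      by (simp add: matpow_Suc' matrix_matrix_mult_def sum_divide_distrib sum_distrib_right sum_distrib_left mult_ac)
    also have "\<dots> = (\<Sum>l\<in>UNIV. \<Sum>k. A $ l $ j * ((matpow A k $ i $ l / fact k) * t ^ k))"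
      by (rule suminf_sum) (intro summable_mult exp_entry_summable)
    also have "\<dots> = (\<Sum>l\<in>UNIV. A $ l $ j * exp_entry A i l t)"
      unfolding exp_entry_def by (intro sum.cong refl suminf_mult exp_entry_summable)
    finally show ?thesis by (simp only: mult.commute)
  qed
  show ?thesis1 using deriv unfolding d 1 .
  show ?thesis2 using 1 2 by simp
qed

lemma exp_entry_0: "exp_entry A i j 0 = (if i = j then 1 else 0)"
  unfolding exp_entry_def by (subst suminf_finite[of "{0}"]) (auto simp: Finite_Cartesian_Product.mat_def)

definition flow :: "real^'n^'n \<Rightarrow> real \<Rightarrow> real^'n \<Rightarrow> real^'n" where
  "flow A t x = matrix_exp (t *\<^sub>R A) *v x"

lemma flow_nth: "flow A t x $ i = (\<Sum>j\<in>UNIV. exp_entry A i j t * x $ j)"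
  by (simp add: flow_def matrix_vector_mult_def matrix_exp_nth)

lemma linear_flow: "linear (flow A t)"
  unfolding flow_def by (rule matrix_vector_mul_linear)

lemma flow_0 [simp]: "flow A 0 x = x"
  by (simp add: Finite_Cartesian_Product.vec_eq_iff flow_nth exp_entry_0 if_distrib if_distribR cong: if_cong)

lemma has_vector_derivative_vecI:
  fixes f :: "real \<Rightarrow> real^'n"
  assumes "\<And>i. ((\<lambda>t. f t $ i) has_real_derivative f' $ i) (at t)"
  shows "(f has_vector_derivative f') (at t)"
proof -
  have "((\<lambda>h. (f (t + h) - f t) /\<^sub>R h) \<longlongrightarrow> f') (at 0)"
    by (rule vec_tendstoI) (use assms in \<open>simp add: DERIV_def divide_inverse mult.commute\<close>)
  then have "((\<lambda>h. norm ((f (t + h) - f t) /\<^sub>R h - f')) \<longlongrightarrow> 0) (at 0)"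
    by (simp add: tendsto_norm_zero_iff LIM_zero_iff)
  moreover have "eventually (\<lambda>h. norm ((f (t + h) - f t) /\<^sub>R h - f') = norm (f (t + h) - f t - h *\<^sub>R f') / norm h) (at 0)"
  proof -
    have "norm (f (t + h) - f t - h *\<^sub>R f') / norm h = norm ((f (t + h) - f t) /\<^sub>R h - f')" if "h \<noteq> 0" for h
    proof -
      have "(f (t + h) - f t) /\<^sub>R h - f' = (f (t + h) - f t - h *\<^sub>R f') /\<^sub>R h"
        using that by (simp add: algebra_simps)
      then show ?thesis by (simp only: norm_scaleR) (simp add: divide_inverse mult.commute)
    qed
    then show ?thesis by (simp add: eventually_at_filter)
  qed
  ultimately have "((\<lambda>h. norm (f (t + h) - f t - h *\<^sub>R f') / norm h) \<longlongrightarrow> 0) (at 0)"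
    by (rule Lim_transform_eventually)
  then show ?thesis
    by (simp add: has_vector_derivative_def has_derivative_at bounded_linear_scaleR_left)
qed

lemma has_vector_derivative_nth:
  fixes f :: "real \<Rightarrow> real^'n"
  assumes "(f has_vector_derivative f') (at t)"
  shows "((\<lambda>t. f t $ i) has_real_derivative f' $ i) (at t)"
  using bounded_linear.has_vector_derivative[OF bounded_linear_vec_nth assms]
  by (simp add: has_real_derivative_iff_has_vector_derivative)

lemma flow_deriv: "((\<lambda>t. flow A t x) has_vector_derivative A *v flow A t x) (at t)"
proof (rule has_vector_derivative_vecI)
  fix i
  have "((\<lambda>t. flow A t x $ i) has_real_derivative
      (\<Sum>j\<in>UNIV. (\<Sum>l\<in>UNIV. A $ i $ l * exp_entry A l j t) * x $ j)) (at t)"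
    unfolding flow_nth by (intro DERIV_sum DERIV_cmult_right exp_entry_deriv)
  also have "(\<Sum>j\<in>UNIV. (\<Sum>l\<in>UNIV. A $ i $ l * exp_entry A l j t) * x $ j)
     = (\<Sum>j\<in>UNIV. \<Sum>l\<in>UNIV. A $ i $ l * (exp_entry A l j t * x $ j))"
    by (simp add: sum_distrib_right mult.assoc)
  also have "\<dots> = (\<Sum>l\<in>UNIV. \<Sum>j\<in>UNIV. A $ i $ l * (exp_entry A l j t * x $ j))"
    by (rule sum.swap)
  also have "\<dots> = (A *v flow A t x) $ i"
    by (simp add: matrix_vector_mult_def flow_nth sum_distrib_left)
  finally show "((\<lambda>t. flow A t x $ i) has_real_derivative (A *v flow A t x) $ i) (at t)" .
qed

text \<open>Uniqueness for the linear equation: applying \<open>flow A (- t)\<close> to any solution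
  gives a curve with derivative 0. The group property of the flow and all explicit solutions below
  are consequences.\<close>

lemma flow_minus_solution:
  assumes f: "\<And>t. (f has_vector_derivative A *v f t) (at t)"
  shows "flow A (- t) (f t) = f 0"
proof -
  have "((\<lambda>t. flow A (- t) (f t) $ i) has_real_derivative 0) (at t)" for t i
  proof -
    have e: "((\<lambda>t. exp_entry A i j (- t)) has_real_derivative
        - (\<Sum>l\<in>UNIV. exp_entry A i l (- t) * A $ l $ j)) (at t)" for j
      using DERIV_chain2[OF exp_entry_deriv(1) DERIV_minus[OF DERIV_ident], of A i j t]
      by (simp add: exp_entry_deriv(2))
    have "((\<lambda>t. flow A (- t) (f t) $ i) has_real_derivative
       (\<Sum>j\<in>UNIV. - (\<Sum>l\<in>UNIV. exp_entry A i l (- t) * A $ l $ j) * f t $ j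
          + (A *v f t) $ j * exp_entry A i j (- t))) (at t)"
      unfolding flow_nth by (intro DERIV_sum DERIV_mult e has_vector_derivative_nth f)
    moreover have "(\<Sum>j\<in>UNIV. \<Sum>l\<in>UNIV. f t $ j * (A $ l $ j * exp_entry A i l (- t)))
       = (\<Sum>j\<in>UNIV. \<Sum>l\<in>UNIV. f t $ l * (A $ j $ l * exp_entry A i j (- t)))"
      by (rule sum.swap)
    then have "(\<Sum>j\<in>UNIV. - (\<Sum>l\<in>UNIV. exp_entry A i l (- t) * A $ l $ j) * f t $ j
          + (A *v f t) $ j * exp_entry A i j (- t)) = 0"
      by (simp add: sum.distrib sum_negf sum_subtractf matrix_vector_mult_def sum_distrib_right sum_distrib_left mult_ac)
    ultimately show ?thesis by simp
  qed
  then have "flow A (- t) (f t) $ i = flow A (- 0) (f 0) $ i" for i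
    using DERIV_isconst_all[of "\<lambda>t. flow A (- t) (f t) $ i" t 0] by blast
  then show ?thesis by (simp add: Finite_Cartesian_Product.vec_eq_iff)
qed

lemma flow_inverse: "flow A t (flow A (- t) x) = x"
  using flow_minus_solution[of "\<lambda>t. flow A t x" A "- t", OF flow_deriv] by simp

lemma flow_solution:
  assumes "\<And>t. (f has_vector_derivative A *v f t) (at t)"
  shows "f t = flow A t (f 0)"
  using flow_inverse[of A t "f t"] flow_minus_solution[of f A t] assms by simp

lemma flow_add: "flow A (s + t) x = flow A s (flow A t x)"
proof -
  have "((\<lambda>s. flow A (s + t) x) has_vector_derivative A *v flow A (s + t) x) (at s)" for s
    using vector_diff_chain_at[of "\<lambda>s. s + t" 1 s "\<lambda>t. flow A t x", OF _ flow_deriv]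
    by (simp add: comp_def has_vector_derivative_add_const has_vector_derivative_id)
  from flow_solution[OF this, of s] show ?thesis by simp
qed

text \<open>Put \<open>z = a + \<i> * b\<close>, \<open>c1 = x1 + \<i> * y1\<close> and
  \<open>c2 = x2 + \<i> * y2\<close>. The hypotheses say \<open>A c1 = z c1\<close> and
  \<open>A c2 = z c2 + c1\<close>, and the right side is the real part of
  \<open>exp (z * t) * (c2 + t * c1)\<close>. Eigenvectors are the case
  \<open>c1 = 0\<close>.\<close>

lemma flow_generalized_eigenvector:
  assumes "A *v x1 = a *\<^sub>R x1 - b *\<^sub>R y1" "A *v y1 = b *\<^sub>R x1 + a *\<^sub>R y1"
    and "A *v x2 = a *\<^sub>R x2 - b *\<^sub>R y2 + x1" "A *v y2 = b *\<^sub>R x2 + a *\<^sub>R y2 + y1"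
  shows "flow A t x2 = exp (a * t) *\<^sub>R (cos (b * t) *\<^sub>R (x2 + t *\<^sub>R x1) - sin (b * t) *\<^sub>R (y2 + t *\<^sub>R y1))"
proof -
  define f where "f t = exp (a * t) *\<^sub>R (cos (b * t) *\<^sub>R (x2 + t *\<^sub>R x1) - sin (b * t) *\<^sub>R (y2 + t *\<^sub>R y1))" for t
  have "(f has_vector_derivative A *v f t) (at t)" for t
  proof (rule has_vector_derivative_vecI)
    fix i
    have Af: "A *v f t = exp (a * t) *\<^sub>R (cos (b * t) *\<^sub>R ((a *\<^sub>R x2 - b *\<^sub>R y2 + x1) + t *\<^sub>R (a *\<^sub>R x1 - b *\<^sub>R y1))
        - sin (b * t) *\<^sub>R ((b *\<^sub>R x2 + a *\<^sub>R y2 + y1) + t *\<^sub>R (b *\<^sub>R x1 + a *\<^sub>R y1)))"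
      unfolding f_def
      by (simp only: linear_scale[OF matrix_vector_mul_linear] linear_add[OF matrix_vector_mul_linear]
          linear_diff[OF matrix_vector_mul_linear] assms)
    show "((\<lambda>t. f t $ i) has_real_derivative (A *v f t) $ i) (at t)"
      unfolding Af unfolding f_def
      by (auto intro!: derivative_eq_intros simp: algebra_simps)
  qed
  from flow_solution[OF this, of t] show ?thesis by (simp add: f_def)
qed

section \<open>Spectral bounds\<close>

lemma cmat_of_carrier [simp]: "cmat_of (A :: real^'n^'n) \<in> carrier_mat CARD('n) CARD('n)"
  by (simp add: cmat_of_def)

lemma enum_bij: "bij_betw (from_nat_into (UNIV :: 'n::finite set)) {..<CARD('n)} UNIV"
  using bij_betw_from_nat_into_finite[of "UNIV :: 'n set"] by simp

lemma mult_mat_index_sum: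
  assumes "A \<in> carrier_mat n n" "B \<in> carrier_mat n n" "i < n" "j < n"
  shows "(A * B) $$ (i, j) = (\<Sum>k<n. A $$ (i, k) * B $$ (k, j))"
  using assms by (simp add: scalar_prod_def atLeast0LessThan)

text \<open>For the matrices of the similarity, \<open>p j\<close> is column \<open>j\<close> of
  \<open>P\<close> and \<open>q i\<close> is row \<open>i\<close> of \<open>Q\<close>, with entries
  indexed by the type \<open>'n\<close>. The conclusions are \<open>A P = P U\<close>,
  \<open>Q A = U Q\<close>, \<open>P Q = 1\<close> and \<open>Q P = 1\<close>.\<close>

lemma similar_functions:
  fixes A :: "real^'n^'n"
  assumes "similar_mat (cmat_of A) U"
  obtains p q :: "nat \<Rightarrow> 'n \<Rightarrow> complex" where
    "\<And>i j. j < CARD('n) \<Longrightarrow> (\<Sum>l\<in>UNIV. of_real (A $ i $ l) * p j l) = (\<Sum>k<CARD('n). p k i * U $$ (k, j))"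
    "\<And>i l. i < CARD('n) \<Longrightarrow> (\<Sum>m\<in>UNIV. q i m * of_real (A $ m $ l)) = (\<Sum>k<CARD('n). U $$ (i, k) * q k l)"
    "\<And>a b. (\<Sum>k<CARD('n). p k a * q k b) = (if a = b then 1 else 0)"
    "\<And>i j. i < CARD('n) \<Longrightarrow> j < CARD('n) \<Longrightarrow> (\<Sum>m\<in>UNIV. q i m * p j m) = (if i = j then 1 else 0)"
proof -
  let ?n = "CARD('n)"
  let ?M = "cmat_of A"
  let ?s = "from_nat_into (UNIV :: 'n set)"
  obtain P Q where wit: "similar_mat_wit ?M U P Q" using assms unfolding similar_mat_def by blast
  note w = similar_mat_witD2[OF cmat_of_carrier wit]
  have MP: "?M * P = P * U"
  proof -
    have "?M * P = P * U * Q * P" using w(3) by simp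
    also have "\<dots> = P * U * (Q * P)" using w by (intro assoc_mult_mat) auto
    also have "\<dots> = P * U" using w by simp
    finally show ?thesis .
  qed
  have QM: "Q * ?M = U * Q"
  proof -
    have "Q * ?M = Q * (P * (U * Q))" using w by (simp add: assoc_mult_mat[of P ?n ?n U ?n Q ?n])
    also have "\<dots> = Q * P * (U * Q)" using w by (intro assoc_mult_mat[symmetric]) auto
    also have "\<dots> = U * Q" using w by simp
    finally show ?thesis .
  qed
  define t where "t = inv_into {..<?n} ?s"
  have ts: "t (?s k) = k" if "k < ?n" for k
    unfolding t_def using that bij_betw_inv_into_left[OF enum_bij] by auto
  have tn: "t i < ?n" and st: "?s (t i) = i" for i
    using bij_betw_inv_into_right[OF enum_bij, of i] bij_betwE[OF bij_betw_inv_into[OF enum_bij]]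
    by (auto simp: t_def)
  have reindex: "(\<Sum>l\<in>UNIV. f l) = (\<Sum>k<?n. f (?s k))" for f :: "'n \<Rightarrow> complex"
    using sum.reindex_bij_betw[OF enum_bij, of f] by simp
  have M_index: "?M $$ (i, k) = of_real ((A $ (?s i)) $ (?s k))" if "i < ?n" "k < ?n" for i k
    using that by (simp add: cmat_of_def)
  define p where "p j i = P $$ (t i, j)" for j i
  define q where "q i m = Q $$ (i, t m)" for i m
  show thesis
  proof (rule that[of p q])
    show "(\<Sum>l\<in>UNIV. of_real (A $ i $ l) * p j l) = (\<Sum>k<?n. p k i * U $$ (k, j))"
      if j: "j < ?n" for i j
    proof -
      have "(\<Sum>l\<in>UNIV. of_real (A $ i $ l) * p j l) = (\<Sum>k<?n. ?M $$ (t i, k) * P $$ (k, j))"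
        unfolding reindex by (intro sum.cong refl) (simp add: p_def ts M_index tn st)
      also have "\<dots> = (?M * P) $$ (t i, j)"
        by (rule mult_mat_index_sum[symmetric]) (use w tn j in auto)
      also have "\<dots> = (\<Sum>k<?n. p k i * U $$ (k, j))"
        unfolding MP p_def by (rule mult_mat_index_sum) (use w tn j in auto)
      finally show ?thesis .
    qed
    show "(\<Sum>m\<in>UNIV. q i m * of_real (A $ m $ l)) = (\<Sum>k<?n. U $$ (i, k) * q k l)"
      if i: "i < ?n" for i l
    proof -
      have "(\<Sum>m\<in>UNIV. q i m * of_real (A $ m $ l)) = (\<Sum>k<?n. Q $$ (i, k) * ?M $$ (k, t l))"
        unfolding reindex by (intro sum.cong refl) (simp add: q_def ts M_index tn st)
      also have "\<dots> = (Q * ?M) $$ (i, t l)"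
        by (rule mult_mat_index_sum[symmetric]) (use w tn i in auto)
      also have "\<dots> = (\<Sum>k<?n. U $$ (i, k) * q k l)"
        unfolding QM q_def by (rule mult_mat_index_sum) (use w tn i in auto)
      finally show ?thesis .
    qed
    show "(\<Sum>k<?n. p k a * q k b) = (if a = b then 1 else 0)" for a b
    proof -
      have "(\<Sum>k<?n. p k a * q k b) = (P * Q) $$ (t a, t b)"
        unfolding p_def q_def by (rule mult_mat_index_sum[symmetric]) (use w tn in auto)
      also have "\<dots> = (if t a = t b then 1 else 0)" using w tn by simp
      also have "t a = t b \<longleftrightarrow> a = b" using st by metis
      finally show ?thesis .
    qed
    show "(\<Sum>m\<in>UNIV. q i m * p j m) = (if i = j then 1 else 0)" if ij: "i < ?n" "j < ?n" for i j
    proof -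
      have "(\<Sum>m\<in>UNIV. q i m * p j m) = (\<Sum>k<?n. Q $$ (i, k) * P $$ (k, j))"
        unfolding reindex by (intro sum.cong refl) (simp add: p_def q_def ts)
      also have "\<dots> = (Q * P) $$ (i, j)"
        by (rule mult_mat_index_sum[symmetric]) (use w ij in auto)
      also have "\<dots> = (if i = j then 1 else 0)" using w ij by simp
      finally show ?thesis .
    qed
  qed
qed

lemma diag_in_spectrum:
  fixes A :: "real^'n^'n"
  assumes "similar_mat (cmat_of A) U" "U \<in> carrier_mat CARD('n) CARD('n)" "upper_triangular U" "i < CARD('n)"
  shows "U $$ (i, i) \<in> spectrum (cmat_of A)"
proof -
  have "char_poly (cmat_of A) = (\<Prod>a\<leftarrow>diag_mat U. [:- a, 1:])"
    using char_poly_similar[OF assms(1)] char_poly_upper_triangular[OF assms(2,3)] by simp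
  moreover have "U $$ (i, i) \<in> set (diag_mat U)" using assms(2,4) by (auto simp: diag_mat_def)
  ultimately have "poly (char_poly (cmat_of A)) (U $$ (i, i)) = 0"
    by (simp add: poly_prod_list prod_list_zero_iff image_iff)
  then show ?thesis using spectrum_root_char_poly[OF cmat_of_carrier] by blast
qed

lemma exp_minus_deriv:
  fixes z :: complex and t :: real
  shows "((\<lambda>t. exp (- (of_real t * z))) has_vector_derivative - z * exp (- (of_real t * z))) (at t)"
  using exp_scaleR_has_vector_derivative_right[of "- z" t UNIV]
  by (simp add: scaleR_conv_of_real mult.commute)

text \<open>Variation of constants: multiplication by \<open>exp (- (of_real t * z))\<close> removes
  the homogeneous part and leaves a derivative bounded by \<open>D * exp (- (c * t))\<close> with
  \<open>c = Re z - b\<close>, which is integrated from \<open>t\<close> to 0 through the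
  antiderivative \<open>phi\<close>.\<close>

lemma scalar_ode_bound:
  fixes g h :: "real \<Rightarrow> complex"
  assumes g: "\<And>t. (g has_vector_derivative z * g t + h t) (at t)"
    and h: "\<And>t. t \<le> 0 \<Longrightarrow> norm (h t) \<le> D * exp (b * t)" and b: "b < Re z" and t: "t \<le> 0"
  shows "norm (g t) \<le> (norm (g 0) + D / (Re z - b)) * exp (b * t)"
proof (cases "t = 0")
  case True
  have "D \<ge> 0" using order_trans[OF norm_ge_zero h[of 0]] by simp
  then show ?thesis using True b by simp
next
  case False
  then have t: "t < 0" using t by simp
  have D: "D \<ge> 0" using order_trans[OF norm_ge_zero h[of 0]] by simp
  define c where "c = Re z - b"
  have c: "c > 0" using b by (simp add: c_def)
  define f where "f t = exp (- (of_real t * z)) * g t" for t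
  have f': "(f has_vector_derivative exp (- (of_real t * z)) * h t) (at t)" for t
  proof -
    have "((\<lambda>t. exp (- (of_real t * z))) has_vector_derivative - z * exp (- (of_real t * z))) (at t)"
      by (rule exp_minus_deriv)
    from has_vector_derivative_mult[OF this g] show ?thesis
      unfolding f_def by (simp add: algebra_simps)
  qed
  have nexp: "norm (exp (- (of_real t * z))) = exp (- (Re z * t))" for t
    by (simp add: norm_exp_eq_Re mult.commute)
  define phi where "phi t = - (D / c) * exp (- (c * t))" for t
  have "norm (f 0 - f t) \<le> phi 0 - phi t"
  proof (rule differentiable_bound_general[OF t])
    show "continuous_on {t..0} f" using f'
      by (meson continuous_at_imp_continuous_on has_vector_derivative_continuous)
    show "continuous_on {t..0} phi" unfolding phi_def by (intro continuous_intros)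
    show "(phi has_vector_derivative D * exp (- (c * x))) (at x)" for x
      unfolding phi_def has_real_derivative_iff_has_vector_derivative[symmetric]
      using c by (auto intro!: derivative_eq_intros)
    show "norm (exp (- (of_real x * z)) * h x) \<le> D * exp (- (c * x))" if "x < 0" for x
    proof -
      have "norm (exp (- (of_real x * z)) * h x) \<le> exp (- (Re z * x)) * (D * exp (b * x))"
        unfolding norm_mult nexp using h[of x] that by (intro mult_left_mono) auto
      also have "\<dots> = D * exp (- (c * x))" by (simp add: c_def algebra_simps flip: exp_add)
      finally show ?thesis .
    qed
  qed (rule f')
  then have "norm (f t) \<le> norm (f 0) + (D / c) * exp (- (c * t))"
    using norm_triangle_sub[of "f t" "f 0"] D c by (simp add: phi_def norm_minus_commute)
       (smt (verit) divide_nonneg_pos)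
  then have "exp (Re z * t) * norm (f t) \<le> exp (Re z * t) * (norm (g 0) + (D / c) * exp (- (c * t)))"
    by (intro mult_left_mono) (auto simp: f_def)
  moreover have "exp (Re z * t) * norm (f t) = norm (g t)"
    unfolding f_def norm_mult nexp by (simp add: exp_minus)
  moreover have "exp (Re z * t) * exp (- (c * t)) = exp (b * t)"
    by (simp add: c_def algebra_simps flip: exp_add)
  moreover have "exp (Re z * t) \<le> exp (b * t)" using b t by (simp add: mult_right_mono_neg)
  then have "exp (Re z * t) * norm (g 0) \<le> exp (b * t) * norm (g 0)" by (intro mult_right_mono) auto
  ultimately show ?thesis unfolding c_def[symmetric] by (simp add: algebra_simps)
qed

definition cfunctional :: "('n \<Rightarrow> complex) \<Rightarrow> real^'n \<Rightarrow> complex" where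
  "cfunctional r x = (\<Sum>m\<in>UNIV. r m * of_real (x $ m))"

lemma linear_cfunctional: "linear (cfunctional r)"
  unfolding cfunctional_def
  by (intro linearI)
     (auto simp: algebra_simps sum.distrib sum_distrib_left scaleR_conv_of_real[of _ "_::complex"])

lemma cfunctional_axis: "cfunctional r (axis m 1) = r m"
  unfolding cfunctional_def by (simp add: axis_def if_distrib cong: if_cong)

lemma cfunctional_flow_deriv:
  fixes A :: "real^'n^'n"
  assumes "\<And>l. (\<Sum>m\<in>UNIV. r m * of_real (A $ m $ l)) = (\<Sum>k\<in>I. U k * q k l)" "finite I"
  shows "((\<lambda>t. cfunctional r (flow A t x)) has_vector_derivative (\<Sum>k\<in>I. U k * cfunctional (q k) (flow A t x))) (at t)"
proof -
  have "((\<lambda>t. cfunctional r (flow A t x)) has_vector_derivative cfunctional r (A *v flow A t x)) (at t)"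
    by (rule bounded_linear.has_vector_derivative[OF _ flow_deriv])
       (use linear_cfunctional linear_conv_bounded_linear in blast)
  moreover have "cfunctional r (A *v y) = (\<Sum>k\<in>I. U k * cfunctional (q k) y)" for y
  proof -
    have "cfunctional r (A *v y) = (\<Sum>m\<in>UNIV. \<Sum>l\<in>UNIV. r m * of_real (A $ m $ l) * of_real (y $ l))"
      by (simp add: cfunctional_def matrix_vector_mult_def sum_distrib_left mult.assoc)
    also have "\<dots> = (\<Sum>l\<in>UNIV. \<Sum>m\<in>UNIV. r m * of_real (A $ m $ l) * of_real (y $ l))"
      by (rule sum.swap)
    also have "\<dots> = (\<Sum>l\<in>UNIV. (\<Sum>k\<in>I. U k * q k l) * of_real (y $ l))"
      by (simp add: sum_distrib_right[symmetric] assms)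
    also have "\<dots> = (\<Sum>l\<in>UNIV. \<Sum>k\<in>I. U k * (q k l * of_real (y $ l)))"
      by (simp add: sum_distrib_right mult.assoc)
    also have "\<dots> = (\<Sum>k\<in>I. \<Sum>l\<in>UNIV. U k * (q k l * of_real (y $ l)))"
      by (rule sum.swap)
    finally show ?thesis by (simp add: cfunctional_def sum_distrib_left)
  qed
  ultimately show ?thesis by simp
qed

lemma cfunctional_bound: "\<exists>C>0. \<forall>x. norm (cfunctional r x) \<le> C * norm x"
  using linear_bounded_pos[OF linear_cfunctional] by blast

text \<open>In Schur coordinates the equation for the functional \<open>q i\<close> is forced only
  by the \<open>q k\<close> with \<open>k > i\<close>, so the system is solved from the last row
  upwards. As \<open>b\<close> lies strictly below every \<open>Re z\<close>, no polynomial factors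
  accumulate.\<close>

lemma flow_lower_bound:
  fixes A :: "real^'n^'n"
  assumes b: "\<And>z. z \<in> spectrum (cmat_of A) \<Longrightarrow> b < Re z"
  shows "\<exists>C. \<forall>t\<le>0. \<forall>y. norm (flow A t y) \<le> C * exp (b * t) * norm y"
proof -
  let ?n = "CARD('n)"
  obtain as where "char_poly (cmat_of A) = (\<Prod>a\<leftarrow>as. [:- a, 1:])"
    using char_poly_factorized[OF cmat_of_carrier, of A] by blast
  from schur_decomposition_exists[OF cmat_of_carrier this]
  obtain U where U: "U \<in> carrier_mat ?n ?n" "upper_triangular U" "similar_mat (cmat_of A) U" by blast
  obtain p q :: "nat \<Rightarrow> 'n \<Rightarrow> complex" where
    q: "\<And>i l. i < ?n \<Longrightarrow> (\<Sum>m\<in>UNIV. q i m * of_real (A $ m $ l)) = (\<Sum>k<?n. U $$ (i, k) * q k l)"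
    and pq: "\<And>a b. (\<Sum>k<?n. p k a * q k b) = (if a = b then 1 else 0)"
    by (rule similar_functions[OF U(3)]) (rule that)
  have row: "\<exists>C. \<forall>t\<le>0. \<forall>x. norm (cfunctional (q i) (flow A t x)) \<le> C * exp (b * t) * norm x" if "i < ?n" for i
    using that
  proof (induction "?n - i" arbitrary: i rule: less_induct)
    case less
    have "\<exists>C. \<forall>t\<le>0. \<forall>x. norm (cfunctional (q k) (flow A t x)) \<le> C * exp (b * t) * norm x"
      if "k \<in> {i<..<?n}" for k
      using less that by auto
    then obtain C where C: "\<And>k t x. k \<in> {i<..<?n} \<Longrightarrow> t \<le> 0 \<Longrightarrow> norm (cfunctional (q k) (flow A t x)) \<le> C k * exp (b * t) * norm x"
      by metis
    define z where "z = U $$ (i, i)"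
    have z: "b < Re z" unfolding z_def by (rule b) (rule diag_in_spectrum[OF U(3,1,2) less(2)])
    define D where "D = (\<Sum>k\<in>{i<..<?n}. norm (U $$ (i, k)) * C k)"
    obtain C0 where C0: "C0 > 0" "\<And>x. norm (cfunctional (q i) x) \<le> C0 * norm x"
      using cfunctional_bound by blast
    have "norm (cfunctional (q i) (flow A t x)) \<le> (C0 + D / (Re z - b)) * exp (b * t) * norm x" if t: "t \<le> 0" for t x
    proof -
      define h where "h t = (\<Sum>k\<in>{i<..<?n}. U $$ (i, k) * cfunctional (q k) (flow A t x))" for t
      have split: "{..<?n} = {..<i} \<union> insert i {i<..<?n}" using less(2) by auto
      have zero: "(\<Sum>k<i. U $$ (i, k) * cfunctional (q k) (flow A t x)) = 0" for t
        using U(1,2) less(2) by (intro sum.neutral) (auto simp: upper_triangular_def)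
      have "((\<lambda>t. cfunctional (q i) (flow A t x)) has_vector_derivative z * cfunctional (q i) (flow A t x) + h t) (at t)" for t
      proof -
        have "((\<lambda>t. cfunctional (q i) (flow A t x)) has_vector_derivative (\<Sum>k<?n. U $$ (i, k) * cfunctional (q k) (flow A t x))) (at t)"
          by (rule cfunctional_flow_deriv[OF q[OF less(2)]]) simp
        also have "(\<Sum>k<?n. U $$ (i, k) * cfunctional (q k) (flow A t x)) = z * cfunctional (q i) (flow A t x) + h t"
          unfolding split by (subst sum.union_disjoint) (auto simp: zero h_def z_def)
        finally show ?thesis .
      qed
      moreover have "norm (h t) \<le> (D * norm x) * exp (b * t)" if "t \<le> 0" for t
      proof -
        have "norm (h t) \<le> (\<Sum>k\<in>{i<..<?n}. norm (U $$ (i, k)) * norm (cfunctional (q k) (flow A t x)))"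
          unfolding h_def by (rule order_trans[OF norm_sum]) (simp add: norm_mult)
        also have "\<dots> \<le> (\<Sum>k\<in>{i<..<?n}. norm (U $$ (i, k)) * (C k * exp (b * t) * norm x))"
          using that by (intro sum_mono mult_left_mono C) auto
        also have "\<dots> = (D * norm x) * exp (b * t)" by (simp add: D_def sum_distrib_right sum_distrib_left mult_ac)
        finally show ?thesis .
      qed
      ultimately have "norm (cfunctional (q i) (flow A t x)) \<le> (norm (cfunctional (q i) (flow A 0 x)) + (D * norm x) / (Re z - b)) * exp (b * t)"
        using z t by (rule scalar_ode_bound)
      also have "\<dots> \<le> (C0 * norm x + (D * norm x) / (Re z - b)) * exp (b * t)"
        using C0 by (intro mult_right_mono add_right_mono) auto
      also have "\<dots> = (C0 + D / (Re z - b)) * exp (b * t) * norm x" by (simp add: algebra_simps)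
      finally show ?thesis .
    qed
    then show ?case by blast
  qed
  then obtain C where C: "\<And>i t x. i < ?n \<Longrightarrow> t \<le> 0 \<Longrightarrow> norm (cfunctional (q i) (flow A t x)) \<le> C i * exp (b * t) * norm x"
    by metis
  have recover: "of_real (x $ a) = (\<Sum>k<?n. p k a * cfunctional (q k) x)" for x a
  proof -
    have "(\<Sum>k<?n. p k a * cfunctional (q k) x) = (\<Sum>k<?n. \<Sum>m\<in>UNIV. p k a * q k m * of_real (x $ m))"
      by (simp add: cfunctional_def sum_distrib_left mult.assoc)
    also have "\<dots> = (\<Sum>m\<in>UNIV. \<Sum>k<?n. p k a * q k m * of_real (x $ m))" by (rule sum.swap)
    also have "\<dots> = (\<Sum>m\<in>UNIV. (if a = m then 1 else 0) * of_real (x $ m))"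
      by (simp add: sum_distrib_right[symmetric] pq)
    also have "\<dots> = of_real (x $ a)" by (simp add: if_distribR if_distrib cong: if_cong)
    finally show ?thesis by simp
  qed
  have "norm (flow A t y) \<le> (\<Sum>a\<in>UNIV. \<Sum>k<?n. norm (p k a) * C k) * exp (b * t) * norm y" if "t \<le> 0" for t y
  proof -
    have "norm (flow A t y) \<le> (\<Sum>a\<in>UNIV. \<bar>flow A t y $ a\<bar>)" by (rule norm_le_l1_cart)
    also have "\<dots> \<le> (\<Sum>a\<in>UNIV. \<Sum>k<?n. norm (p k a) * (C k * exp (b * t) * norm y))"
    proof (rule sum_mono)
      fix a
      have "\<bar>flow A t y $ a\<bar> = norm (complex_of_real (flow A t y $ a))" by simp
      also have "\<dots> \<le> (\<Sum>k<?n. norm (p k a) * norm (cfunctional (q k) (flow A t y)))"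
        unfolding recover by (rule order_trans[OF norm_sum]) (simp add: norm_mult)
      also have "\<dots> \<le> (\<Sum>k<?n. norm (p k a) * (C k * exp (b * t) * norm y))"
        using that by (intro sum_mono mult_left_mono C) auto
      finally show "\<bar>flow A t y $ a\<bar> \<le> (\<Sum>k<?n. norm (p k a) * (C k * exp (b * t) * norm y))" .
    qed
    also have "\<dots> = (\<Sum>a\<in>UNIV. \<Sum>k<?n. norm (p k a) * C k) * exp (b * t) * norm y"
      by (simp add: sum_distrib_right sum_distrib_left mult_ac)
    finally show ?thesis .
  qed
  then show ?thesis by blast
qed

text \<open>For a left eigenvector the functional solves a scalar equation along the flow, so there
  is no polynomial factor even if the eigenvalue has a larger Jordan block.\<close>

lemma cfunctional_eigen:
  fixes A :: "real^'n^'n"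
  assumes "\<And>l. (\<Sum>m\<in>UNIV. r m * of_real (A $ m $ l)) = z * r l"
  shows "norm (cfunctional r (flow A t x)) = exp (Re z * t) * norm (cfunctional r x)"
proof -
  define f where "f t = exp (- (of_real t * z)) * cfunctional r (flow A t x)" for t
  have "(f has_vector_derivative 0) (at t within UNIV)" for t
  proof -
    have "((\<lambda>t. exp (- (of_real t * z))) has_vector_derivative - z * exp (- (of_real t * z))) (at t)"
      by (rule exp_minus_deriv)
    moreover have "((\<lambda>t. cfunctional r (flow A t x)) has_vector_derivative (\<Sum>k\<in>{()}. z * cfunctional r (flow A t x))) (at t)"
      by (rule cfunctional_flow_deriv) (use assms in auto)
    ultimately show ?thesis
      unfolding f_def using has_vector_derivative_mult by fastforce
  qed
  then have "f t = f 0" using has_vector_derivative_zero_constant[of UNIV f] by (metis convex_UNIV UNIV_I)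
  then have "exp (- (of_real t * z)) * cfunctional r (flow A t x) = cfunctional r x" by (simp add: f_def)
  then have e: "norm (exp (- (of_real t * z))) * norm (cfunctional r (flow A t x)) = norm (cfunctional r x)"
    by (metis norm_mult)
  have n: "norm (exp (- (of_real t * z))) = exp (- (Re z * t))"
    by (simp add: norm_exp_eq_Re mult.commute)
  have "exp (Re z * t) * (exp (- (Re z * t)) * norm (cfunctional r (flow A t x))) = norm (cfunctional r (flow A t x))"
    by (simp add: mult.assoc[symmetric] flip: exp_add)
  then show ?thesis using e unfolding n by simp
qed

section \<open>Real solutions from complex eigenvectors\<close>

definition re_vec :: "('n \<Rightarrow> complex) \<Rightarrow> real^'n" where "re_vec c = (\<chi> i. Re (c i))"
definition im_vec :: "('n \<Rightarrow> complex) \<Rightarrow> real^'n" where "im_vec c = (\<chi> i. Im (c i))"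

lemma re_im_vec_mult:
  fixes A :: "real^'n^'n"
  assumes "\<And>i. (\<Sum>l\<in>UNIV. of_real (A $ i $ l) * c l) = z * c i + d i"
  shows "A *v re_vec c = Re z *\<^sub>R re_vec c - Im z *\<^sub>R im_vec c + re_vec d"
    "A *v im_vec c = Im z *\<^sub>R re_vec c + Re z *\<^sub>R im_vec c + im_vec d"
proof -
  have "(\<Sum>l\<in>UNIV. A $ i $ l * Re (c l)) = Re (\<Sum>l\<in>UNIV. of_real (A $ i $ l) * c l)"
    "(\<Sum>l\<in>UNIV. A $ i $ l * Im (c l)) = Im (\<Sum>l\<in>UNIV. of_real (A $ i $ l) * c l)" for i
    by simp_all
  then show "A *v re_vec c = Re z *\<^sub>R re_vec c - Im z *\<^sub>R im_vec c + re_vec d"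
    "A *v im_vec c = Im z *\<^sub>R re_vec c + Re z *\<^sub>R im_vec c + im_vec d"
    unfolding assms
    by (auto simp: Finite_Cartesian_Product.vec_eq_iff matrix_vector_mult_def re_vec_def im_vec_def)
qed

text \<open>If the real part vanishes, multiplication by \<open>- \<i>\<close> moves the imaginary
  part into its place; eigenvector relations survive multiplication by a scalar.\<close>

lemma re_vec_nonzero_rotation:
  assumes "c i \<noteq> 0"
  obtains u :: complex where "u \<noteq> 0" "re_vec (\<lambda>i. u * c i) \<noteq> 0"
proof (cases "re_vec c = 0")
  case True
  then have "Re (c i) = 0" by (simp add: re_vec_def Finite_Cartesian_Product.vec_eq_iff)
  then have "Im (c i) \<noteq> 0" using assms by (simp add: complex_eq_iff)
  then have "re_vec (\<lambda>i. - \<i> * c i) \<noteq> 0"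
    by (auto simp: re_vec_def Finite_Cartesian_Product.vec_eq_iff)
  then show ?thesis using that[of "- \<i>"] by simp
next
  case False
  then show ?thesis using that[of 1] by simp
qed

lemma flow_eigenvector:
  fixes A :: "real^'n^'n"
  assumes eig: "\<And>i. (\<Sum>l\<in>UNIV. of_real (A $ i $ l) * c l) = z * c i" and ne: "c i0 \<noteq> 0"
  obtains v C where "v \<noteq> 0" "\<And>t. norm (flow A t v) \<le> C * exp (Re z * t)"
proof -
  obtain u where u: "u \<noteq> 0" "re_vec (\<lambda>i. u * c i) \<noteq> 0" using re_vec_nonzero_rotation[of c i0, OF ne] .
  define d where "d i = u * c i" for i
  have "(\<Sum>l\<in>UNIV. of_real (A $ i $ l) * d l) = z * d i + 0" for i
  proof -
    have "(\<Sum>l\<in>UNIV. of_real (A $ i $ l) * d l) = u * (\<Sum>l\<in>UNIV. of_real (A $ i $ l) * c l)"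
      by (simp add: d_def sum_distrib_left mult_ac)
    then show ?thesis by (simp add: eig d_def)
  qed
  note m = re_im_vec_mult[OF this]
  have z: "re_vec (\<lambda>_. 0) = 0" "im_vec (\<lambda>_. 0) = 0"
    by (simp_all add: re_vec_def im_vec_def Finite_Cartesian_Product.vec_eq_iff)
  have "flow A t (re_vec d) = exp (Re z * t) *\<^sub>R (cos (Im z * t) *\<^sub>R (re_vec d + t *\<^sub>R 0) - sin (Im z * t) *\<^sub>R (im_vec d + t *\<^sub>R 0))" for t
    by (rule flow_generalized_eigenvector) (use m z in auto)
  then have "norm (flow A t (re_vec d)) \<le> (norm (re_vec d) + norm (im_vec d)) * exp (Re z * t)" for t
  proof -
    assume *: "\<And>t. flow A t (re_vec d) = exp (Re z * t) *\<^sub>R (cos (Im z * t) *\<^sub>R (re_vec d + t *\<^sub>R 0) - sin (Im z * t) *\<^sub>R (im_vec d + t *\<^sub>R 0))"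
    have "norm (cos (Im z * t) *\<^sub>R re_vec d - sin (Im z * t) *\<^sub>R im_vec d) \<le> \<bar>cos (Im z * t)\<bar> * norm (re_vec d) + \<bar>sin (Im z * t)\<bar> * norm (im_vec d)"
      using norm_triangle_ineq4[of "cos (Im z * t) *\<^sub>R re_vec d" "sin (Im z * t) *\<^sub>R im_vec d"] by simp
    also have "\<dots> \<le> 1 * norm (re_vec d) + 1 * norm (im_vec d)"
      by (intro add_mono mult_right_mono) auto
    finally show ?thesis by (simp add: * mult.commute)
  qed
  then show ?thesis using u that unfolding d_def by blast
qed

text \<open>The eigenvector direction itself grows like \<open>exp (Re z * s)\<close>, which is just
  too fast. The flow of the generalized eigenvector contains \<open>s\<close> times the flow of the
  eigenvector, so subtracting its multiple by \<open>1 / s\<close> cancels the leading term and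
  gains a factor \<open>1 / s\<close>, while \<open>w s\<close> still tends to the eigenvector
  direction.\<close>

lemma flow_jordan_pair:
  fixes A :: "real^'n^'n"
  assumes c1: "\<And>i. (\<Sum>l\<in>UNIV. of_real (A $ i $ l) * c1 l) = z * c1 i" and ne: "c1 i0 \<noteq> 0"
    and c2: "\<And>i. (\<Sum>l\<in>UNIV. of_real (A $ i $ l) * c2 l) = z * c2 i + c1 i"
  obtains w w0 where "(w \<longlongrightarrow> w0) at_top" "w0 \<noteq> 0" "((\<lambda>s. norm (flow A s (w s)) * exp (- (Re z * s))) \<longlongrightarrow> 0) at_top"
proof -
  obtain u where u: "u \<noteq> 0" "re_vec (\<lambda>i. u * c1 i) \<noteq> 0" using re_vec_nonzero_rotation[of c1 i0, OF ne] .
  define d1 where "d1 i = u * c1 i" for i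
  define d2 where "d2 i = u * c2 i" for i
  have "(\<Sum>l\<in>UNIV. of_real (A $ i $ l) * d1 l) = z * d1 i + 0" for i
  proof -
    have "(\<Sum>l\<in>UNIV. of_real (A $ i $ l) * d1 l) = u * (\<Sum>l\<in>UNIV. of_real (A $ i $ l) * c1 l)"
      by (simp add: d1_def sum_distrib_left mult_ac)
    then show ?thesis by (simp add: c1 d1_def)
  qed
  note m1 = re_im_vec_mult[OF this]
  have "(\<Sum>l\<in>UNIV. of_real (A $ i $ l) * d2 l) = z * d2 i + d1 i" for i
  proof -
    have "(\<Sum>l\<in>UNIV. of_real (A $ i $ l) * d2 l) = u * (\<Sum>l\<in>UNIV. of_real (A $ i $ l) * c2 l)"
      by (simp add: d2_def sum_distrib_left mult_ac)
    also have "\<dots> = z * d2 i + d1 i" unfolding c2 by (simp add: d1_def d2_def algebra_simps)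
    finally show ?thesis .
  qed
  note m2 = re_im_vec_mult[OF this]
  have z: "re_vec (\<lambda>_. 0) = 0" "im_vec (\<lambda>_. 0) = 0"
    by (simp_all add: re_vec_def im_vec_def Finite_Cartesian_Product.vec_eq_iff)
  let ?x1 = "re_vec d1" and ?y1 = "im_vec d1" and ?x2 = "re_vec d2" and ?y2 = "im_vec d2"
  have f1: "flow A t ?x1 = exp (Re z * t) *\<^sub>R (cos (Im z * t) *\<^sub>R (?x1 + t *\<^sub>R 0) - sin (Im z * t) *\<^sub>R (?y1 + t *\<^sub>R 0))" for t
    by (rule flow_generalized_eigenvector) (use m1 z in auto)
  have f2: "flow A t ?x2 = exp (Re z * t) *\<^sub>R (cos (Im z * t) *\<^sub>R (?x2 + t *\<^sub>R ?x1) - sin (Im z * t) *\<^sub>R (?y2 + t *\<^sub>R ?y1))" for t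
    by (rule flow_generalized_eigenvector) (use m1 m2 z in auto)
  define w where "w s = ?x1 - (1 / s) *\<^sub>R ?x2" for s :: real
  have inv: "((\<lambda>s::real. 1 / s) \<longlongrightarrow> 0) at_top"
    using tendsto_inverse_0_at_top[OF filterlim_ident] by (simp add: divide_inverse)
  have "(w \<longlongrightarrow> ?x1 - 0 *\<^sub>R ?x2) at_top"
    unfolding w_def by (intro tendsto_intros inv)
  moreover have "?x1 \<noteq> 0" using u by (simp add: d1_def[abs_def])
  moreover have "((\<lambda>s. norm (flow A s (w s)) * exp (- (Re z * s))) \<longlongrightarrow> 0) at_top"
  proof (rule Lim_null_comparison)
    show "eventually (\<lambda>s. norm (norm (flow A s (w s)) * exp (- (Re z * s))) \<le> (1 / s) * (norm ?x2 + norm ?y2)) at_top"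
      using eventually_gt_at_top[of 0]
    proof eventually_elim
      case (elim s)
      have "flow A s (w s) = flow A s ?x1 - (1 / s) *\<^sub>R flow A s ?x2"
        using linear_flow[of A s] by (simp add: w_def linear_diff linear_scale)
      also have "\<dots> = - ((1 / s) * exp (Re z * s)) *\<^sub>R (cos (Im z * s) *\<^sub>R ?x2 - sin (Im z * s) *\<^sub>R ?y2)"
        unfolding f1 f2 using elim by (simp add: algebra_simps)
      finally have "norm (flow A s (w s)) = (1 / s) * exp (Re z * s) * norm (cos (Im z * s) *\<^sub>R ?x2 - sin (Im z * s) *\<^sub>R ?y2)"
        using elim by simp
      moreover have "norm (cos (Im z * s) *\<^sub>R ?x2 - sin (Im z * s) *\<^sub>R ?y2) \<le> norm ?x2 + norm ?y2"
      proof -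
        have "norm (cos (Im z * s) *\<^sub>R ?x2 - sin (Im z * s) *\<^sub>R ?y2) \<le> \<bar>cos (Im z * s)\<bar> * norm ?x2 + \<bar>sin (Im z * s)\<bar> * norm ?y2"
          using norm_triangle_ineq4[of "cos (Im z * s) *\<^sub>R ?x2" "sin (Im z * s) *\<^sub>R ?y2"] by simp
        also have "\<dots> \<le> 1 * norm ?x2 + 1 * norm ?y2" by (intro add_mono mult_right_mono) auto
        finally show ?thesis by simp
      qed
      ultimately have "norm (flow A s (w s)) \<le> (1 / s) * exp (Re z * s) * (norm ?x2 + norm ?y2)"
        using elim by (simp add: divide_right_mono mult_left_mono)
      then have "norm (flow A s (w s)) * exp (- (Re z * s)) \<le> (1 / s) * exp (Re z * s) * (norm ?x2 + norm ?y2) * exp (- (Re z * s))"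
        by (intro mult_right_mono) auto
      also have "\<dots> = (1 / s) * (norm ?x2 + norm ?y2) * (exp (Re z * s) * exp (- (Re z * s)))" by simp
      finally show ?case by (simp add: exp_minus)
    qed
    show "((\<lambda>s. (1 / s) * (norm ?x2 + norm ?y2)) \<longlongrightarrow> 0) at_top"
      using tendsto_mult[OF inv tendsto_const] by simp
  qed
  ultimately show ?thesis using that[of w ?x1] by simp
qed

text \<open>The first column of a block yields an eigenvector, the second a generalized one, and the
  last row, at index \<open>p + k - 1\<close>, a left eigenvector.\<close>

lemma jordan_matrix_block:
  assumes "(k, z) \<in> set cs" "k > 0"
  shows "\<exists>p. p + k \<le> sum_list (map fst cs) \<and>
    (\<forall>i<sum_list (map fst cs). jordan_matrix cs $$ (i, p) = (if i = p then z else 0)) \<and>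
    (k \<ge> 2 \<longrightarrow> (\<forall>i<sum_list (map fst cs). jordan_matrix cs $$ (i, Suc p) = (if i = Suc p then z else if i = p then 1 else 0))) \<and>
    (\<forall>j<sum_list (map fst cs). jordan_matrix cs $$ (p + k - 1, j) = (if j = p + k - 1 then z else 0))"
  using assms(1)
proof (induction cs)
  case Nil
  then show ?case by simp
next
  case (Cons c cs)
  obtain m a where c: "c = (m, a)" by force
  let ?N = "sum_list (map fst cs)"
  show ?case
  proof (cases "(k, z) = c")
    case True
    then have "m = k" "a = z" using c by auto
    then show ?thesis unfolding c jordan_matrix_Cons
      using assms(2) by (intro exI[of _ 0]) auto
  next
    case False
    then obtain p where p: "p + k \<le> ?N"
      "\<And>i. i < ?N \<Longrightarrow> jordan_matrix cs $$ (i, p) = (if i = p then z else 0)"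
      "\<And>i. k \<ge> 2 \<Longrightarrow> i < ?N \<Longrightarrow> jordan_matrix cs $$ (i, Suc p) = (if i = Suc p then z else if i = p then 1 else 0)"
      "\<And>j. j < ?N \<Longrightarrow> jordan_matrix cs $$ (p + k - 1, j) = (if j = p + k - 1 then z else 0)"
      using Cons by auto
    let ?J = "jordan_matrix (c # cs)"
    have J1: "?J $$ (m + i, m + j) = jordan_matrix cs $$ (i, j)" if "i < ?N" "j < ?N" for i j
      using that unfolding c jordan_matrix_Cons by simp
    have J2: "?J $$ (i, m + j) = 0" "?J $$ (m + j, i) = 0" if "i < m" "j < ?N" for i j
      using that unfolding c jordan_matrix_Cons by simp_all
    have N: "sum_list (map fst (c # cs)) = m + ?N" by (simp add: c)
    have split: "i < m \<or> (\<exists>i'. i = m + i' \<and> i' < ?N)" if "i < m + ?N" for i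
      using that by (metis add_diff_inverse_nat nat_add_left_cancel_less)
    show ?thesis unfolding N
    proof (intro exI[of _ "m + p"] conjI allI impI)
      show "m + p + k \<le> m + ?N" using p(1) by simp
      fix i assume i: "i < m + ?N"
      have pN: "p < ?N" using p(1) assms(2) by simp
      show "?J $$ (i, m + p) = (if i = m + p then z else 0)"
        using split[OF i] J1[OF _ pN] J2(1)[OF _ pN] p(2) by auto
      have q: "m + p + k - 1 = m + (p + k - 1)" "p + k - 1 < ?N" using assms(2) p(1) by auto
      show "?J $$ (m + p + k - 1, i) = (if i = m + p + k - 1 then z else 0)"
        unfolding q(1) using split[OF i] J1[OF q(2)] J2(2)[OF _ q(2)] p(4) by auto
      assume k: "k \<ge> 2"
      then have sN: "Suc p < ?N" using p(1) by simp
      have s: "Suc (m + p) = m + Suc p" by simp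
      show "?J $$ (i, Suc (m + p)) = (if i = Suc (m + p) then z else if i = m + p then 1 else 0)"
        using split[OF i]
      proof (elim disjE exE conjE)
        assume "i < m"
        then show ?thesis unfolding s using J2(1)[OF _ sN] by simp
      next
        fix i' assume "i = m + i'" "i' < ?N"
        then show ?thesis unfolding s using J1[OF _ sN, of i'] p(3)[OF k, of i'] by (simp del: add_Suc_right)
      qed
    qed
  qed
qed

lemma jordan_matrix_scalar:
  fixes c :: "'a :: semiring_1"
  assumes "\<And>b. b \<in> set bs \<Longrightarrow> b = (1, c)"
  shows "jordan_matrix bs = c \<cdot>\<^sub>m 1\<^sub>m (length bs)"
  using assms
proof (induction bs)
  case Nil
  show ?case by (rule eq_matI) auto
next
  case (Cons b bs)
  then have b: "b = (1, c)" and IH: "jordan_matrix bs = c \<cdot>\<^sub>m 1\<^sub>m (length bs)" by auto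
  have len: "sum_list (map fst bs) = length bs"
    using arg_cong[OF IH, of dim_row] by simp
  show ?case unfolding b jordan_matrix_Cons IH len
    by (rule eq_matI) (auto simp: jordan_block_def)
qed

lemma eigenfunction_exists:
  fixes A :: "real^'n^'n"
  assumes "z \<in> spectrum (cmat_of A)"
  obtains c :: "'n \<Rightarrow> complex" and i0 where "c i0 \<noteq> 0"
    "\<And>i. (\<Sum>l\<in>UNIV. of_real (A $ i $ l) * c l) = z * c i"
proof -
  let ?n = "CARD('n)"
  let ?s = "from_nat_into (UNIV :: 'n set)"
  obtain v where v: "v \<in> carrier_vec ?n" "v \<noteq> 0\<^sub>v ?n" "cmat_of A *\<^sub>v v = z \<cdot>\<^sub>v v"
    using assms unfolding spectrum_def eigenvalue_def eigenvector_def by (auto simp: cmat_of_def)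
  define t where "t = inv_into {..<?n} ?s"
  have ts: "t (?s k) = k" if "k < ?n" for k
    unfolding t_def using that bij_betw_inv_into_left[OF enum_bij] by auto
  have tn: "t i < ?n" and st: "?s (t i) = i" for i
    using bij_betw_inv_into_right[OF enum_bij, of i] bij_betwE[OF bij_betw_inv_into[OF enum_bij]]
    by (auto simp: t_def)
  have reindex: "(\<Sum>l\<in>UNIV. f l) = (\<Sum>k<?n. f (?s k))" for f :: "'n \<Rightarrow> complex"
    using sum.reindex_bij_betw[OF enum_bij, of f] by simp
  define c where "c i = vec_index v (t i)" for i
  have "\<exists>k<?n. vec_index v k \<noteq> 0"
  proof (rule ccontr)
    assume "\<not> ?thesis"
    then have "v = 0\<^sub>v ?n" using v(1) by (intro eq_vecI) auto
    then show False using v(2) by simp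
  qed
  then obtain k where k: "k < ?n" "vec_index v k \<noteq> 0" by blast
  have "c (?s k) \<noteq> 0" using k by (simp add: c_def ts)
  moreover have "(\<Sum>l\<in>UNIV. of_real (A $ i $ l) * c l) = z * c i" for i
  proof -
    have "(\<Sum>l\<in>UNIV. of_real (A $ i $ l) * c l) = vec_index (cmat_of A *\<^sub>v v) (t i)"
      unfolding reindex using v(1) tn[of i]
      by (simp add: scalar_prod_def cmat_of_def atLeast0LessThan c_def ts st)
    also have "\<dots> = z * c i" unfolding v(3) using v(1) tn[of i] by (simp add: c_def)
    finally show ?thesis .
  qed
  ultimately show ?thesis using that by blast
qed

lemma left_eigenfunctional:
  fixes A :: "real^'n^'n" and r :: "'n \<Rightarrow> complex"
  assumes "\<And>l. (\<Sum>m\<in>UNIV. r m * of_real (A $ m $ l)) = z * r l" "r m0 \<noteq> 0"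
  obtains phi :: "real^'n \<Rightarrow> real" and x1 C where "linear phi" "phi x1 \<noteq> 0"
    "\<And>t x. \<bar>phi (flow A t x)\<bar> \<le> C * exp (Re z * t) * norm x"
proof -
  obtain C where C: "C > 0" "\<And>x. norm (cfunctional r x) \<le> C * norm x"
    using cfunctional_bound by blast
  have bound: "norm (cfunctional r (flow A t x)) \<le> C * exp (Re z * t) * norm x" for t x
  proof -
    have "norm (cfunctional r (flow A t x)) = exp (Re z * t) * norm (cfunctional r x)"
      by (rule cfunctional_eigen) (rule assms(1))
    also have "\<dots> \<le> exp (Re z * t) * (C * norm x)" by (intro mult_left_mono C) auto
    finally show ?thesis by (simp add: mult_ac)
  qed
  have ax: "cfunctional r (axis m0 1) = r m0" by (rule cfunctional_axis)
  show ?thesis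
  proof (cases "Re (r m0) = 0")
    case False
    have "linear (\<lambda>x. Re (cfunctional r x))"
      using linear_compose[OF linear_cfunctional bounded_linear.linear[OF bounded_linear_Re]] by (simp add: comp_def)
    moreover have "\<bar>Re (cfunctional r (flow A t x))\<bar> \<le> C * exp (Re z * t) * norm x" for t x
      using abs_Re_le_cmod bound order_trans by blast
    ultimately show ?thesis using that[of "\<lambda>x. Re (cfunctional r x)" "axis m0 1" C] False ax by simp
  next
    case True
    then have "Im (r m0) \<noteq> 0" using assms(2) by (simp add: complex_eq_iff)
    have "linear (\<lambda>x. Im (cfunctional r x))"
      using linear_compose[OF linear_cfunctional bounded_linear.linear[OF bounded_linear_Im]] by (simp add: comp_def)
    moreover have "\<bar>Im (cfunctional r (flow A t x))\<bar> \<le> C * exp (Re z * t) * norm x" for t x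
      using abs_Im_le_cmod bound order_trans by blast
    ultimately show ?thesis using that[of "\<lambda>x. Im (cfunctional r x)" "axis m0 1" C] \<open>Im (r m0) \<noteq> 0\<close> ax by simp
  qed
qed

text \<open>A block of size at least two supplies \<open>phi\<close> by its last row and
  \<open>w\<close> by \<open>flow_jordan_pair\<close>. Without such blocks the matrix is
  diagonalizable over the complex numbers and has two different real parts: the larger supplies
  \<open>phi\<close>, and an eigenvector for the smaller serves as a constant
  \<open>w\<close>.\<close>

lemma splitting_data:
  fixes A :: "real^'n^'n"
  assumes J: "real_part_jordan_form A J" "\<not> (\<exists>c. J = c \<cdot>\<^sub>m 1\<^sub>m CARD('n))"
  obtains b phi x1 C w w0 where "b \<in> eigenvalue_re_parts A" "linear phi" "phi x1 \<noteq> (0::real)"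
    "\<And>t x. \<bar>phi (flow A t x)\<bar> \<le> C * exp (b * t) * norm x"
    "(w \<longlongrightarrow> w0) at_top" "w0 \<noteq> 0" "((\<lambda>s. norm (flow A s (w s)) * exp (- (b * s))) \<longlongrightarrow> 0) at_top"
proof -
  let ?n = "CARD('n)"
  obtain cs bs where cs: "jordan_nf (cmat_of A) cs" and bs: "mset bs = mset (map (\<lambda>(k, z). (k, Re z)) cs)"
    and Jbs: "J = jordan_matrix bs"
    using J(1) unfolding real_part_jordan_form_def by blast
  define U where "U = jordan_matrix cs"
  have sim: "similar_mat (cmat_of A) U" and nz: "0 \<notin> fst ` set cs"
    using cs unfolding jordan_nf_def U_def by auto
  have len: "sum_list (map fst cs) = ?n"
  proof -
    obtain P Q where wit: "similar_mat_wit (cmat_of A) U P Q" using sim unfolding similar_mat_def by blast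
    have "U \<in> carrier_mat ?n ?n" using similar_mat_witD2(5)[OF cmat_of_carrier wit] .
    then show ?thesis unfolding U_def by auto
  qed
  have U: "U \<in> carrier_mat ?n ?n" unfolding U_def using jordan_matrix_carrier[of cs] len by simp
  have Uut: "upper_triangular U" using jordan_matrix_upper_triangular[of _ cs] by (auto simp: U_def)
  obtain p q :: "nat \<Rightarrow> 'n \<Rightarrow> complex" where
    p: "\<And>i j. j < ?n \<Longrightarrow> (\<Sum>l\<in>UNIV. of_real (A $ i $ l) * p j l) = (\<Sum>k<?n. p k i * U $$ (k, j))"
    and q: "\<And>i l. i < ?n \<Longrightarrow> (\<Sum>m\<in>UNIV. q i m * of_real (A $ m $ l)) = (\<Sum>k<?n. U $$ (i, k) * q k l)"
    and qp: "\<And>i j. i < ?n \<Longrightarrow> j < ?n \<Longrightarrow> (\<Sum>m\<in>UNIV. q i m * p j m) = (if i = j then 1 else 0)"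
    by (rule similar_functions[OF sim]) (rule that)
  have pnz: "\<exists>m. p i m \<noteq> 0" if "i < ?n" for i
  proof (rule ccontr)
    assume "\<not> ?thesis"
    then have "(\<Sum>m\<in>UNIV. q i m * p i m) = 0" by simp
    then show False using qp[OF that that] by simp
  qed
  have qnz: "\<exists>m. q i m \<noteq> 0" if "i < ?n" for i
  proof (rule ccontr)
    assume "\<not> ?thesis"
    then have "(\<Sum>m\<in>UNIV. q i m * p i m) = 0" by simp
    then show False using qp[OF that that] by simp
  qed
  have block: "\<exists>P e. P + k \<le> ?n \<and> e < ?n \<and> z \<in> spectrum (cmat_of A) \<and>
     (\<forall>i. (\<Sum>l\<in>UNIV. of_real (A $ i $ l) * p P l) = z * p P i) \<and>
     (k \<ge> 2 \<longrightarrow> (\<forall>i. (\<Sum>l\<in>UNIV. of_real (A $ i $ l) * p (Suc P) l) = z * p (Suc P) i + p P i)) \<and>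
     (\<forall>l. (\<Sum>m\<in>UNIV. q e m * of_real (A $ m $ l)) = z * q e l)"
    if kz: "(k, z) \<in> set cs" for k z
  proof -
    have k: "k > 0" using kz nz by (metis fst_conv gr0I image_eqI)
    obtain P where P0: "P + k \<le> ?n"
      "\<And>i. i < ?n \<Longrightarrow> U $$ (i, P) = (if i = P then z else 0)"
      "\<And>i. k \<ge> 2 \<Longrightarrow> i < ?n \<Longrightarrow> U $$ (i, Suc P) = (if i = Suc P then z else if i = P then 1 else 0)"
      "\<And>j. j < ?n \<Longrightarrow> U $$ (P + k - 1, j) = (if j = P + k - 1 then z else 0)"
      using jordan_matrix_block[OF kz k] unfolding len U_def by auto
    define e where "e = P + k - 1"
    note P = P0(1-3) P0(4)[folded e_def]
    have Pn: "P < ?n" "e < ?n" using P(1) k by (auto simp: e_def)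
    have "z \<in> spectrum (cmat_of A)"
      using diag_in_spectrum[OF sim U Uut Pn(1)] P(2)[OF Pn(1)] by simp
    moreover have "(\<Sum>l\<in>UNIV. of_real (A $ i $ l) * p P l) = z * p P i" for i
    proof -
      have "(\<Sum>k<?n. p k i * U $$ (k, P)) = (\<Sum>k<?n. if k = P then z * p P i else 0)"
        by (intro sum.cong) (auto simp: P(2))
      then show ?thesis using p[OF Pn(1), of i] Pn(1) by simp
    qed
    moreover have "(\<Sum>l\<in>UNIV. of_real (A $ i $ l) * p (Suc P) l) = z * p (Suc P) i + p P i" if k2: "k \<ge> 2" for i
    proof -
      have S: "Suc P < ?n" using P(1) k2 by simp
      have "(\<Sum>k<?n. p k i * U $$ (k, Suc P)) = (\<Sum>k<?n. (if k = Suc P then z * p (Suc P) i else 0) + (if k = P then p P i else 0))"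
        by (intro sum.cong) (auto simp: P(3)[OF k2])
      also have "\<dots> = z * p (Suc P) i + p P i" using S by (simp add: sum.distrib)
      finally show ?thesis using p[OF S, of i] by simp
    qed
    moreover have "(\<Sum>m\<in>UNIV. q e m * of_real (A $ m $ l)) = z * q e l" for l
    proof -
      have "(\<Sum>j<?n. U $$ (e, j) * q j l) = (\<Sum>j<?n. if j = e then z * q e l else 0)"
        by (intro sum.cong) (auto simp: P(4))
      then show ?thesis using q[OF Pn(2), of l] Pn(2) by simp
    qed
    ultimately show ?thesis using P(1) Pn(2) by (intro exI[of _ P] exI[of _ e] conjI allI impI)
  qed
  show ?thesis
  proof (cases "\<exists>k z. (k, z) \<in> set cs \<and> k \<ge> 2")
    case True
    then obtain k z where kz: "(k, z) \<in> set cs" "k \<ge> 2" by blast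
    obtain P e where P: "P + k \<le> ?n" "z \<in> spectrum (cmat_of A)"
     "\<And>i. (\<Sum>l\<in>UNIV. of_real (A $ i $ l) * p P l) = z * p P i"
     "\<And>i. (\<Sum>l\<in>UNIV. of_real (A $ i $ l) * p (Suc P) l) = z * p (Suc P) i + p P i"
     "\<And>l. (\<Sum>m\<in>UNIV. q e m * of_real (A $ m $ l)) = z * q e l" "e < ?n"
      using block[OF kz(1)] kz(2) by blast
    obtain m0 where m0: "p P m0 \<noteq> 0" using pnz[of P] P(1) kz(2) by auto
    obtain m1 where m1: "q e m1 \<noteq> 0" using qnz[OF P(6)] by blast
    obtain w w0 where w: "(w \<longlongrightarrow> w0) at_top" "w0 \<noteq> 0" "((\<lambda>s. norm (flow A s (w s)) * exp (- (Re z * s))) \<longlongrightarrow> 0) at_top"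
      by (rule flow_jordan_pair[of A "p P" z m0 "p (Suc P)", OF P(3) m0 P(4)]) (rule that)
    obtain phi x1 C where phi: "linear phi" "phi x1 \<noteq> (0::real)" "\<And>t x. \<bar>phi (flow A t x)\<bar> \<le> C * exp (Re z * t) * norm x"
      by (rule left_eigenfunctional[of "q e" A z m1, OF P(5) m1]) (rule that)
    have "Re z \<in> eigenvalue_re_parts A" using P(2) by (simp add: eigenvalue_re_parts_def)
    from that[OF this phi w] show ?thesis .
  next
    case False
    have one: "k = 1" if "(k, z) \<in> set cs" for k z
    proof -
      have "k \<noteq> 0" using that nz by (metis fst_conv image_eqI)
      moreover have "\<not> k \<ge> 2" using False that by blast
      ultimately show ?thesis by simp
    qed
    \<comment> \<open>If all real parts agreed, every entry of \<open>bs\<close> would be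
      \<open>(1, Re z0)\<close> and \<open>J\<close> would be scalar, in whatever order the blocks
      stand.\<close>
    have "\<exists>z z'. (1, z) \<in> set cs \<and> (1, z') \<in> set cs \<and> Re z < Re z'"
    proof (rule ccontr)
      assume no: "\<not> ?thesis"
      have "cs \<noteq> []" using len by auto
      then obtain k0 z0 where "(k0, z0) \<in> set cs" by (metis list.set_intros(1) neq_Nil_conv surj_pair)
      then have z0: "(1, z0) \<in> set cs" using one by metis
      have "b = (1, Re z0)" if "b \<in> set bs" for b
      proof -
        have "b \<in> set (map (\<lambda>(k, z). (k, Re z)) cs)" using that bs by (metis set_mset_mset)
        then obtain k z where kz: "(k, z) \<in> set cs" "b = (k, Re z)" by auto
        have "k = 1" using one[OF kz(1)] .
        then have "\<not> Re z < Re z0" "\<not> Re z0 < Re z" using no z0 kz(1) by blast+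
        then show ?thesis using kz(2) \<open>k = 1\<close> by simp
      qed
      then have "jordan_matrix bs = Re z0 \<cdot>\<^sub>m 1\<^sub>m (length bs)" by (rule jordan_matrix_scalar)
      moreover have "length bs = ?n"
      proof -
        have "length bs = length cs" using arg_cong[OF bs, of size] by simp
        also have "\<dots> = sum_list (map fst cs)"
        proof -
          have "map fst cs = map (\<lambda>_. 1) cs" using one by (intro map_cong) auto
          then have "sum_list (map fst cs) = sum_list (map (\<lambda>_. 1) cs)" by (rule arg_cong)
          then show ?thesis by (simp only: sum_list_triv) simp
        qed
        finally show ?thesis using len by simp
      qed
      ultimately show False using J(2) Jbs by auto
    qed
    then obtain z z' where z: "(1, z) \<in> set cs" "(1, z') \<in> set cs" "Re z < Re z'" by blast
    obtain P where P: "P + 1 \<le> ?n" "\<And>i. (\<Sum>l\<in>UNIV. of_real (A $ i $ l) * p P l) = z * p P i"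
      using block[OF z(1)] by blast
    obtain e' where P': "e' < ?n" "z' \<in> spectrum (cmat_of A)"
      "\<And>l. (\<Sum>m\<in>UNIV. q e' m * of_real (A $ m $ l)) = z' * q e' l"
      using block[OF z(2)] by blast
    obtain m0 where m0: "p P m0 \<noteq> 0" using pnz[of P] P(1) by auto
    obtain m1 where m1: "q e' m1 \<noteq> 0" using qnz[OF P'(1)] by blast
    obtain v C' where v: "v \<noteq> 0" "\<And>t. norm (flow A t v) \<le> C' * exp (Re z * t)"
      by (rule flow_eigenvector[of A "p P" z m0, OF P(2) m0]) (rule that)
    obtain phi x1 C where phi: "linear phi" "phi x1 \<noteq> (0::real)" "\<And>t x. \<bar>phi (flow A t x)\<bar> \<le> C * exp (Re z' * t) * norm x"
      by (rule left_eigenfunctional[of "q e'" A z' m1, OF P'(3) m1]) (rule that)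
    have re: "Re z' \<in> eigenvalue_re_parts A" using P'(2) by (simp add: eigenvalue_re_parts_def)
    have "((\<lambda>s. norm (flow A s v) * exp (- (Re z' * s))) \<longlongrightarrow> 0) at_top"
    proof (rule Lim_null_comparison)
      show "eventually (\<lambda>s. norm (norm (flow A s v) * exp (- (Re z' * s))) \<le> C' * exp ((Re z' - Re z) * (- s)) * 1) at_top"
      proof (rule always_eventually, rule allI)
        fix s
        have "norm (flow A s v) * exp (- (Re z' * s)) \<le> C' * exp (Re z * s) * exp (- (Re z' * s))"
          by (intro mult_right_mono v) auto
        also have "\<dots> = C' * exp ((Re z' - Re z) * (- s))"
          by (simp add: algebra_simps flip: exp_add)
        finally show "norm (norm (flow A s v) * exp (- (Re z' * s))) \<le> C' * exp ((Re z' - Re z) * (- s)) * 1" by simp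
      qed
      show "((\<lambda>s. C' * exp ((Re z' - Re z) * (- s)) * 1) \<longlongrightarrow> 0) at_top"
        by (rule exp_decay_tendsto) (use z(3) in simp)
    qed
    from that[OF re phi tendsto_const v(1) this] show ?thesis .
  qed
qed

section \<open>The visual quasimetric\<close>

text \<open>
  HOL-Analysis states the determinant formula for the Lebesgue measure of a linear image only for
  index types of class \<open>wellorder\<close>; the statement is transported to such an index type.
\<close>

typedef 'a wo = "UNIV :: 'a set" by auto

instantiation wo :: (finite) wellorder
begin

definition less_eq_wo :: "'a wo \<Rightarrow> 'a wo \<Rightarrow> bool" where
  "less_eq_wo x y \<longleftrightarrow> to_nat_on (UNIV :: 'a set) (Rep_wo x) \<le> to_nat_on (UNIV :: 'a set) (Rep_wo y)"

definition less_wo :: "'a wo \<Rightarrow> 'a wo \<Rightarrow> bool" where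
  "less_wo x y \<longleftrightarrow> to_nat_on (UNIV :: 'a set) (Rep_wo x) < to_nat_on (UNIV :: 'a set) (Rep_wo y)"

instance
proof
  fix x y z :: "'a wo"
  show "x < y \<longleftrightarrow> x \<le> y \<and> \<not> y \<le> x" by (auto simp: less_wo_def less_eq_wo_def)
  show "x \<le> x" by (simp add: less_eq_wo_def)
  show "x \<le> y \<Longrightarrow> y \<le> z \<Longrightarrow> x \<le> z" by (simp add: less_eq_wo_def)
  show "x \<le> y \<or> y \<le> x" by (auto simp: less_eq_wo_def)
  show "x \<le> y \<Longrightarrow> y \<le> x \<Longrightarrow> x = y"
    using inj_on_to_nat_on[OF countable_finite[OF finite[of "UNIV :: 'a set"]]]
    by (simp add: less_eq_wo_def inj_on_def Rep_wo_inject)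
next
  fix P :: "'a wo \<Rightarrow> bool" and a :: "'a wo"
  assume step: "\<And>x. (\<And>y. y < x \<Longrightarrow> P y) \<Longrightarrow> P x"
  show "P a"
  proof (induction a rule: measure_induct_rule[of "\<lambda>x. to_nat_on (UNIV :: 'a set) (Rep_wo x)"])
    case (less x)
    show ?case by (rule step) (rule less.IH, simp only: less_wo_def)
  qed
qed

end

instance wo :: (finite) finite
proof
  have "(UNIV :: 'a wo set) = range Abs_wo" by (metis Rep_wo_inverse surjI)
  then show "finite (UNIV :: 'a wo set)" by (metis finite finite_imageI)
qed

definition to_wo :: "real^'n \<Rightarrow> real^('n::finite) wo" where "to_wo x = (\<chi> i. x $ (Rep_wo i))"
definition of_wo :: "real^('n::finite) wo \<Rightarrow> real^'n" where "of_wo y = (\<chi> i. y $ (Abs_wo i))"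

lemma of_to_wo [simp]: "of_wo (to_wo x) = x" "to_wo (of_wo y) = y"
  by (simp_all add: of_wo_def to_wo_def Finite_Cartesian_Product.vec_eq_iff Abs_wo_inverse Rep_wo_inverse)

lemma linear_wo: "linear to_wo" "linear of_wo"
  by (auto intro!: linearI simp: of_wo_def to_wo_def Finite_Cartesian_Product.vec_eq_iff)

lemma norm_wo [simp]: "norm (of_wo y) = norm y" "norm (to_wo x) = norm x"
proof -
  have bij: "bij (Rep_wo :: 'n wo \<Rightarrow> 'n)"
    by (metis Abs_wo_inverse Rep_wo_inverse UNIV_I bij_betw_def injI surjI)
  have *: "norm (to_wo x) = norm x" for x :: "real^'n"
    unfolding norm_vec_def L2_set_def to_wo_def
    using sum.reindex_bij_betw[OF bij, of "\<lambda>i. (norm (x $ i))\<^sup>2"] by simp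
  then show "norm (to_wo x) = norm x" .
  show "norm (of_wo y) = norm y" using *[of "of_wo y"] by simp
qed

lemma wo_diff [simp]: "of_wo (x - y) = of_wo x - of_wo y" "to_wo (a - b) = to_wo a - to_wo b"
  by (simp_all add: linear_diff[OF linear_wo(1)] linear_diff[OF linear_wo(2)])

section \<open>The gauge of an admissible metric\<close>

lemma identity_norm_props:
  fixes g :: "(real^'n) \<times> real \<Rightarrow> (real^'n) \<times> real \<Rightarrow> (real^'n) \<times> real \<Rightarrow> real"
  assumes g: "inner_product_form (g (0, 0))"
  shows "continuous_on UNIV (identity_norm g)" (is ?cont)
    and "identity_norm g (c *\<^sub>R x) = \<bar>c\<bar> * identity_norm g x" (is ?scale)
    and "\<exists>l>0. \<exists>u>0. \<forall>x. l * norm x \<le> identity_norm g x \<and> identity_norm g x \<le> u * norm x"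
proof -
  let ?N = "identity_norm g"
  let ?g = "g (0, 0)"
  have bil: "bounded_bilinear ?g" and pos: "\<And>v. v \<noteq> 0 \<Longrightarrow> ?g v v > 0"
    using g unfolding inner_product_form_def by (auto simp: bilinear_conv_bounded_bilinear)
  interpret bounded_bilinear ?g by (rule bil)
  show cont: ?cont
    unfolding identity_norm_def[abs_def]
    by (intro continuous_intros continuous_on)
  have sc: "?N (c *\<^sub>R x) = \<bar>c\<bar> * ?N x" for c x
  proof -
    have "(c *\<^sub>R x, 0 :: real) = c *\<^sub>R (x, 0)" by simp
    then have "?g (c *\<^sub>R x, 0) (c *\<^sub>R x, 0) = c\<^sup>2 * ?g (x, 0) (x, 0)"
      by (simp only: scaleR_left scaleR_right) (simp add: power2_eq_square)
    then show ?thesis by (simp add: identity_norm_def real_sqrt_mult)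
  qed
  then show ?scale .
  have ne: "sphere (0 :: real^'n) 1 \<noteq> {}" by simp
  have co: "continuous_on (sphere 0 1) ?N" using cont continuous_on_subset by blast
  obtain a where a: "a \<in> sphere 0 1" "\<And>x. x \<in> sphere 0 1 \<Longrightarrow> ?N a \<le> ?N x"
    using continuous_attains_inf[OF compact_sphere ne co] by blast
  obtain b where b: "b \<in> sphere 0 1" "\<And>x. x \<in> sphere 0 1 \<Longrightarrow> ?N x \<le> ?N b"
    using continuous_attains_sup[OF compact_sphere ne co] by blast
  have "a \<noteq> 0" using a(1) by auto
  then have "(a, 0 :: real) \<noteq> 0" by (simp add: zero_prod_def)
  then have la: "?N a > 0" using pos unfolding identity_norm_def by simp
  have "?N a * norm x \<le> ?N x \<and> ?N x \<le> ?N b * norm x" for x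
  proof (cases "x = 0")
    case True
    then show ?thesis using sc[of 0 x] by simp
  next
    case False
    define y where "y = x /\<^sub>R norm x"
    have y: "y \<in> sphere 0 1" using False by (simp add: y_def)
    have "x = norm x *\<^sub>R y" using False by (simp add: y_def)
    then have "?N x = norm x * ?N y" using sc[of "norm x" y] by simp
    then show ?thesis using a(2)[OF y] b(2)[OF y] False by (simp add: mult.commute)
  qed
  moreover have "?N b > 0" using la b(2)[OF a(1)] by simp
  ultimately show "\<exists>l>0. \<exists>u>0. \<forall>x. l * norm x \<le> ?N x \<and> ?N x \<le> u * norm x" using la by blast
qed

definition visual_gauge where
  "visual_gauge A g v = visual_qmetric A g v 0"

lemma visual_qmetric_gauge: "visual_qmetric A g x y = visual_gauge A g (x - y)"
  by (simp add: visual_qmetric_def visual_gauge_def slice_dist_def)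

lemma visual_gauge_eq:
  "visual_gauge A g v = (if v = 0 then 0 else exp (LEAST t. identity_norm g (flow A (- t) v) = 1))"
  by (simp add: visual_qmetric_def visual_gauge_def slice_dist_def flow_def)

lemma flow_contract:
  fixes A :: "real^'n^'n"
  assumes pos: "\<forall>r\<in>eigenvalue_re_parts A. r > 0"
  shows "\<exists>C>0. \<exists>k>0. \<forall>t\<le>0. \<forall>x. norm (flow A t x) \<le> C * exp (k * t) * norm x"
proof -
  have fin: "finite (spectrum (cmat_of A))" by (rule card_finite_spectrum[OF cmat_of_carrier])
  have ne: "spectrum (cmat_of A) \<noteq> {}" by (rule spectrum_non_empty[OF cmat_of_carrier]) simp
  \<comment> \<open>Half the smallest real part is still positive and lies strictly below the
    spectrum, as \<open>flow_lower_bound\<close> requires.\<close>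
  define k where "k = Min (eigenvalue_re_parts A) / 2"
  have fin': "finite (eigenvalue_re_parts A)" "eigenvalue_re_parts A \<noteq> {}"
    using fin ne by (auto simp: eigenvalue_re_parts_def)
  then have mpos: "Min (eigenvalue_re_parts A) > 0" using pos Min_in by blast
  have "k < Re z" if "z \<in> spectrum (cmat_of A)" for z
  proof -
    have "Re z \<in> eigenvalue_re_parts A" using that by (simp add: eigenvalue_re_parts_def)
    then have "Min (eigenvalue_re_parts A) \<le> Re z" using fin' by simp
    then show ?thesis using mpos by (simp add: k_def)
  qed
  from flow_lower_bound[OF this] obtain C where C: "\<forall>t\<le>0. \<forall>y. norm (flow A t y) \<le> C * exp (k * t) * norm y"
    by blast
  have "norm (flow A t y) \<le> max C 1 * exp (k * t) * norm y" if "t \<le> 0" for t y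
    by (rule order_trans[OF C[rule_format, OF that]]) (intro mult_right_mono; simp)
  then show ?thesis using mpos by (intro exI[of _ "max C 1"] conjI exI[of _ k]) (auto simp: k_def)
qed

text \<open>A \<open>LEAST\<close> over the reals need not be attained. Here the solution set is
  nonempty by the intermediate value theorem, closed by continuity, and bounded below because the
  norm exceeds 1 for all sufficiently negative times; so it contains its infimum.\<close>

lemma visual_least:
  fixes A :: "real^'n^'n"
  assumes pos: "\<forall>r\<in>eigenvalue_re_parts A. r > 0" and g: "inner_product_form (g (0, 0))" and v: "v \<noteq> 0"
  shows "\<exists>t. identity_norm g (flow A (- t) v) = 1 \<and> (\<forall>s. identity_norm g (flow A (- s) v) = 1 \<longrightarrow> t \<le> s)"
proof -
  let ?N = "identity_norm g"
  obtain C k where C: "C > 0" "k > 0" "\<And>t x. t \<le> 0 \<Longrightarrow> norm (flow A t x) \<le> C * exp (k * t) * norm x"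
    using flow_contract[OF pos] by blast
  obtain l u where lu: "l > 0" "u > 0" "\<And>x. l * norm x \<le> ?N x" "\<And>x. ?N x \<le> u * norm x"
    using identity_norm_props(3)[of g, OF g] by blast
  have cflow: "continuous_on UNIV (\<lambda>t. flow A t x)" for x
    by (intro continuous_at_imp_continuous_on ballI has_vector_derivative_continuous[OF flow_deriv])
  have cont: "continuous_on S (\<lambda>t. ?N (flow A (- t) v))" for S
    by (intro continuous_on_compose2[OF identity_norm_props(1)[of g, OF g]]
        continuous_on_compose2[OF cflow] continuous_intros) auto
  have "((\<lambda>t. C * exp (k * (- t)) * norm v) \<longlongrightarrow> 0) at_top" by (rule exp_decay_tendsto[OF C(2)])
  then have "eventually (\<lambda>t. C * exp (k * (- t)) * norm v < 1 / u) at_top"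
    by (rule order_tendstoD) (use lu in simp)
  then have "eventually (\<lambda>t. C * exp (k * (- t)) * norm v < 1 / u \<and> t \<ge> 0) at_top"
    by (intro eventually_conj eventually_ge_at_top)
  then obtain t1 where t1: "C * exp (k * (- t1)) * norm v < 1 / u" "t1 \<ge> 0"
    using eventually_happens by fastforce
  have hi: "?N (flow A (- t1) v) \<le> 1"
  proof -
    have "?N (flow A (- t1) v) \<le> u * (C * exp (k * (- t1)) * norm v)"
      by (rule order_trans[OF lu(4)]) (use lu C(3)[of "- t1" v] t1 in \<open>intro mult_left_mono; simp\<close>)
    also have "\<dots> \<le> u * (1 / u)" using t1(1) lu(2) by (intro mult_left_mono) auto
    finally show ?thesis using lu(2) by simp
  qed
  have "((\<lambda>t. C * exp (k * (- t)) * 1) \<longlongrightarrow> 0) at_top" by (rule exp_decay_tendsto[OF C(2)])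
  then have "eventually (\<lambda>t. C * exp (k * (- t)) * 1 < l * norm v) at_top"
    by (rule order_tendstoD) (use lu v in simp)
  then have "eventually (\<lambda>t. C * exp (k * (- t)) * 1 < l * norm v \<and> t \<ge> 0) at_top"
    by (intro eventually_conj eventually_ge_at_top)
  then obtain t0 where t0: "C * exp (k * (- t0)) < l * norm v" "t0 \<ge> 0"
    using eventually_happens by fastforce
  have lo: "?N (flow A (- t) v) > 1" if "t \<le> - t0" for t
  proof -
    have "norm v = norm (flow A t (flow A (- t) v))" by (simp add: flow_inverse)
    also have "\<dots> \<le> C * exp (k * t) * norm (flow A (- t) v)" using that t0 by (intro C(3)) simp
    also have "\<dots> \<le> C * exp (k * (- t0)) * norm (flow A (- t) v)"
      using mult_left_mono[OF that, of k] C(1,2) by (intro mult_right_mono mult_left_mono) auto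
    finally have 1: "l * norm v \<le> (C * exp (k * (- t0))) * (l * norm (flow A (- t) v))"
      using mult_left_mono[of "norm v" _ l] lu(1) by (simp add: mult_ac)
    also have "\<dots> \<le> (C * exp (k * (- t0))) * ?N (flow A (- t) v)"
      using lu(3) C(1) by (intro mult_left_mono) auto
    finally have "C * exp (k * (- t0)) < (C * exp (k * (- t0))) * ?N (flow A (- t) v)" using t0(1) by linarith
    then show ?thesis using C(1) by (simp add: mult_less_cancel_left1)
  qed
  define Z where "Z = {t. ?N (flow A (- t) v) = 1}"
  have "\<exists>t\<ge>- t0. t \<le> t1 \<and> ?N (flow A (- t) v) = 1"
    by (rule IVT2'[OF hi less_imp_le[OF lo] _ cont]) (use t0 t1 in auto)
  then have ne: "Z \<noteq> {}" by (auto simp: Z_def)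
  have bdd: "bdd_below Z"
  proof (rule bdd_belowI[of _ "- t0"])
    fix x assume "x \<in> Z"
    then show "- t0 \<le> x" using lo[of x] by (cases "x \<le> - t0") (auto simp: Z_def)
  qed
  have "closed Z" unfolding Z_def by (intro closed_Collect_eq cont continuous_intros)
  then have "Inf Z \<in> Z" using closed_contains_Inf[OF ne bdd] by blast
  moreover have "Inf Z \<le> s" if "s \<in> Z" for s using cInf_lower[OF that bdd] .
  ultimately show ?thesis by (auto simp: Z_def)
qed

lemma visual_gauge_props:
  fixes A :: "real^'n^'n"
  assumes pos: "\<forall>r\<in>eigenvalue_re_parts A. r > 0" and g: "inner_product_form (g (0, 0))"
  shows "visual_gauge A g 0 = 0" "v \<noteq> 0 \<Longrightarrow> visual_gauge A g v > 0"
    "visual_gauge A g (- v) = visual_gauge A g v"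
    "visual_gauge A g (flow A t v) = exp t * visual_gauge A g v"
    "visual_gauge A g v = 1 \<Longrightarrow> identity_norm g v = 1"
proof -
  let ?N = "identity_norm g"
  show "visual_gauge A g 0 = 0" "v \<noteq> 0 \<Longrightarrow> visual_gauge A g v > 0" by (simp_all add: visual_gauge_eq)
  have "?N (- x) = ?N x" for x using identity_norm_props(2)[of g, OF g, of "- 1" x] by simp
  then show "visual_gauge A g (- v) = visual_gauge A g v"
    by (simp add: visual_gauge_eq linear_neg[OF linear_flow])
  have least: "?N (flow A (- (LEAST t. ?N (flow A (- t) v) = 1)) v) = 1"
    "?N (flow A (- s) v) = 1 \<Longrightarrow> (LEAST t. ?N (flow A (- t) v) = 1) \<le> s" if v: "v \<noteq> 0" for v s
  proof -
    obtain t where t: "?N (flow A (- t) v) = 1" "\<And>s. ?N (flow A (- s) v) = 1 \<Longrightarrow> t \<le> s"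
      using visual_least[of A g v, OF pos g v] by blast
    have "(LEAST t. ?N (flow A (- t) v) = 1) = t" using t by (intro Least_equality) auto
    then show "?N (flow A (- (LEAST t. ?N (flow A (- t) v) = 1)) v) = 1"
      "?N (flow A (- s) v) = 1 \<Longrightarrow> (LEAST t. ?N (flow A (- t) v) = 1) \<le> s" using t by auto
  qed
  show "visual_gauge A g (flow A t v) = exp t * visual_gauge A g v"
  proof (cases "v = 0")
    case True
    then show ?thesis by (simp add: visual_gauge_eq linear_0[OF linear_flow])
  next
    case False
    have inv: "flow A (- t) (flow A t v) = v" using flow_inverse[of A "- t" v] by simp
    then have nz: "flow A t v \<noteq> 0" using False by (auto simp: linear_0[OF linear_flow])
    have shift: "flow A (- s) (flow A t v) = flow A (- (s - t)) v" for s
      using flow_add[of A "- s" t v] by simp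
    \<comment> \<open>Flowing for time \<open>t\<close> shifts all solutions of the defining
      equation by \<open>t\<close>, hence also the least one.\<close>
    have "(LEAST s. ?N (flow A (- s) (flow A t v)) = 1) = t + (LEAST s. ?N (flow A (- s) v) = 1)"
    proof (rule Least_equality)
      show "?N (flow A (- (t + (LEAST s. ?N (flow A (- s) v) = 1))) (flow A t v)) = 1"
        unfolding shift using least(1)[OF False] by simp
      fix s assume "?N (flow A (- s) (flow A t v)) = 1"
      then have "?N (flow A (- (s - t)) v) = 1" unfolding shift .
      from least(2)[OF False this] show "t + (LEAST s. ?N (flow A (- s) v) = 1) \<le> s" by simp
    qed
    then show ?thesis using False nz by (simp add: visual_gauge_eq exp_add)
  qed
  show "?N v = 1" if "visual_gauge A g v = 1"
  proof -
    have v: "v \<noteq> 0" using that by (auto simp: visual_gauge_eq)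
    then have "(LEAST t. ?N (flow A (- t) v) = 1) = 0" using that by (simp add: visual_gauge_eq)
    then show ?thesis using least(1)[OF v] by simp
  qed
qed

lemma flow_dilation_space:
  fixes A :: "real^'n^'n"
  assumes pos: "\<forall>r\<in>eigenvalue_re_parts A. r > 0" and g: "inner_product_form (g (0, 0))"
  shows "dilation_space (\<lambda>t y. to_wo (flow A t (of_wo y))) (\<lambda>y. to_wo (A *v of_wo y)) (\<lambda>y. visual_gauge A g (of_wo y))"
proof (rule dilation_space.intro)
  have lin: "of_wo 0 = 0" "of_wo (- x) = - of_wo x" for x :: "real^'n wo"
    using linear_0[OF linear_wo(2)] linear_neg[OF linear_wo(2)] by auto
  show "linear (\<lambda>y. to_wo (flow A t (of_wo y)))" for t
    using linear_compose[OF linear_compose[OF linear_wo(2) linear_flow] linear_wo(1)] by (simp add: comp_def)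
  show "to_wo (flow A 0 (of_wo x)) = x" for x by simp
  show "to_wo (flow A (s + t) (of_wo x)) = to_wo (flow A s (of_wo (to_wo (flow A t (of_wo x)))))" for s t x
    by (simp add: flow_add)
  show "((\<lambda>t. to_wo (flow A t (of_wo x))) has_vector_derivative to_wo (A *v of_wo x)) (at 0)" for x
    using bounded_linear.has_vector_derivative[OF _ flow_deriv[of A "of_wo x" 0], of to_wo]
      linear_wo(1) linear_conv_bounded_linear by auto
  show "\<exists>C>0. \<exists>k>0. \<forall>t\<le>0. \<forall>x. norm (to_wo (flow A t (of_wo x))) \<le> C * exp (k * t) * norm x"
  proof -
    obtain C k where C: "C > 0" "k > 0" "\<And>t x. t \<le> 0 \<Longrightarrow> norm (flow A t x) \<le> C * exp (k * t) * norm x"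
      using flow_contract[OF pos] by blast
    have "norm (to_wo (flow A t (of_wo x))) \<le> C * exp (k * t) * norm x" if "t \<le> 0" for t x
      using C(3)[OF that, of "of_wo x"] by simp
    then show ?thesis using C by blast
  qed
  show "visual_gauge A g (of_wo 0) = 0" by (simp add: lin visual_gauge_props(1)[of A g, OF pos g])
  show "0 < visual_gauge A g (of_wo x)" if "x \<noteq> 0" for x
  proof (rule visual_gauge_props(2)[of A g, OF pos g])
    show "of_wo x \<noteq> 0" using that by (metis norm_eq_zero norm_wo(1))
  qed
  show "visual_gauge A g (of_wo (- x)) = visual_gauge A g (of_wo x)" for x
    by (simp add: lin visual_gauge_props(3)[of A g, OF pos g])
  show "visual_gauge A g (of_wo (to_wo (flow A t (of_wo x)))) = exp t * visual_gauge A g (of_wo x)" for t x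
    by (simp add: visual_gauge_props(4)[of A g, OF pos g])
  show "\<exists>c>0. \<exists>C. \<forall>x. visual_gauge A g (of_wo x) = 1 \<longrightarrow> c \<le> norm x \<and> norm x \<le> C"
  proof -
    obtain l u where lu: "l > 0" "u > 0" "\<And>x. l * norm x \<le> identity_norm g x" "\<And>x. identity_norm g x \<le> u * norm x"
      using identity_norm_props(3)[of g, OF g] by blast
    have "1 / u \<le> norm x \<and> norm x \<le> 1 / l" if "visual_gauge A g (of_wo x) = 1" for x
      using visual_gauge_props(5)[of A g, OF pos g that] lu(3)[of "of_wo x"] lu(4)[of "of_wo x"] lu(1,2)
      by (simp add: field_simps)
    then show ?thesis using lu(2) by (intro exI[of _ "1 / u"] conjI exI[of _ "1 / l"]) auto
  qed
qed

text \<open>A continuous injective function on an interval is strictly monotone. If the zero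
  \<open>p\<close> of \<open>eta\<close> were positive, \<open>eta\<close> would be negative on one
  side of \<open>p\<close>; so \<open>p = 0\<close>, and nonnegativity makes \<open>eta\<close>
  increasing.\<close>

lemma homeomorphism_halfline_mono:
  fixes eta :: "real \<Rightarrow> real"
  assumes "homeomorphism {0..} {0..} eta eta'"
  shows "eta 0 = 0" "0 \<le> x \<Longrightarrow> x \<le> y \<Longrightarrow> eta x \<le> eta y"
proof -
  have cont: "continuous_on {0..} eta" and im: "eta ` {0..} = {0..}" and inv: "\<And>x. x \<ge> 0 \<Longrightarrow> eta' (eta x) = x"
    using assms unfolding homeomorphism_def by auto
  have inj: "inj_on eta {0..}" using inv by (metis atLeast_iff inj_onI)
  have nn: "eta x \<ge> 0" if "x \<ge> 0" for x using im that by auto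
  have mono: "(eta a < eta x \<and> eta x < eta b) \<or> (eta b < eta x \<and> eta x < eta a)" if "0 \<le> a" "a < x" "x < b" for a x b
    by (rule continuous_inj_imp_mono[OF that(2,3)])
       (use that in \<open>auto intro: continuous_on_subset[OF cont] inj_on_subset[OF inj]\<close>)
  obtain p where p: "p \<ge> 0" "eta p = 0" using im by (metis atLeast_iff imageE order_refl)
  have "p = 0"
  proof (rule ccontr)
    assume "p \<noteq> 0"
    then show False using mono[of 0 p "p + 1"] p nn[of 0] nn[of "p + 1"] by auto
  qed
  then show e0: "eta 0 = 0" using p by simp
  assume that: "0 \<le> x" "x \<le> y"
  show "eta x \<le> eta y"
  proof (cases "x = 0 \<or> x = y")
    case True
    then show ?thesis using e0 nn[of y] that by (elim disjE) simp_all
  next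
    case False
    then show ?thesis using mono[of 0 x y] that e0 nn[of y] by auto
  qed
qed

text \<open>The first claim comes from monotonicity of the control function, the second, which
  concerns the inverse map, from its smallness near 0. Coincident points are treated separately,
  because quasisymmetry speaks of distinct triples.\<close>

lemma quasisymmetric_weak_qs:
  assumes qs: "quasisymmetric rho rho' F"
    and rho: "\<And>x y. rho x y \<ge> (0::real)" "\<And>x y. rho x y = 0 \<longleftrightarrow> x = y"
    and rho': "\<And>x y. rho' x y \<ge> (0::real)" "\<And>x y. rho' x y = 0 \<longleftrightarrow> x = y"
  shows "\<exists>K'>0. \<forall>x y z. rho x y \<le> K * rho x z \<longrightarrow> rho' (F x) (F y) \<le> K' * rho' (F x) (F z)"
    and "\<exists>K'>0. \<forall>x y z. rho' (F x) (F y) \<le> K * rho' (F x) (F z) \<longrightarrow> rho x y \<le> K' * rho x z"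
proof -
  obtain eta eta' where bij: "bij F" and eta: "homeomorphism {0::real..} {0::real..} eta eta'"
    and *: "\<And>x y z. x \<noteq> y \<Longrightarrow> y \<noteq> z \<Longrightarrow> x \<noteq> z \<Longrightarrow> rho' (F x) (F y) / rho' (F x) (F z) \<le> eta (rho x y / rho x z)"
    using qs unfolding quasisymmetric_def by blast
  note mono = homeomorphism_halfline_mono[OF eta]
  have rpos: "rho x y > 0" if "x \<noteq> y" for x y using rho that by (metis less_eq_real_def)
  have Finj: "F x = F y \<longleftrightarrow> x = y" for x y using bij by (simp add: bij_def inj_eq)
  have spos: "rho' (F x) (F y) > 0" if "x \<noteq> y" for x y
    using rho' that Finj by (metis less_eq_real_def)
  show "\<exists>K'>0. \<forall>x y z. rho x y \<le> K * rho x z \<longrightarrow> rho' (F x) (F y) \<le> K' * rho' (F x) (F z)"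
  proof (intro exI[of _ "max 1 (eta (max K 0))"] conjI allI impI)
    fix x y z assume le: "rho x y \<le> K * rho x z"
    let ?K = "max 1 (eta (max K 0))"
    consider "x = y" | "x \<noteq> y" "x = z" | "y = z" | "x \<noteq> y" "x \<noteq> z" "y \<noteq> z" by blast
    then show "rho' (F x) (F y) \<le> ?K * rho' (F x) (F z)"
    proof cases
      case 1
      then have "rho' (F x) (F y) = 0" using rho'(2) by simp
      then show ?thesis using rho'(1)[of "F x" "F z"] by simp
    next
      case 2
      then have "rho x y \<le> 0" using le rho(2)[of x z] by simp
      then show ?thesis using rpos[OF 2(1)] by simp
    next
      case 3
      then show ?thesis using mult_right_mono[of 1 ?K "rho' (F x) (F z)"] rho'(1) by simp
    next
      case 4
      have "rho x y / rho x z \<le> max K 0" using le rpos[OF 4(2)] by (simp add: divide_le_eq le_max_iff_disj)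
      then have "eta (rho x y / rho x z) \<le> eta (max K 0)" using rho by (intro mono(2)) auto
      then have "rho' (F x) (F y) / rho' (F x) (F z) \<le> ?K" using *[OF 4(1,3,2)] by linarith
      then show ?thesis using spos[OF 4(2)] by (simp only: pos_divide_le_eq)
    qed
  qed simp
  show "\<exists>K'>0. \<forall>x y z. rho' (F x) (F y) \<le> K * rho' (F x) (F z) \<longrightarrow> rho x y \<le> K' * rho x z"
  proof -
    define K1 where "K1 = max K 1"
    have K1: "K1 > 0" "K \<le> K1" by (auto simp: K1_def)
    \<comment> \<open>A ratio \<open>rho x z / rho x y\<close> of at most \<open>d\<close> forces an
      image ratio of at most \<open>1 / (2 * K1)\<close>. The factor 2 makes the contradiction with
      the assumed bound strict.\<close>
    have "1 / (2 * K1) \<in> eta ` {0..}" using eta K1 unfolding homeomorphism_def by auto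
    then obtain d where d: "d \<ge> 0" "eta d = 1 / (2 * K1)" by auto
    have "d \<noteq> 0" using d(2) mono(1) K1 by auto
    then have d0: "d > 0" using d(1) by simp
    let ?K = "max 1 (1 / d)"
    have "rho x y \<le> ?K * rho x z" if le: "rho' (F x) (F y) \<le> K * rho' (F x) (F z)" for x y z
    proof -
      consider "x = y" | "x \<noteq> y" "x = z" | "y = z" | "x \<noteq> y" "x \<noteq> z" "y \<noteq> z" by blast
      then show ?thesis
      proof cases
        case 1
        then have "rho x y = 0" using rho(2) by simp
        then show ?thesis using rho(1)[of x z] by simp
      next
        case 2
        then have "rho' (F x) (F y) \<le> 0" using le rho'(2)[of "F x" "F z"] by simp
        then show ?thesis using spos[OF 2(1)] by simp
      next
        case 3
        then show ?thesis using mult_right_mono[of 1 ?K "rho x z"] rho(1) by simp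
      next
        case 4
        show ?thesis
        proof (rule ccontr)
          assume "\<not> ?thesis"
          then have "1 / d * rho x z \<le> rho x y"
            using mult_right_mono[of "1 / d" ?K "rho x z"] rho(1)[of x z] by simp
          then have "rho x z / rho x y \<le> d" using d0 rpos[OF 4(1)] by (simp add: field_simps)
          then have "eta (rho x z / rho x y) \<le> 1 / (2 * K1)"
            unfolding d(2)[symmetric] using rho by (intro mono(2)) auto
          then have "rho' (F x) (F z) / rho' (F x) (F y) \<le> 1 / (2 * K1)"
            using *[of x z y] 4 by force
          then have "2 * K1 * rho' (F x) (F z) \<le> rho' (F x) (F y)"
            using K1 spos[OF 4(1)] by (simp add: field_simps)
          also have "\<dots> \<le> K1 * rho' (F x) (F z)"
            by (rule order_trans[OF le]) (use K1 rho'(1) in \<open>simp add: mult_right_mono\<close>)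
          finally show False using K1 spos[OF 4(2)] by simp
        qed
      qed
    qed
    then show ?thesis by (intro exI[of _ ?K]) auto
  qed
qed

text \<open>An eigenvector, not a generalized one, for an eigenvalue of least real part: its growth
  has no polynomial factor, so the rate is attained exactly.\<close>

lemma slow_direction:
  fixes A :: "real^'n^'n"
  obtains v C where "v \<noteq> 0" "\<And>t. norm (flow A t v) \<le> C * exp (Min (eigenvalue_re_parts A) * t)"
proof -
  have fin: "finite (spectrum (cmat_of A))" by (rule card_finite_spectrum[OF cmat_of_carrier])
  have ne: "spectrum (cmat_of A) \<noteq> {}" by (rule spectrum_non_empty[OF cmat_of_carrier]) simp
  have "Min (eigenvalue_re_parts A) \<in> eigenvalue_re_parts A"
    using fin ne by (intro Min_in) (auto simp: eigenvalue_re_parts_def)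
  then obtain z where z: "z \<in> spectrum (cmat_of A)" "Re z = Min (eigenvalue_re_parts A)"
    by (auto simp: eigenvalue_re_parts_def)
  obtain c i0 where "c i0 \<noteq> 0" "\<And>i. (\<Sum>l\<in>UNIV. of_real (A $ i $ l) * c l) = z * c i"
    by (rule eigenfunction_exists[OF z(1)]) (rule that)
  from flow_eigenvector[of A c z i0, OF this(2,1)] show ?thesis using that unfolding z(2) .
qed

lemma flow_lower_bound_Min:
  fixes A :: "real^'n^'n"
  assumes "b < Min (eigenvalue_re_parts A)"
  shows "\<exists>C. \<forall>t\<le>0. \<forall>y. norm (flow A t y) \<le> C * exp (b * t) * norm y"
proof (rule flow_lower_bound)
  fix z assume "z \<in> spectrum (cmat_of A)"
  moreover have "finite (spectrum (cmat_of A))" by (rule card_finite_spectrum[OF cmat_of_carrier])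
  ultimately have "Min (eigenvalue_re_parts A) \<le> Re z" by (simp add: eigenvalue_re_parts_def)
  then show "b < Re z" using assms by simp
qed

theorem theorem1p2:
  fixes A B :: "real^'n^'n"
    and gA gB :: "(real^'n) \<times> real \<Rightarrow> (real^'n) \<times> real \<Rightarrow> (real^'n) \<times> real \<Rightarrow> real"
    and JA :: "real Matrix.mat"
    and F :: "real^'n \<Rightarrow> real^'n"
    and lambda1 mu1 eps :: real
  assumes "\<forall>r\<in>eigenvalue_re_parts A. r > 0"
    and "\<forall>r\<in>eigenvalue_re_parts B. r > 0"
    and "admissible_metric A gA"
    and "admissible_metric B gB"
    and "lambda1 = Min (eigenvalue_re_parts A)"
    and "mu1 = Min (eigenvalue_re_parts B)"
    and "eps = lambda1 / mu1"
    and "real_part_jordan_form A JA"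
    and "\<not> (\<exists>c::real. JA = c \<cdot>\<^sub>m 1\<^sub>m CARD('n))"
    and "quasisymmetric (visual_qmetric A gA) (visual_qmetric B gB) F"
  shows "biLipschitz (\<lambda>x y. visual_qmetric A gA x y powr eps) (visual_qmetric B gB) F"
proof -
  have gA: "inner_product_form (gA (0, 0))" and gB: "inner_product_form (gB (0, 0))"
    using assms(3,4) unfolding admissible_metric_def left_invariant_metric_def by blast+
  have bij: "bij F" using assms(10) unfolding quasisymmetric_def by blast
  \<comment> \<open>Everything is moved to the well-ordered copy of the index type by the linear
    isometry \<open>to_wo\<close>, which leaves norms and growth rates unchanged.\<close>
  define TA where "TA t y = to_wo (flow A t (of_wo y))" for t y
  define TB where "TB t y = to_wo (flow B t (of_wo y))" for t y
  define rA where "rA y = visual_gauge A gA (of_wo y)" for y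
  define rB where "rB y = visual_gauge B gB (of_wo y)" for y
  interpret sA: dilation_space TA "\<lambda>y. to_wo (A *v of_wo y)" rA
    unfolding TA_def[abs_def] rA_def[abs_def] by (rule flow_dilation_space[of A gA, OF assms(1) gA])
  interpret sB: dilation_space TB "\<lambda>y. to_wo (B *v of_wo y)" rB
    unfolding TB_def[abs_def] rB_def[abs_def] by (rule flow_dilation_space[of B gB, OF assms(2) gB])
  \<comment> \<open>The quasimetric is built from \<open>x - y\<close>, while the estimates use
    \<open>y - x\<close>; the gauge is even.\<close>
  have dA: "visual_qmetric A gA x y = rA (to_wo y - to_wo x)" for x y
    using sA.rho_commute[of "to_wo x" "to_wo y"] by (simp add: visual_qmetric_gauge rA_def)
  have dB: "visual_qmetric B gB x y = rB (to_wo y - to_wo x)" for x y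
    using sB.rho_commute[of "to_wo x" "to_wo y"] by (simp add: visual_qmetric_gauge rB_def)
  have inj: "to_wo x = to_wo y \<longleftrightarrow> x = y" for x y :: "real^'n" by (metis of_to_wo(1))
  define F' where "F' y = to_wo (F (of_wo y))" for y
  define G' where "G' y = to_wo (inv_into UNIV F (of_wo y))" for y
  note wqs = quasisymmetric_weak_qs[OF assms(10), unfolded dA dB]
  have "weak_qs rA rB F'"
    unfolding weak_qs_def
  proof
    fix K
    obtain K' where "K' > 0" "\<And>x y z. rA (to_wo y - to_wo x) \<le> K * rA (to_wo z - to_wo x) \<Longrightarrow>
        rB (to_wo (F y) - to_wo (F x)) \<le> K' * rB (to_wo (F z) - to_wo (F x))"
      using wqs(1)[of K] inj by auto
    from this(1) this(2)[of "of_wo y" "of_wo x" "of_wo z" for x y z]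
    show "\<exists>K'>0. \<forall>x y z. rA (y - x) \<le> K * rA (z - x) \<longrightarrow> rB (F' y - F' x) \<le> K' * rB (F' z - F' x)"
      by (auto simp: F'_def)
  qed
  moreover have "weak_qs rB rA G'"
    unfolding weak_qs_def
  proof
    fix K
    obtain K' where "K' > 0" "\<And>x y z. rB (to_wo (F y) - to_wo (F x)) \<le> K * rB (to_wo (F z) - to_wo (F x)) \<Longrightarrow>
        rA (to_wo y - to_wo x) \<le> K' * rA (to_wo z - to_wo x)"
      using wqs(2)[of K] inj by auto
    from this(1) this(2)[of "inv_into UNIV F (of_wo y)" "inv_into UNIV F (of_wo x)" "inv_into UNIV F (of_wo z)" for x y z]
    show "\<exists>K'>0. \<forall>x y z. rB (y - x) \<le> K * rB (z - x) \<longrightarrow> rA (G' y - G' x) \<le> K' * rA (G' z - G' x)"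
      using bij by (auto simp: G'_def bij_def surj_f_inv_f)
  qed
  moreover have "G' (F' x) = x" "F' (G' x) = x" for x
    using bij by (simp_all add: F'_def G'_def bij_def surj_f_inv_f)
  ultimately interpret qs_pair TA "\<lambda>y. to_wo (A *v of_wo y)" rA TB "\<lambda>y. to_wo (B *v of_wo y)" rB F' G'
    by unfold_locales
  have fin: "finite (eigenvalue_re_parts M)" "eigenvalue_re_parts M \<noteq> {}" for M :: "real^'n^'n"
    using card_finite_spectrum(1)[OF cmat_of_carrier, of M] spectrum_non_empty[OF cmat_of_carrier, of M]
    by (auto simp: eigenvalue_re_parts_def)
  have lam: "lambda1 > 0" and mu: "mu1 > 0"
    using assms(1,2,5,6) Min_in[OF fin] by auto
  obtain b phi x1 C w w0 where b: "b \<in> eigenvalue_re_parts A" and phi: "linear phi" "phi x1 \<noteq> (0::real)"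
    "\<And>t x. \<bar>phi (flow A t x)\<bar> \<le> C * exp (b * t) * norm x"
    and w: "(w \<longlongrightarrow> w0) at_top" "w0 \<noteq> 0" "((\<lambda>s. norm (flow A s (w s)) * exp (- (b * s))) \<longlongrightarrow> 0) at_top"
    by (rule splitting_data[OF assms(8,9)]) (rule that)
  obtain vA CA where vA: "vA \<noteq> 0" "\<And>t. norm (flow A t vA) \<le> CA * exp (Min (eigenvalue_re_parts A) * t)"
    by (rule slow_direction[of A]) (rule that)
  obtain vB CB where vB: "vB \<noteq> 0" "\<And>t. norm (flow B t vB) \<le> CB * exp (Min (eigenvalue_re_parts B) * t)"
    by (rule slow_direction[of B]) (rule that)
  have "\<exists>L\<ge>1. \<forall>x y. (1 / L) * rA (y - x) powr (lambda1 / mu1) \<le> rB (F' y - F' x) \<and>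
           rB (F' y - F' x) \<le> L * rA (y - x) powr (lambda1 / mu1)"
  proof (rule biLipschitz_of_split[where phi = "\<lambda>y. phi (of_wo y)" and ?x1.0 = "to_wo x1" and Cphi = C and b = b
        and w = "\<lambda>s. to_wo (w s)" and ?w0.0 = "to_wo w0" and v = "to_wo vA" and C = CA and v' = "to_wo vB" and C' = CB])
    show "linear (\<lambda>y. phi (of_wo y))" using linear_compose[OF linear_wo(2) phi(1)] by (simp add: comp_def)
    show "phi (of_wo (to_wo x1)) \<noteq> 0" using phi(2) by simp
    show "\<bar>phi (of_wo (TA t x))\<bar> \<le> C * exp (b * t) * norm x" for t x
      using phi(3)[of t "of_wo x"] by (simp add: TA_def)
    show "b > 0" using b assms(1) by blast
    show "((\<lambda>s. to_wo (w s)) \<longlongrightarrow> to_wo w0) at_top"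
      using bounded_linear.tendsto[OF _ w(1), of to_wo] linear_wo(1) linear_conv_bounded_linear by blast
    show "((\<lambda>s. norm (TA s (to_wo (w s))) * exp (- (b * s))) \<longlongrightarrow> 0) at_top" using w(3) by (simp add: TA_def)
    show nz: "to_wo w0 \<noteq> 0" "to_wo vA \<noteq> 0" "to_wo vB \<noteq> 0"
      using w(2) vA(1) vB(1) by (metis norm_eq_zero norm_wo(2))+
    show "norm (TA s (to_wo vA)) \<le> CA * exp (lambda1 * s)" "norm (TB s (to_wo vB)) \<le> CB * exp (mu1 * s)" for s
      using vA(2) vB(2) by (simp_all add: TA_def TB_def assms(5,6))
    show "\<exists>C. \<forall>t\<le>0. \<forall>y. norm (TA t y) \<le> C * exp (b * t) * norm y" if less: "b < lambda1" for b
    proof -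
      obtain C where "\<And>t y. t \<le> 0 \<Longrightarrow> norm (flow A t y) \<le> C * exp (b * t) * norm y"
        using flow_lower_bound_Min[OF less[unfolded assms(5)]] by blast
      from this[of _ "of_wo y" for y] show ?thesis by (intro exI[of _ C]) (auto simp: TA_def)
    qed
    show "\<exists>C. \<forall>t\<le>0. \<forall>y. norm (TB t y) \<le> C * exp (b * t) * norm y" if less: "b < mu1" for b
    proof -
      obtain C where "\<And>t y. t \<le> 0 \<Longrightarrow> norm (flow B t y) \<le> C * exp (b * t) * norm y"
        using flow_lower_bound_Min[OF less[unfolded assms(6)]] by blast
      from this[of _ "of_wo y" for y] show ?thesis by (intro exI[of _ C]) (auto simp: TB_def)
    qed
  qed (use lam mu in auto)
  then obtain L where L: "L \<ge> 1" "\<And>x y. (1 / L) * rA (y - x) powr eps \<le> rB (F' y - F' x)"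
      "\<And>x y. rB (F' y - F' x) \<le> L * rA (y - x) powr eps"
    unfolding assms(7) by blast
  have "(1 / L) * visual_qmetric A gA x y powr eps \<le> visual_qmetric B gB (F x) (F y) \<and>
      visual_qmetric B gB (F x) (F y) \<le> L * visual_qmetric A gA x y powr eps" for x y
    using L(2)[of "to_wo y" "to_wo x"] L(3)[of "to_wo y" "to_wo x"]
    unfolding dA dB by (simp add: F'_def)
  then show ?thesis unfolding biLipschitz_def using bij L(1) by blast
qed

end
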